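(* Let $(H,\|\cdot\|,(e_i))$ be a computable Hilbert space, where $(e_i)$ is a computable orthonormal basis. The computable frames for $H$ are precisely the families $(U(e_k))_{k}$, where $U:H\to H$ is a computable surjective operator.
   Context: Computability conventions (representation-based computable analysis). $\Sigma$ is a finite alphabet containing $0,1$. A partial function $F:\subseteq\Sigma^\omega\to\Sigma^\omega$ is computable if a Turing machine, running forever with a one-way output tape, transforms each $p\in\mathrm{dom}(F)$ on its input tape into $F(p)$. A representation of a set $X$ is a surjective partial map $\delta:\subseteq\Sigma^\omega\to X$; $p$ with $\delta(p)=x$ is a $\delta$-name of $x$. A partial function $f:\subseteq X\to Y$ between represented spaces $(X,\delta),(Y,\delta')$ is computable (or $(\delta,\delta')$-computable) if there is a computable $F$ with $\delta'F(p)=f\delta(p)$ for all $p\in\mathrm{dom}(f\delta)$. $\mathbb{N}$ is represented by $\delta_{\mathbb N}(1^n0^\omega)=n$; a computable sequence in $X$ is a computable function $\mathbb{N}\to X$. A computable metric space $(X,d,\alpha)$ is a metric space with a dense sequence $\alpha:\mathbb{N}\to X$ such that $d\circ(\alpha\times\alpha)$ is a computable double sequence of reals; it is represented by its Cauchy representation $\delta_X(01^{n_0+1}01^{n_1+1}\dots)=\lim_i\alpha(n_i)$, defined when $(\alpha(n_i))$ converges and $d(\alpha(n_i),\alpha(n_j))<2^{-i}$ for all $j>i$. $\mathbb{R}$ carries the Cauchy representation for the standard numbering of $\mathbb{Q}$ (similarly $\mathbb{C}$ with $\mathbb{Q}[i]$). With $\mathbb{F}\in\{\mathbb{R},\mathbb{C}\}$,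 a computable Hilbert space over $\mathbb{F}$ is a separable Hilbert space $H$ with a sequence $e:\mathbb{N}\to H$ with dense linear span such that $H$ with the norm metric and the dense sequence $\alpha_e$, $\alpha_e\langle k,\langle n_0,\dots,n_k\rangle\rangle=\sum_{i=0}^k\alpha_{\mathbb F}(n_i)e_i$ ($\alpha_{\mathbb F}$ a standard numbering of $\mathbb{Q}$, resp. $\mathbb{Q}[i]$, and $\langle\cdot\rangle$ Cantor tupling), is a computable metric space; its Cauchy representation is $\delta_H$. "Operator" means linear operator; a computable operator is one computable with respect to Cauchy representations. A computable frame for $H$ is a computable sequence $(f_i)$ in $H$ that is a frame, i.e. there are constants $A,B>0$ with $A\|f\|^2\le\sum_i|\langle f,f_i\rangle|^2\le B\|f\|^2$ for all $f\in H$. *)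

theory Defs
  imports "HOL-Analysis.Analysis" "HOL-Library.Nat_Bijection"
begin

text \<open>
  The alphabet is an arbitrary type \<^emph>\<open>'s\<close> of sort \<^emph>\<open>{finite, zero_neq_one}\<close>, that is, a finite set
  with two distinguished distinct elements 0 and 1. Notions in whose type the alphabet does not
  occur take it as an extra argument of the form \<^emph>\<open>TYPE('s)\<close>.
\<close>

section \<open>Turing machines on infinite words\<close>

datatype move = MoveLeft | Stay | MoveRight

fun offset :: "move \<Rightarrow> int" where
  "offset MoveLeft = -1"
| "offset Stay = 0"
| "offset MoveRight = 1"

text \<open>
  A machine has a read-only one-way input tape, a fixed number of two-way work tapes over the
  alphabet extended by a blank (the symbol \<^emph>\<open>None\<close>), and a write-only one-way output tape. There is no
  halting state, so a machine runs forever.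

  The states are the numbers below \<^emph>\<open>num_states\<close>, with 0 the initial one. Given the current state,
  the scanned input symbol and the scanned work tape symbols, the transition function yields the
  next state, whether the input head advances, what to write and how to move on each work tape,
  and the symbol (if any) to be appended to the output.
\<close>

record 's machine =
  num_states :: nat
  num_tapes :: nat
  transition :: "nat \<Rightarrow> 's \<Rightarrow> 's option list \<Rightarrow> nat \<times> bool \<times> ('s option \<times> move) list \<times> 's option"

text \<open>
  Only finitely many values of the transition function matter for a well-formed machine, because
  the alphabet is finite and the reachable states and the number of work tapes are bounded.
\<close>

definition wf_machine :: "'s::finite machine \<Rightarrow> bool" where
  "wf_machine M \<longleftrightarrow> num_states M > 0 \<and>
     (\<forall>q < num_states M. \<forall>a w. length w = num_tapes M \<longrightarrow>
        (case transition M q a w of (q', adv, acts, out) \<Rightarrow>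
           q' < num_states M \<and> length acts = num_tapes M))"

record 's config =
  ctrl :: nat
  input_pos :: nat
  work :: "((int \<Rightarrow> 's option) \<times> int) list"  \<comment> \<open>contents and head position of each work tape\<close>
  written :: "'s list"

definition init_config :: "'s machine \<Rightarrow> 's config" where
  "init_config M = \<lparr> ctrl = 0, input_pos = 0, work = replicate (num_tapes M) (\<lambda>_. None, 0), written = [] \<rparr>"

fun update_tape :: "'s option \<times> move \<Rightarrow> (int \<Rightarrow> 's option) \<times> int \<Rightarrow> (int \<Rightarrow> 's option) \<times> int" where
  "update_tape (b, m) (T, h) = (T(h := b), h + offset m)"

definition step :: "'s machine \<Rightarrow> (nat \<Rightarrow> 's) \<Rightarrow> 's config \<Rightarrow> 's config" where
  "step M p c =
     (case transition M (ctrl c) (p (input_pos c)) (map (\<lambda>(T, h). T h) (work c)) of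
        (q, adv, acts, out) \<Rightarrow>
          \<lparr> ctrl = q,
            input_pos = (if adv then Suc (input_pos c) else input_pos c),
            work = map2 update_tape acts (work c),
            written = written c @ (case out of None \<Rightarrow> [] | Some a \<Rightarrow> [a]) \<rparr>)"

definition output_after :: "'s machine \<Rightarrow> (nat \<Rightarrow> 's) \<Rightarrow> nat \<Rightarrow> 's list" where
  "output_after M p t = written ((step M p ^^ t) (init_config M))"

definition transforms :: "'s machine \<Rightarrow> (nat \<Rightarrow> 's) \<Rightarrow> (nat \<Rightarrow> 's) \<Rightarrow> bool" where
  "transforms M p q \<longleftrightarrow>
     (\<forall>t. output_after M p t = map q [0..<length (output_after M p t)]) \<and>
     (\<forall>n. \<exists>t. length (output_after M p t) \<ge> n)"

definition computable_on_words :: "((nat \<Rightarrow> 's::finite) \<rightharpoonup> (nat \<Rightarrow> 's)) \<Rightarrow> bool" where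
  "computable_on_words F \<longleftrightarrow>
     (\<exists>M. wf_machine M \<and> (\<forall>p \<in> dom F. transforms M p (the (F p))))"


section \<open>Representations\<close>

definition representation :: "((nat \<Rightarrow> 's) \<rightharpoonup> 'x) \<Rightarrow> bool" where
  "representation \<delta> \<longleftrightarrow> ran \<delta> = UNIV"

definition computable ::
    "((nat \<Rightarrow> 's::finite) \<rightharpoonup> 'x) \<Rightarrow> ((nat \<Rightarrow> 's) \<rightharpoonup> 'y) \<Rightarrow> ('x \<rightharpoonup> 'y) \<Rightarrow> bool" where
  "computable \<delta> \<delta>' f \<longleftrightarrow>
     (\<exists>F. computable_on_words F \<and>
        (\<forall>p \<in> dom (f \<circ>\<^sub>m \<delta>). (\<delta>' \<circ>\<^sub>m F) p = (f \<circ>\<^sub>m \<delta>) p))"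

definition nat_name :: "nat \<Rightarrow> nat \<Rightarrow> 's::zero_neq_one" where
  "nat_name n = (\<lambda>i. if i < n then 1 else 0)"

definition nat_rep :: "(nat \<Rightarrow> 's::zero_neq_one) \<rightharpoonup> nat" where
  "nat_rep p = (if \<exists>n. p = nat_name n then Some (THE n. p = nat_name n) else None)"

text \<open>The two components of a name of a pair are interleaved.\<close>

definition prod_rep ::
    "((nat \<Rightarrow> 's) \<rightharpoonup> 'x) \<Rightarrow> ((nat \<Rightarrow> 's) \<rightharpoonup> 'y) \<Rightarrow> ((nat \<Rightarrow> 's) \<rightharpoonup> 'x \<times> 'y)" where
  "prod_rep \<delta> \<delta>' p =
     (case (\<delta> (\<lambda>n. p (2 * n)), \<delta>' (\<lambda>n. p (2 * n + 1))) of
        (Some x, Some y) \<Rightarrow> Some (x, y)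
      | _ \<Rightarrow> None)"

definition computable_sequence ::
    "((nat \<Rightarrow> 's::{finite, zero_neq_one}) \<rightharpoonup> 'x) \<Rightarrow> (nat \<Rightarrow> 'x) \<Rightarrow> bool" where
  "computable_sequence \<delta> f \<longleftrightarrow> computable nat_rep \<delta> (\<lambda>n. Some (f n))"

definition computable_double_sequence ::
    "((nat \<Rightarrow> 's::{finite, zero_neq_one}) \<rightharpoonup> 'x) \<Rightarrow> (nat \<Rightarrow> nat \<Rightarrow> 'x) \<Rightarrow> bool" where
  "computable_double_sequence \<delta> f \<longleftrightarrow>
     computable (prod_rep nat_rep nat_rep) \<delta> (\<lambda>(i, j). Some (f i j))"

lemma nat_name_inject:
  assumes "(nat_name m :: nat \<Rightarrow> 's::zero_neq_one) = nat_name n"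
  shows "m = n"
proof -
  have *: "(i < m) = (i < n)" for i
    using fun_cong[OF assms, of i] by (auto simp: nat_name_def split: if_splits)
  show ?thesis
    using *[of m] *[of n] by auto
qed

lemma nat_rep_eq_Some_iff: "nat_rep (p :: nat \<Rightarrow> 'a::zero_neq_one) = Some n \<longleftrightarrow> p = nat_name n"
proof -
  have "(THE m. (nat_name k :: nat \<Rightarrow> 'a) = nat_name m) = k" for k
    by (rule the_equality) (auto dest: nat_name_inject)
  then show ?thesis
    unfolding nat_rep_def by auto
qed

lemma representation_nat_rep: "representation (nat_rep :: (nat \<Rightarrow> 's::zero_neq_one) \<rightharpoonup> nat)"
  unfolding representation_def ran_def by (auto simp: nat_rep_eq_Some_iff)


section \<open>Computable metric spaces\<close>

text \<open>
  The word $01^{n_0+1}01^{n_1+1}\ldots$ has the symbol 0 exactly at the starting positions of the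
  blocks $01^{n_i+1}$.
\<close>

definition block_start :: "(nat \<Rightarrow> nat) \<Rightarrow> nat \<Rightarrow> nat" where
  "block_start n i = (\<Sum>j<i. n j + 2)"

definition seq_name :: "(nat \<Rightarrow> nat) \<Rightarrow> nat \<Rightarrow> 's::zero_neq_one" where
  "seq_name n = (\<lambda>k. if k \<in> range (block_start n) then 0 else 1)"

definition is_cauchy_name ::
    "(nat \<Rightarrow> 'x::metric_space) \<Rightarrow> 'x \<Rightarrow> (nat \<Rightarrow> 's::zero_neq_one) \<Rightarrow> bool" where
  "is_cauchy_name \<alpha> x p \<longleftrightarrow>
     (\<exists>n. p = seq_name n \<and> (\<lambda>i. \<alpha> (n i)) \<longlonglongrightarrow> x \<and>
        (\<forall>i j. i < j \<longrightarrow> dist (\<alpha> (n i)) (\<alpha> (n j)) < 1 / 2 ^ i))"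

definition cauchy_rep :: "(nat \<Rightarrow> 'x::metric_space) \<Rightarrow> ((nat \<Rightarrow> 's::zero_neq_one) \<rightharpoonup> 'x)" where
  "cauchy_rep \<alpha> p =
     (if \<exists>x. is_cauchy_name \<alpha> x p then Some (THE x. is_cauchy_name \<alpha> x p) else None)"

text \<open>
  Codes of tuples are built from the library's Cantor pairing function, with
  $\langle n\rangle = n$ and $\langle n_0,\ldots,n_{k+1}\rangle =
  \langle n_0,\langle n_1,\ldots,n_{k+1}\rangle\rangle$. The inverse needs to be told the length;
  the first argument is the largest index, not the length.
\<close>

fun tuple :: "nat list \<Rightarrow> nat" where
  "tuple [] = 0"
| "tuple [n] = n"
| "tuple (n # m # ns) = prod_encode (n, tuple (m # ns))"

fun untuple :: "nat \<Rightarrow> nat \<Rightarrow> nat list" where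
  "untuple 0 c = [c]"
| "untuple (Suc k) c = (case prod_decode c of (n, c') \<Rightarrow> n # untuple k c')"

definition rat_numbering :: "nat \<Rightarrow> real" where
  "rat_numbering c =
     (let ns = untuple 2 c in (real (ns ! 0) - real (ns ! 1)) / (real (ns ! 2) + 1))"

definition real_rep :: "(nat \<Rightarrow> 's::zero_neq_one) \<rightharpoonup> real" where
  "real_rep = cauchy_rep rat_numbering"

definition computable_metric_space ::
    "'s::{finite, zero_neq_one} itself \<Rightarrow> (nat \<Rightarrow> 'x::metric_space) \<Rightarrow> bool" where
  "computable_metric_space _ \<alpha> \<longleftrightarrow>
     closure (range \<alpha>) = UNIV \<and>
     computable_double_sequence (real_rep :: (nat \<Rightarrow> 's) \<rightharpoonup> real) (\<lambda>i j. dist (\<alpha> i) (\<alpha> j))"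

lemma untuple_tuple: "length ns = Suc k \<Longrightarrow> untuple k (tuple ns) = ns"
proof (induction k arbitrary: ns)
  case 0
  then obtain n where "ns = [n]" by (auto simp: length_Suc_conv)
  then show ?case by simp
next
  case (Suc k)
  then obtain n m ms where ns: "ns = n # m # ms" by (auto simp: length_Suc_conv)
  with Suc show ?case by simp
qed

lemma strict_mono_block_start: "strict_mono (block_start n)"
  by (rule strict_mono_Suc_iff[THEN iffD2]) (simp add: block_start_def)

lemma seq_name_inject:
  assumes eq: "(seq_name m :: nat \<Rightarrow> 's::zero_neq_one) = seq_name n"
  shows "m = n"
proof -
  have ran: "range (block_start m) = range (block_start n)"
  proof (rule set_eqI)
    fix k
    show "k \<in> range (block_start m) \<longleftrightarrow> k \<in> range (block_start n)"
      using fun_cong[OF eq, of k] by (auto simp: seq_name_def split: if_splits)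
  qed
  have "block_start m i = block_start n i" for i
  proof (induction i rule: less_induct)
    case (less i)
    have *: "block_start b i \<le> block_start a i"
      if ab: "range (block_start a) = range (block_start b)"
        and IH: "\<And>j. j < i \<Longrightarrow> block_start a j = block_start b j" for a b
    proof -
      obtain j where j: "block_start a i = block_start b j"
        using ab by (metis rangeE rangeI)
      have "\<not> j < i"
        using IH[of j] j strict_mono_less[OF strict_mono_block_start[of a], of j i] by auto
      then show ?thesis
        using j strict_mono_less_eq[OF strict_mono_block_start[of b], of i j] by simp
    qed
    show ?case
      using *[OF ran] *[OF ran[symmetric]] less by (metis order.antisym)
  qed
  then have "block_start m (Suc i) - block_start m i = block_start n (Suc i) - block_start n i" for i
    by simp
  then show ?thesis
    by (intro ext) (simp add: block_start_def)
qed

lemma cauchy_rep_eq_Some_iff: "cauchy_rep \<alpha> p = Some x \<longleftrightarrow> is_cauchy_name \<alpha> x p"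
proof -
  have uniq: "x = y" if "is_cauchy_name \<alpha> x p" "is_cauchy_name \<alpha> y p" for x y
    using that unfolding is_cauchy_name_def by (metis LIMSEQ_unique seq_name_inject)
  then have "(THE x. is_cauchy_name \<alpha> x p) = x" if "is_cauchy_name \<alpha> x p" for x
    using that by blast
  then show ?thesis
    unfolding cauchy_rep_def by auto
qed

lemma representation_cauchy_rep:
  fixes \<alpha> :: "nat \<Rightarrow> 'x::metric_space"
  assumes dense: "closure (range \<alpha>) = UNIV"
  shows "representation (cauchy_rep \<alpha> :: (nat \<Rightarrow> 's::zero_neq_one) \<rightharpoonup> 'x)"
proof -
  have "\<exists>p. cauchy_rep \<alpha> (p :: nat \<Rightarrow> 's) = Some x" for x
  proof -
    have "\<exists>k. dist (\<alpha> k) x < 1 / 2 ^ (Suc i)" for i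
    proof -
      have "x \<in> closure (range \<alpha>)" using dense by simp
      then have "\<exists>y\<in>range \<alpha>. dist y x < 1 / 2 ^ (Suc i)"
        unfolding closure_approachable by (metis half_gt_zero zero_less_divide_1_iff zero_less_numeral zero_less_power)
      then show ?thesis by blast
    qed
    then obtain n where n: "\<And>i. dist (\<alpha> (n i)) x < 1 / 2 ^ (Suc i)" by metis
    have lim: "(\<lambda>i. \<alpha> (n i)) \<longlonglongrightarrow> x"
    proof (rule metric_tendsto_imp_tendsto[where f = "\<lambda>i. (1/2::real) ^ i" and a = 0])
      show "(\<lambda>i. (1/2::real) ^ i) \<longlonglongrightarrow> 0" by (rule LIMSEQ_realpow_zero) auto
      have "dist (\<alpha> (n i)) x \<le> dist ((1/2::real) ^ i) 0" for i
      proof -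
        have "1 / 2 ^ Suc i \<le> (1/2::real) ^ i" by (simp add: field_simps)
        then show ?thesis using n[of i] by (simp add: dist_real_def)
      qed
      then show "\<forall>\<^sub>F i in sequentially. dist (\<alpha> (n i)) x \<le> dist ((1/2::real) ^ i) 0" by simp
    qed
    have "dist (\<alpha> (n i)) (\<alpha> (n j)) < 1 / 2 ^ i" if "i < j" for i j
    proof -
      have "(1::real) / 2 ^ Suc j \<le> 1 / 2 ^ Suc i"
        using that by (intro divide_left_mono power_increasing) auto
      moreover have "dist (\<alpha> (n i)) (\<alpha> (n j)) \<le> dist (\<alpha> (n i)) x + dist (\<alpha> (n j)) x"
        by (rule dist_triangle2)
      moreover have "(1::real) / 2 ^ Suc i + 1 / 2 ^ Suc i = 1 / 2 ^ i" by simp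
      ultimately show ?thesis using n[of i] n[of j] by linarith
    qed
    with lim have "is_cauchy_name \<alpha> x (seq_name n :: nat \<Rightarrow> 's)"
      unfolding is_cauchy_name_def by blast
    then show ?thesis by (auto simp: cauchy_rep_eq_Some_iff)
  qed
  then show ?thesis
    unfolding representation_def ran_def by blast
qed


section \<open>Hilbert spaces over the real or complex numbers\<close>

text \<open>
  The scalar field is \<^emph>\<open>real\<close> or \<^emph>\<open>complex\<close>, treated uniformly: the axioms say that the
  normed field is isomorphic to one of the two, realised as a subfield of the complex numbers.
\<close>

class real_or_complex = real_normed_field +
  fixes to_complex :: "'a \<Rightarrow> complex"
  assumes to_complex_add: "to_complex (x + y) = to_complex x + to_complex y"
    and to_complex_mult: "to_complex (x * y) = to_complex x * to_complex y"
    and to_complex_scaleR: "to_complex (r *\<^sub>R x) = r *\<^sub>R to_complex x"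
    and norm_to_complex: "norm (to_complex x) = norm x"
    and range_to_complex: "range to_complex = \<real> \<or> range to_complex = UNIV"

instantiation real :: real_or_complex
begin
definition to_complex_real :: "real \<Rightarrow> complex" where "to_complex_real = complex_of_real"
instance by standard (auto simp: to_complex_real_def Reals_def scaleR_conv_of_real)
end

instantiation complex :: real_or_complex
begin
definition to_complex_complex :: "complex \<Rightarrow> complex" where "to_complex_complex = id"
instance by standard (auto simp: to_complex_complex_def)
end

definition gauss_rat_numbering :: "nat \<Rightarrow> complex" where
  "gauss_rat_numbering c = (case prod_decode c of (a, b) \<Rightarrow> Complex (rat_numbering a) (rat_numbering b))"

definition scalar_numbering :: "nat \<Rightarrow> 'f::real_or_complex" where
  "scalar_numbering c =
     (if range (to_complex :: 'f \<Rightarrow> complex) = UNIV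
      then inv to_complex (gauss_rat_numbering c)
      else of_real (rat_numbering c))"

lemma scalar_numbering_real: "(scalar_numbering :: nat \<Rightarrow> real) = rat_numbering"
proof -
  have "\<i> \<notin> range complex_of_real"
    by (metis Im_complex_of_real imaginary_unit.simps(2) rangeE zero_neq_one)
  then show ?thesis
    by (intro ext) (auto simp: scalar_numbering_def to_complex_real_def)
qed

lemma scalar_numbering_complex: "(scalar_numbering :: nat \<Rightarrow> complex) = gauss_rat_numbering"
  by (intro ext) (simp add: scalar_numbering_def to_complex_complex_def)

text \<open>
  Norm, metric and completeness are those of the type \<^emph>\<open>'h\<close>; the inner product is linear in its
  first argument.
\<close>

locale hilbert_space = vector_space smul
  for smul :: "'f::real_or_complex \<Rightarrow> 'h::banach \<Rightarrow> 'h" +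
  fixes ip :: "'h \<Rightarrow> 'h \<Rightarrow> 'f"
  assumes smul_of_real: "smul (of_real r) x = r *\<^sub>R x"
    and ip_add_left: "ip (x + y) z = ip x z + ip y z"
    and ip_scale_left: "ip (smul a x) y = a * ip x y"
    and ip_cnj: "to_complex (ip y x) = cnj (to_complex (ip x y))"
    and ip_self: "ip x x = of_real ((norm x)\<^sup>2)"

lemma hilbert_space_real:
  "hilbert_space (scaleR :: real \<Rightarrow> 'h \<Rightarrow> 'h) (inner :: 'h::{real_inner, banach} \<Rightarrow> 'h \<Rightarrow> real)"
  by unfold_locales
    (simp_all add: scaleR_add_left scaleR_add_right inner_add_left to_complex_real_def
      power2_norm_eq_inner, simp add: inner_commute)

lemma hilbert_space_complex: "hilbert_space ((*) :: complex \<Rightarrow> complex \<Rightarrow> complex) (\<lambda>x y. x * cnj y)"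
  by unfold_locales
    (simp_all add: algebra_simps scaleR_conv_of_real to_complex_complex_def
      complex_norm_square[unfolded of_real_power])

definition rational_combination :: "('f::real_or_complex \<Rightarrow> 'h \<Rightarrow> 'h) \<Rightarrow> (nat \<Rightarrow> 'h) \<Rightarrow> nat \<Rightarrow> 'h::banach" where
  "rational_combination smul e c =
     (case prod_decode c of (k, t) \<Rightarrow>
        \<Sum>i\<le>k. smul (scalar_numbering (untuple k t ! i)) (e i))"

definition hilbert_rep ::
    "('f::real_or_complex \<Rightarrow> 'h \<Rightarrow> 'h) \<Rightarrow> (nat \<Rightarrow> 'h) \<Rightarrow> ((nat \<Rightarrow> 's::zero_neq_one) \<rightharpoonup> 'h::banach)" where
  "hilbert_rep smul e = cauchy_rep (rational_combination smul e)"

definition computable_hilbert_space ::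
    "'s::{finite, zero_neq_one} itself \<Rightarrow> ('f::real_or_complex \<Rightarrow> 'h::banach \<Rightarrow> 'h) \<Rightarrow>
     ('h \<Rightarrow> 'h \<Rightarrow> 'f) \<Rightarrow> (nat \<Rightarrow> 'h) \<Rightarrow> bool" where
  "computable_hilbert_space S smul ip e \<longleftrightarrow>
     hilbert_space smul ip \<and>
     closure (module.span smul (range e)) = UNIV \<and>
     computable_metric_space S (rational_combination smul e)"

definition orthonormal_basis ::
    "('f::real_or_complex \<Rightarrow> 'h::banach \<Rightarrow> 'h) \<Rightarrow> ('h \<Rightarrow> 'h \<Rightarrow> 'f) \<Rightarrow> (nat \<Rightarrow> 'h) \<Rightarrow> bool" where
  "orthonormal_basis smul ip b \<longleftrightarrow>
     (\<forall>i j. ip (b i) (b j) = (if i = j then 1 else 0)) \<and>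
     closure (module.span smul (range b)) = UNIV"

definition is_frame :: "('h::banach \<Rightarrow> 'h \<Rightarrow> 'f::real_or_complex) \<Rightarrow> (nat \<Rightarrow> 'h) \<Rightarrow> bool" where
  "is_frame ip f \<longleftrightarrow>
     (\<exists>A B. A > 0 \<and> B > 0 \<and>
        (\<forall>x. summable (\<lambda>i. (norm (ip x (f i)))\<^sup>2) \<and>
             A * (norm x)\<^sup>2 \<le> (\<Sum>i. (norm (ip x (f i)))\<^sup>2) \<and>
             (\<Sum>i. (norm (ip x (f i)))\<^sup>2) \<le> B * (norm x)\<^sup>2))"

text \<open>
  In the following three notions, \<^emph>\<open>e\<close> is the sequence that determines the computable structure
  of the Hilbert space.
\<close>

definition computable_hilbert_sequence ::
    "'s::{finite, zero_neq_one} itself \<Rightarrow> ('f::real_or_complex \<Rightarrow> 'h::banach \<Rightarrow> 'h) \<Rightarrow>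
     (nat \<Rightarrow> 'h) \<Rightarrow> (nat \<Rightarrow> 'h) \<Rightarrow> bool" where
  "computable_hilbert_sequence _ smul e f \<longleftrightarrow>
     computable_sequence (hilbert_rep smul e :: (nat \<Rightarrow> 's) \<rightharpoonup> 'h) f"

definition computable_frame ::
    "'s::{finite, zero_neq_one} itself \<Rightarrow> ('f::real_or_complex \<Rightarrow> 'h::banach \<Rightarrow> 'h) \<Rightarrow>
     ('h \<Rightarrow> 'h \<Rightarrow> 'f) \<Rightarrow> (nat \<Rightarrow> 'h) \<Rightarrow> (nat \<Rightarrow> 'h) \<Rightarrow> bool" where
  "computable_frame S smul ip e f \<longleftrightarrow> computable_hilbert_sequence S smul e f \<and> is_frame ip f"

definition computable_operator ::
    "'s::{finite, zero_neq_one} itself \<Rightarrow> ('f::real_or_complex \<Rightarrow> 'h::banach \<Rightarrow> 'h) \<Rightarrow>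
     (nat \<Rightarrow> 'h) \<Rightarrow> ('h \<Rightarrow> 'h) \<Rightarrow> bool" where
  "computable_operator _ smul e U \<longleftrightarrow>
     Vector_Spaces.linear smul smul U \<and>
     computable (hilbert_rep smul e :: (nat \<Rightarrow> 's) \<rightharpoonup> 'h) (hilbert_rep smul e) (\<lambda>x. Some (U x))"

end

theory Submission
  imports Defs
begin

text \<open>
  The theorem combines an analytic fact with an effective one.

  The analytic fact is that, for an orthonormal basis \<^emph>\<open>e\<close>, the equation \<^emph>\<open>U (e k) = f k\<close> relates the
  bounded surjective operators \<^emph>\<open>U\<close> with the frames \<^emph>\<open>f\<close>. If \<^emph>\<open>f\<close> is a frame, the upper frame bound
  makes the synthesis operator \<^emph>\<open>U x = (\<Sum>k. \<langle>x, e k\<rangle> f k)\<close> converge and be bounded, while the lower bound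
  makes the frame operator \<^emph>\<open>S x = (\<Sum>k. \<langle>x, f k\<rangle> f k)\<close> coercive; then \<^emph>\<open>x \<mapsto> x - t (S x - y)\<close> is a contraction
  for a small \<^emph>\<open>t\<close>, its fixed point solves \<^emph>\<open>S x = y\<close>, and \<^emph>\<open>U\<close> is onto because its range contains that of
  \<^emph>\<open>S\<close> (lemma synthesis_operator). If \<^emph>\<open>U\<close> is bounded and onto, the upper frame bound is immediate. For
  the lower one, consider the \<^emph>\<open>z\<close> with \<^emph>\<open>(\<Sum>k. |\<langle>z, U (e k)\<rangle>|^2) \<le> 1\<close>: every vector has the form \<^emph>\<open>U y\<close>, and
  \<^emph>\<open>|\<langle>U y, z\<rangle>| \<le> \<parallel>y\<parallel>\<close>, so these \<^emph>\<open>z\<close> are weakly bounded and hence, by uniform boundedness, bounded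
  (lemma frame_of_surjective).

  The effective fact is that \<^emph>\<open>U\<close> is computable if and only if it is bounded and \<^emph>\<open>k \<mapsto> U (e k)\<close> is a
  computable sequence. A computable operator is bounded because a machine writes the first
  approximation to \<^emph>\<open>U 0\<close> after reading finitely many symbols of a name of \<^emph>\<open>0\<close>, and these symbols also begin
  names of all vectors close to \<^emph>\<open>0\<close> (lemma computable_locally_bounded). Conversely, a
  rational combination \<^emph>\<open>\<Sum>j. q j e j\<close> is mapped by \<^emph>\<open>U\<close> to \<^emph>\<open>\<Sum>j. q j U (e j)\<close>, which can be approximated by
  replacing \<^emph>\<open>U (e j)\<close> with rational combinations taken from its name; the precision needed can be read
  off the code of the combination, and a bound on the norm of \<^emph>\<open>U\<close> only shifts the index by a constant
  (lemma computable_of_bounded).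

  Turing machines are handled through the class \<^emph>\<open>recursive\<close> of total number-theoretic functions.
  Every recursive function is computed by a program over counters, and a counter is a work tape whose
  head is as far from a mark as the counter says; this yields machines that translate names of the two
  kinds that occur, words \<^emph>\<open>1\<dots>10\<dots>\<close> for numbers and Cauchy names, block by block (lemmas
  computable_block_map and computable_block_sequence). In the other direction, the runs of an
  arbitrary machine on a recursively given sequence of inputs are described by recursive functions
  (lemma simulation). So the computable sequences are those with a recursive double sequence of
  approximations (lemma computable_sequence_iff), the composition of computable maps with computable
  sequences requires no construction of a composite machine, and computing \<^emph>\<open>U\<close> amounts to arithmetic on
  codes of rational combinations (lemma combination_of_combinations).
\<close>

section \<open>Counter programs\<close>

text \<open>
  Programs over counters holding natural numbers, with an input that is read from left to right and
  an output that is only appended to. \<^emph>\<open>Branch\<close> and \<^emph>\<open>While\<close> test whether a counter is nonzero, and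
  \<^emph>\<open>WhileInput\<close> tests whether the scanned input symbol differs from 0. These tests are all that a machine
  sees of a counter that it represents by the position of a head.
\<close>

datatype com =
    Inc nat | Dec nat | Seq com com | Branch nat com com | While nat com
  | WhileInput com | Advance | Emit bool

text \<open>
  Counter values, input position and output.
\<close>

type_synonym store = "(nat \<Rightarrow> nat) \<times> nat \<times> bool list"

text \<open>
  The control state is the stack of programs that remain to be run. A body is repeated forever, since
  machines do not halt: the empty stack starts the next round. The result consists of the next stack,
  whether the input advances, the change of each counter as a head movement, and the output.
\<close>

fun control :: "com \<Rightarrow> com list \<Rightarrow> (nat \<Rightarrow> bool) \<Rightarrow> bool \<Rightarrow>
    com list \<times> bool \<times> (nat \<Rightarrow> move) \<times> bool option" where
  "control body [] nz a = ([body], False, (\<lambda>_. Stay), None)"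
| "control body (Inc r # K) nz a = (K, False, (\<lambda>_. Stay)(r := MoveRight), None)"
| "control body (Dec r # K) nz a =
     (K, False, (\<lambda>_. Stay)(r := if nz r then MoveLeft else Stay), None)"
| "control body (Seq c d # K) nz a = (c # d # K, False, (\<lambda>_. Stay), None)"
| "control body (Branch r c d # K) nz a = ((if nz r then c else d) # K, False, (\<lambda>_. Stay), None)"
| "control body (While r c # K) nz a =
     (if nz r then c # While r c # K else K, False, (\<lambda>_. Stay), None)"
| "control body (WhileInput c # K) nz a =
     (if a then c # WhileInput c # K else K, False, (\<lambda>_. Stay), None)"
| "control body (Advance # K) nz a = (K, True, (\<lambda>_. Stay), None)"
| "control body (Emit b # K) nz a = (K, False, (\<lambda>_. Stay), Some b)"

fun shift :: "move \<Rightarrow> nat \<Rightarrow> nat" where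
  "shift MoveLeft n = n - 1"
| "shift Stay n = n"
| "shift MoveRight n = Suc n"

fun cstep :: "(nat \<Rightarrow> bool) \<Rightarrow> com \<Rightarrow> com list \<times> store \<Rightarrow> com list \<times> store" where
  "cstep w body (K, R, i, out) =
     (case control body K (\<lambda>r. R r \<noteq> 0) (w i) of (K', adv, mv, b) \<Rightarrow>
        (K', (\<lambda>r. shift (mv r) (R r)), if adv then Suc i else i,
         out @ (case b of None \<Rightarrow> [] | Some x \<Rightarrow> [x])))"

definition reaches :: "(nat \<Rightarrow> bool) \<Rightarrow> com \<Rightarrow> com list \<times> store \<Rightarrow> com list \<times> store \<Rightarrow> bool" where
  "reaches w body x y \<longleftrightarrow> (\<exists>t. (cstep w body ^^ t) x = y)"

lemma reaches_refl: "reaches w body x x"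
  unfolding reaches_def by (rule exI[of _ 0]) simp

lemma reaches_trans: "reaches w body x y \<Longrightarrow> reaches w body y z \<Longrightarrow> reaches w body x z"
  unfolding reaches_def by (metis comp_apply funpow_add)

lemma reaches_step: "reaches w body (cstep w body x) y \<Longrightarrow> reaches w body x y"
  unfolding reaches_def by (metis funpow_Suc_right comp_apply)

lemma reaches_one: "cstep w body x = y \<Longrightarrow> reaches w body x y"
  by (metis reaches_step reaches_refl)

text \<open>
  The quantification over the body and the rest of the stack expresses that a program runs in the same way
  in every context. It makes the rules for composite programs below compositional.
\<close>

definition exec :: "(nat \<Rightarrow> bool) \<Rightarrow> com \<Rightarrow> store \<Rightarrow> store \<Rightarrow> bool" where
  "exec w c s s' \<longleftrightarrow> (\<forall>body K. reaches w body (c # K, s) (K, s'))"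

lemma exec_Inc: "exec w (Inc r) (R, i, out) (R(r := Suc (R r)), i, out)"
  unfolding exec_def by (auto intro!: reaches_one simp: fun_eq_iff)

lemma exec_Dec: "exec w (Dec r) (R, i, out) (R(r := R r - 1), i, out)"
  unfolding exec_def by (auto intro!: reaches_one simp: fun_eq_iff)

lemma exec_Advance: "exec w Advance (R, i, out) (R, Suc i, out)"
  unfolding exec_def by (auto intro!: reaches_one simp: fun_eq_iff)

lemma exec_Emit: "exec w (Emit b) (R, i, out) (R, i, out @ [b])"
  unfolding exec_def by (auto intro!: reaches_one simp: fun_eq_iff)

lemma exec_Seq:
  assumes "exec w c s s'" and "exec w d s' s''"
  shows "exec w (Seq c d) s s''"
  unfolding exec_def
proof (intro allI)
  fix body K
  have "reaches w body (Seq c d # K, s) (c # d # K, s)" by (cases s) (auto intro: reaches_one)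
  then show "reaches w body (Seq c d # K, s) (K, s'')"
    using assms unfolding exec_def by (meson reaches_trans)
qed

lemma exec_Branch:
  assumes "exec w (if fst s r \<noteq> 0 then c else d) s s'"
  shows "exec w (Branch r c d) s s'"
  unfolding exec_def
proof (intro allI)
  fix body K
  have "reaches w body (Branch r c d # K, s) ((if fst s r \<noteq> 0 then c else d) # K, s)"
    by (cases s) (auto intro: reaches_one)
  then show "reaches w body (Branch r c d # K, s) (K, s')"
    using assms unfolding exec_def by (meson reaches_trans)
qed

lemma exec_While_False: "fst s r = 0 \<Longrightarrow> exec w (While r c) s s"
  unfolding exec_def by (cases s) (auto intro!: reaches_one)

lemma exec_While_True:
  assumes "fst s r \<noteq> 0" and "exec w c s s'" and "exec w (While r c) s' s''"
  shows "exec w (While r c) s s''"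
  unfolding exec_def
proof (intro allI)
  fix body K
  have "reaches w body (While r c # K, s) (c # While r c # K, s)"
    using assms(1) by (cases s) (auto intro: reaches_one)
  then show "reaches w body (While r c # K, s) (K, s'')"
    using assms(2,3) unfolding exec_def by (meson reaches_trans)
qed

lemma exec_WhileInput_False: "\<not> w (fst (snd s)) \<Longrightarrow> exec w (WhileInput c) s s"
  unfolding exec_def by (cases s) (auto intro!: reaches_one)

lemma exec_WhileInput_True:
  assumes "w (fst (snd s))" and "exec w c s s'" and "exec w (WhileInput c) s' s''"
  shows "exec w (WhileInput c) s s''"
  unfolding exec_def
proof (intro allI)
  fix body K
  have "reaches w body (WhileInput c # K, s) (c # WhileInput c # K, s)"
    using assms(1) by (cases s) (auto intro: reaches_one)
  then show "reaches w body (WhileInput c # K, s) (K, s'')"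
    using assms(2,3) unfolding exec_def by (meson reaches_trans)
qed

lemma exec_While_iterate:
  assumes "\<And>i. i < n \<Longrightarrow> fst (\<sigma> i) r \<noteq> 0 \<and> exec w c (\<sigma> i) (\<sigma> (Suc i))" and "fst (\<sigma> n) r = 0"
  shows "exec w (While r c) (\<sigma> 0) (\<sigma> n)"
  using assms
proof (induction n arbitrary: \<sigma>)
  case 0
  then show ?case by (simp add: exec_While_False)
next
  case (Suc n)
  have "exec w (While r c) (\<sigma> (Suc 0)) (\<sigma> (Suc n))"
    using Suc.prems by (intro Suc.IH) auto
  then show ?case
    using Suc.prems by (meson exec_While_True zero_less_Suc)
qed

lemma exec_WhileInput_iterate:
  assumes "\<And>i. i < n \<Longrightarrow> w (fst (snd (\<sigma> i))) \<and> exec w c (\<sigma> i) (\<sigma> (Suc i))" and "\<not> w (fst (snd (\<sigma> n)))"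
  shows "exec w (WhileInput c) (\<sigma> 0) (\<sigma> n)"
  using assms
proof (induction n arbitrary: \<sigma>)
  case 0
  then show ?case by (simp add: exec_WhileInput_False)
next
  case (Suc n)
  have "exec w (WhileInput c) (\<sigma> (Suc 0)) (\<sigma> (Suc n))"
    using Suc.prems by (intro Suc.IH) auto
  then show ?case
    using Suc.prems by (meson exec_WhileInput_True zero_less_Suc)
qed

section \<open>From counter programs to machines\<close>

text \<open>
  The stacks that occur while \<^emph>\<open>c\<close> is run on top of \<^emph>\<open>K\<close>. There are finitely many of them because a
  loop puts itself back below its body instead of growing the stack; this is what allows stacks to
  serve as states of a machine.
\<close>

fun stacks :: "com \<Rightarrow> com list \<Rightarrow> com list set" where
  "stacks (Seq c d) K = {Seq c d # K} \<union> stacks c (d # K) \<union> stacks d K"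
| "stacks (Branch r c d) K = {Branch r c d # K} \<union> stacks c K \<union> stacks d K"
| "stacks (While r c) K = {While r c # K} \<union> stacks c (While r c # K)"
| "stacks (WhileInput c) K = {WhileInput c # K} \<union> stacks c (WhileInput c # K)"
| "stacks c K = {c # K}"

fun counters :: "com \<Rightarrow> nat set" where
  "counters (Inc r) = {r}"
| "counters (Dec r) = {r}"
| "counters (Seq c d) = counters c \<union> counters d"
| "counters (Branch r c d) = {r} \<union> counters c \<union> counters d"
| "counters (While r c) = {r} \<union> counters c"
| "counters (WhileInput c) = counters c"
| "counters _ = {}"

lemma finite_stacks: "finite (stacks c K)"
  by (induction c arbitrary: K) auto

lemma finite_counters: "finite (counters c)"
  by (induction c) auto

lemma stacks_self: "c # K \<in> stacks c K"
  by (cases c) auto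

text \<open>
  The only way out of the stacks of \<^emph>\<open>c\<close> is the stack that is left when \<^emph>\<open>c\<close> is finished.
\<close>

lemma control_stacks: "L \<in> stacks c K \<Longrightarrow> fst (control body L nz a) \<in> stacks c K \<union> {K}"
proof (induction c arbitrary: K)
  case (Seq c d)
  consider "L = Seq c d # K" | "L \<in> stacks c (d # K)" | "L \<in> stacks d K"
    using Seq.prems by auto
  then show ?case
  proof cases
    case 1
    then show ?thesis using stacks_self[of c "d # K"] by auto
  next
    case 2
    then show ?thesis using Seq.IH(1) stacks_self[of d K] by fastforce
  next
    case 3
    then show ?thesis using Seq.IH(2) by fastforce
  qed
next
  case (Branch r c d)
  then show ?case
    using Branch.IH(1)[of K] Branch.IH(2)[of K] stacks_self[of c K] stacks_self[of d K] by auto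
next
  case (While r c)
  then show ?case using While.IH[of "While r c # K"] stacks_self[of c "While r c # K"]
    by (auto split: if_splits)
next
  case (WhileInput c)
  then show ?case using WhileInput.IH[of "WhileInput c # K"] stacks_self[of c "WhileInput c # K"]
    by (auto split: if_splits)
qed auto

lemma control_stacks_body:
  assumes "L \<in> insert [] (stacks body [])"
  shows "fst (control body L nz a) \<in> insert [] (stacks body [])"
  using assms control_stacks[of L body "[]" body nz a] stacks_self[of body "[]"] by auto

lemma stacks_counters:
  "L \<in> stacks c K \<Longrightarrow> \<Union> (counters ` set L) \<subseteq> counters c \<union> \<Union> (counters ` set K)"
  by (induction c arbitrary: K) fastforce+

lemma control_cong:
  assumes "\<And>r. r \<in> \<Union> (counters ` set L) \<Longrightarrow> nz r = nz' r"
  shows "control body L nz a = control body L nz' a"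
proof (cases L)
  case (Cons c K)
  then show ?thesis using assms by (cases c) auto
qed auto

lemma control_Stay:
  assumes "r \<notin> \<Union> (counters ` set L)"
  shows "fst (snd (snd (control body L nz a))) r = Stay"
proof (cases L)
  case (Cons c K)
  then show ?thesis using assms by (cases c) auto
qed auto

lemma control_MoveLeft:
  assumes "fst (snd (snd (control body L nz a))) r = MoveLeft"
  shows "nz r"
proof (cases L)
  case (Cons c K)
  then show ?thesis using assms by (cases c) (auto split: if_splits)
qed (use assms in auto)

definition bit_symbol :: "bool \<Rightarrow> 's::zero_neq_one" where
  "bit_symbol b = (if b then 1 else 0)"

definition marked_tape :: "int \<Rightarrow> 's::zero_neq_one option" where
  "marked_tape = (\<lambda>_. None)(0 := Some 1)"

text \<open>
  Counter \<^emph>\<open>r\<close> is the head position on work tape \<^emph>\<open>r\<close>, whose cell 0 is marked, so that the counter is 0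
  exactly when the head scans the mark. The machine needs one step to mark its tapes, which accounts
  for \<^emph>\<open>Suc t\<close>. Its state 0 is used for this step, and the others enumerate the stacks.
\<close>

lemma machine_of_program:
  fixes body :: com
  shows "\<exists>M :: 's::{finite, zero_neq_one} machine. wf_machine M \<and>
    (\<forall>p t. output_after M p (Suc t) =
       map bit_symbol (snd (snd (snd ((cstep (\<lambda>i. p i \<noteq> 0) body ^^ t) ([], \<lambda>_. 0, 0, []))))))"
proof -
  define St where "St = insert [] (stacks body [])"
  define N where "N = card St"
  have fin: "finite St" by (simp add: St_def finite_stacks)
  obtain idx where idx: "bij_betw idx St {0..<N}"
    using ex_bij_betw_finite_nat[OF fin] by (auto simp: N_def)
  define un where "un = the_inv_into St idx"
  have un: "un (idx L) = L" if "L \<in> St" for L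
    unfolding un_def using idx that by (meson bij_betw_imp_inj_on the_inv_into_f_f)
  have un_in: "un q \<in> St" if "q < N" for q
    unfolding un_def using idx that
    by (metis atLeast0LessThan bij_betw_the_inv_into bij_betwE lessThan_iff)
  have idx_less: "idx L < N" if "L \<in> St" for L
    using idx that by (auto dest: bij_betwE)
  obtain k where k: "\<And>r. r \<in> counters body \<Longrightarrow> r < k"
    using finite_counters[of body] by (meson finite_nat_set_iff_bounded)
  have St_counters: "r < k" if "L \<in> St" "r \<in> \<Union> (counters ` set L)" for L r
    using that stacks_counters[of L body "[]"] k by (auto simp: St_def)
  \<comment> \<open>a counter is nonzero if its head scans a blank\<close>
  define tr where "tr = (\<lambda>q (a::'s) (w::'s option list).
      case q of 0 \<Rightarrow> (Suc (idx []), False, replicate k (Some (1::'s), Stay), None)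
      | Suc q' \<Rightarrow> (case control body (un q') (\<lambda>r. w ! r = None) (a \<noteq> 0) of (L, adv, mv, b) \<Rightarrow>
          (Suc (idx L), adv, map (\<lambda>r. (w ! r, mv r)) [0..<k], map_option (bit_symbol :: bool \<Rightarrow> 's) b)))"
  define M where "M = \<lparr> num_states = Suc N, num_tapes = k, transition = tr \<rparr>"
  have wf: "wf_machine M"
  proof -
    have "idx [] < N" by (rule idx_less) (simp add: St_def)
    moreover have "idx (fst (control body (un q) nz a)) < N" if "q < N" for q nz a
      using control_stacks_body[of "un q" body nz a] un_in[OF that] by (intro idx_less) (simp add: St_def)
    ultimately show ?thesis
      unfolding wf_machine_def M_def tr_def by (auto split: nat.split prod.split) (metis fst_conv)
  qed
  have sim: "\<exists>L R i out. (cstep (\<lambda>i. p i \<noteq> 0) body ^^ t) ([], \<lambda>_. 0, 0, []) = (L, R, i, out) \<and> L \<in> St \<and>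
      (\<forall>r\<ge>k. R r = 0) \<and>
      (step M p ^^ Suc t) (init_config M) =
        \<lparr> ctrl = Suc (idx L), input_pos = i, work = map (\<lambda>r. (marked_tape, int (R r))) [0..<k],
          written = map bit_symbol out \<rparr>" for p t
  proof (induction t)
    case 0
    have "map2 update_tape (replicate k (Some (1::'s), Stay)) (replicate k (\<lambda>_. None, 0))
        = map (\<lambda>r. (marked_tape, 0)) [0..<k]"
      by (rule nth_equalityI) (auto simp: marked_tape_def)
    then show ?case
      by (auto simp: step_def init_config_def M_def tr_def St_def)
  next
    case (Suc t)
    then obtain L R i out where IH: "(cstep (\<lambda>i. p i \<noteq> 0) body ^^ t) ([], \<lambda>_. 0, 0, []) = (L, R, i, out)"
      "L \<in> St" "\<forall>r\<ge>k. R r = 0"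
      "(step M p ^^ Suc t) (init_config M) =
        \<lparr> ctrl = Suc (idx L), input_pos = i, work = map (\<lambda>r. (marked_tape, int (R r))) [0..<k],
          written = map bit_symbol out \<rparr>" by blast
    define w :: "'s option list" where "w = map (\<lambda>r. marked_tape (int (R r))) [0..<k]"
    obtain L' adv mv b where ctl: "control body L (\<lambda>r. R r \<noteq> 0) (p i \<noteq> 0) = (L', adv, mv, b)"
      by (metis prod_cases4)
    have ctl': "control body L (\<lambda>r. w ! r = None) (p i \<noteq> 0) = (L', adv, mv, b)"
      unfolding ctl[symmetric]
      using St_counters[OF IH(2)] by (intro control_cong) (auto simp: w_def marked_tape_def)
    have scan: "map (\<lambda>(T, h). T h) (map (\<lambda>r. (marked_tape, int (R r))) [0..<k]) = w"
      by (simp add: w_def)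
    have L': "L' \<in> St"
      using control_stacks_body[of L body "\<lambda>r. R r \<noteq> 0" "p i \<noteq> 0"] IH(2) ctl by (simp add: St_def)
    have stay: "mv r = Stay" if "r \<ge> k" for r
      using control_Stay[of r L body "\<lambda>r. R r \<noteq> 0" "p i \<noteq> 0"] St_counters[OF IH(2)] ctl that
      by (metis fst_conv leD snd_conv)
    have left: "R r \<noteq> 0" if "mv r = MoveLeft" for r
      using control_MoveLeft[of body L "\<lambda>r. R r \<noteq> 0" "p i \<noteq> 0" r] ctl that by auto
    have "int (R r) + offset (mv r) = int (shift (mv r) (R r))" for r
      using left[of r] by (cases "mv r") auto
    then have tapes: "map2 update_tape (map (\<lambda>r. (w ! r, mv r)) [0..<k]) (map (\<lambda>r. (marked_tape, int (R r))) [0..<k])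
        = map (\<lambda>r. (marked_tape, int (shift (mv r) (R r)))) [0..<k]"
      by (intro nth_equalityI) (auto simp: w_def)
    have trans: "tr (Suc (idx L)) (p i) w =
        (Suc (idx L'), adv, map (\<lambda>r. (w ! r, mv r)) [0..<k], map_option bit_symbol b)"
      by (simp add: tr_def un[OF IH(2)] ctl')
    have "(step M p ^^ Suc (Suc t)) (init_config M) = step M p ((step M p ^^ Suc t) (init_config M))"
      by simp
    also have "\<dots> = \<lparr> ctrl = Suc (idx L'), input_pos = (if adv then Suc i else i),
        work = map (\<lambda>r. (marked_tape, int (shift (mv r) (R r)))) [0..<k],
        written = map bit_symbol (out @ (case b of None \<Rightarrow> [] | Some x \<Rightarrow> [x])) \<rparr>"
      unfolding IH(4) step_def
      by (simp add: M_def trans scan tapes del: map_map split: option.split)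
    finally show ?case
      using IH L' stay ctl by auto
  qed
  have "output_after M p (Suc t) =
      map bit_symbol (snd (snd (snd ((cstep (\<lambda>i. p i \<noteq> 0) body ^^ t) ([], \<lambda>_. 0, 0, [])))))" for p t
    using sim[of t p] unfolding output_after_def by (auto simp del: funpow.simps)
  with wf show ?thesis by blast
qed

lemma cstep_output_extends:
  "\<exists>xs. snd (snd (snd (cstep w body x))) = snd (snd (snd x)) @ xs"
proof -
  obtain K R i out where x: "x = (K, R, i, out)" by (metis prod_cases4)
  show ?thesis unfolding x by (simp split: prod.split)
qed

lemma output_extends:
  "t \<le> t' \<Longrightarrow> \<exists>xs. snd (snd (snd ((cstep w body ^^ t') x))) = snd (snd (snd ((cstep w body ^^ t) x))) @ xs"
proof (induction t' rule: dec_induct)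
  case (step n)
  then show ?case
    using cstep_output_extends[of w body "(cstep w body ^^ n) x"] by auto
qed auto

text \<open>
  As the output only grows, its values between the rounds determine the word that is written.
\<close>

lemma forever_machine:
  fixes body :: com
  shows "\<exists>M :: 's::{finite, zero_neq_one} machine. wf_machine M \<and>
    (\<forall>p q \<sigma>. \<sigma> 0 = (\<lambda>_. 0, 0, []) \<longrightarrow> (\<forall>n. exec (\<lambda>i. p i \<noteq> 0) body (\<sigma> n) (\<sigma> (Suc n))) \<longrightarrow>
       (\<forall>n. map bit_symbol (snd (snd (\<sigma> n))) = map q [0..<length (snd (snd (\<sigma> n)))]) \<longrightarrow>
       (\<forall>m. \<exists>n. length (snd (snd (\<sigma> n))) \<ge> m) \<longrightarrow> transforms M p q)"
proof -
  obtain M :: "'s machine" where wf: "wf_machine M"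
    and M: "\<And>p t. output_after M p (Suc t) =
       map bit_symbol (snd (snd (snd ((cstep (\<lambda>i. p i \<noteq> 0) body ^^ t) ([], \<lambda>_. 0, 0, [])))))"
    using machine_of_program[of body] by blast
  have "transforms M p q" if \<sigma>0: "\<sigma> 0 = (\<lambda>_. 0, 0, [])"
    and run: "\<And>n. exec (\<lambda>i. p i \<noteq> 0) body (\<sigma> n) (\<sigma> (Suc n))"
    and out: "\<And>n. map bit_symbol (snd (snd (\<sigma> n))) = map q [0..<length (snd (snd (\<sigma> n)))]"
    and unb: "\<And>m. \<exists>n. length (snd (snd (\<sigma> n))) \<ge> m" for p q \<sigma>
  proof -
    let ?w = "\<lambda>i. p i \<noteq> 0"
    define written_at where "written_at t = snd (snd (snd ((cstep ?w body ^^ t) ([], \<sigma> 0))))" for t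
    have 1: "reaches ?w body ([], \<sigma> 0) ([], \<sigma> n)" for n
    proof (induction n)
      case (Suc n)
      have "cstep ?w body ([], \<sigma> n) = ([body], \<sigma> n)" by (cases "\<sigma> n") auto
      moreover have "reaches ?w body ([body], \<sigma> n) ([], \<sigma> (Suc n))"
        using run[of n] unfolding exec_def by blast
      ultimately have "reaches ?w body ([], \<sigma> n) ([], \<sigma> (Suc n))"
        by (metis reaches_step)
      with Suc show ?case by (rule reaches_trans)
    qed (rule reaches_refl)
    have 2: "\<exists>t. written_at t = snd (snd (\<sigma> n))" for n
      using 1[of n] unfolding reaches_def written_at_def by (metis snd_conv)
    have 3: "\<exists>xs. written_at t' = written_at t @ xs" if "t \<le> t'" for t t'
      using output_extends[OF that] unfolding written_at_def .
    have 4: "map bit_symbol (written_at t) = map q [0..<length (written_at t)]" for t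
    proof -
      obtain n where n: "length (snd (snd (\<sigma> n))) \<ge> length (written_at t)" using unb by blast
      obtain t' where t': "written_at t' = snd (snd (\<sigma> n))" using 2 by blast
      obtain xs where xs: "written_at t' = written_at t @ xs"
      proof (cases "t \<le> t'")
        case True
        then show ?thesis using 3 that by blast
      next
        case False
        then obtain ys where "written_at t = written_at t' @ ys" using 3[of t' t] by auto
        with n t' have "written_at t' = written_at t @ []" by simp
        then show ?thesis using that by blast
      qed
      have "map bit_symbol (written_at t) = take (length (written_at t)) (map bit_symbol (written_at t'))" by (simp add: xs)
      also have "\<dots> = take (length (written_at t)) (map q [0..<length (written_at t')])" using out[of n] t' by simp
      also have "\<dots> = map q [0..<length (written_at t)]" by (simp add: take_map xs)
      finally show ?thesis .
    qed
    have 5: "output_after M p (Suc t) = map bit_symbol (written_at t)" for t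
      unfolding M written_at_def \<sigma>0 ..
    show ?thesis unfolding transforms_def
    proof (intro conjI allI)
      fix t show "output_after M p t = map q [0..<length (output_after M p t)]"
        by (cases t) (simp_all add: 5 4, simp add: output_after_def init_config_def)
    next
      fix m
      obtain n where "length (snd (snd (\<sigma> n))) \<ge> m" using unb by blast
      then show "\<exists>t. length (output_after M p t) \<ge> m" using 2[of n] 5 by (metis length_map)
    qed
  qed
  with wf show ?thesis by blast
qed

abbreviation pfst :: "nat \<Rightarrow> nat" where "pfst c \<equiv> fst (prod_decode c)"
abbreviation psnd :: "nat \<Rightarrow> nat" where "psnd c \<equiv> snd (prod_decode c)"
abbreviation pair :: "nat \<Rightarrow> nat \<Rightarrow> nat" where "pair a b \<equiv> prod_encode (a, b)"

text \<open>
  Total recursive functions, all of one argument: tuples of arguments are passed as nested pairs, so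
  that no arities have to be tracked. Minimization is restricted to functions that have a zero for every
  parameter, which keeps the class total.
\<close>

inductive recursive :: "(nat \<Rightarrow> nat) \<Rightarrow> bool" where
  rec_id: "recursive (\<lambda>x. x)"
| rec_zero: "recursive (\<lambda>_. 0)"
| rec_Suc: "recursive f \<Longrightarrow> recursive (\<lambda>x. Suc (f x))"
| rec_pfst: "recursive f \<Longrightarrow> recursive (\<lambda>x. pfst (f x))"
| rec_psnd: "recursive f \<Longrightarrow> recursive (\<lambda>x. psnd (f x))"
| rec_comp: "recursive f \<Longrightarrow> recursive g \<Longrightarrow> recursive (\<lambda>x. f (g x))"
| rec_pair: "recursive f \<Longrightarrow> recursive g \<Longrightarrow> recursive (\<lambda>x. pair (f x) (g x))"
| rec_iter: "recursive f \<Longrightarrow> recursive (\<lambda>x. (f ^^ pfst x) (psnd x))"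
| rec_mu: "recursive f \<Longrightarrow> (\<And>x. \<exists>n. f (pair n x) = 0) \<Longrightarrow> recursive (\<lambda>x. LEAST n. f (pair n x) = 0)"

definition runs :: "com \<Rightarrow> (nat \<Rightarrow> nat) \<Rightarrow> (nat \<Rightarrow> nat) \<Rightarrow> bool" where
  "runs c R R' \<longleftrightarrow> (\<forall>w i out. exec w c (R, i, out) (R', i, out))"

lemma runs_Inc: "runs (Inc r) R (R(r := Suc (R r)))"
  by (simp add: runs_def exec_Inc)

lemma runs_Dec: "runs (Dec r) R (R(r := R r - 1))"
  unfolding runs_def by (intro allI) (rule exec_Dec)

lemma runs_Seq: "runs c R R' \<Longrightarrow> runs d R' R'' \<Longrightarrow> runs (Seq c d) R R''"
  unfolding runs_def by (blast intro: exec_Seq)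

lemma runs_Branch: "runs (if R r \<noteq> 0 then c else d) R R' \<Longrightarrow> runs (Branch r c d) R R'"
  unfolding runs_def by (simp add: exec_Branch)

lemma runs_While_iterate:
  assumes "\<And>i. i < n \<Longrightarrow> \<rho> i r \<noteq> 0 \<and> runs c (\<rho> i) (\<rho> (Suc i))" and "\<rho> n r = 0"
    and "R = \<rho> 0" and "R' = \<rho> n"
  shows "runs (While r c) R R'"
  unfolding runs_def
proof (intro allI)
  fix w i out
  show "exec w (While r c) (R, i, out) (R', i, out)"
    using exec_While_iterate[of n "\<lambda>k. (\<rho> k, i, out)" r w c] assms unfolding runs_def by simp
qed

lemma runs_eq: "runs c R R' \<Longrightarrow> R' = R'' \<Longrightarrow> runs c R R''"
  by simp

section \<open>Counter programs for pairing\<close>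

definition clear :: "nat \<Rightarrow> com" where
  "clear r = While r (Dec r)"

lemma runs_clear: "runs (clear r) R (R(r := 0))"
  unfolding clear_def
  by (rule runs_While_iterate[where n = "R r" and \<rho> = "\<lambda>i. R(r := R r - i)"])
    (auto intro!: runs_eq[OF runs_Dec])

definition move_to :: "nat \<Rightarrow> nat \<Rightarrow> com" where
  "move_to r r' = While r (Seq (Dec r) (Inc r'))"

lemma runs_move_to:
  assumes "r \<noteq> r'"
  shows "runs (move_to r r') R (R(r := 0, r' := R r' + R r))"
  unfolding move_to_def
  by (rule runs_While_iterate[where n = "R r" and \<rho> = "\<lambda>i. R(r := R r - i, r' := R r' + i)"])
    (use assms in \<open>auto intro!: runs_eq[OF runs_Seq[OF runs_Dec runs_Inc]]\<close>)

text \<open>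
  A counter can only be read by counting it down, so a copy needs a second, temporary copy in the
  counter \<^emph>\<open>t\<close> from which the original is restored.
\<close>

definition copy :: "nat \<Rightarrow> nat \<Rightarrow> nat \<Rightarrow> com" where
  "copy r r' t = Seq (While r (Seq (Dec r) (Seq (Inc r') (Inc t)))) (move_to t r)"

lemma runs_copy:
  assumes "r \<noteq> r'" "r \<noteq> t" "r' \<noteq> t" "R t = 0"
  shows "runs (copy r r' t) R (R(r' := R r' + R r))"
proof -
  have "runs (While r (Seq (Dec r) (Seq (Inc r') (Inc t)))) R (R(r := 0, r' := R r' + R r, t := R r))"
    by (rule runs_While_iterate[where n = "R r" and
          \<rho> = "\<lambda>i. R(r := R r - i, r' := R r' + i, t := i)"])
      (use assms in \<open>auto intro!: runs_eq[OF runs_Seq[OF runs_Dec runs_Seq[OF runs_Inc runs_Inc]]]\<close>)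
  then show ?thesis
    unfolding copy_def using assms
    by (auto intro!: runs_eq[OF runs_Seq[OF _ runs_move_to]])
qed

text \<open>
  The pair of \<^emph>\<open>m\<close> and \<^emph>\<open>n\<close> has the code \<^emph>\<open>triangle (m + n) + m\<close>. The second loop computes the triangle
  number by adding up \<^emph>\<open>m + n\<close>, \<^emph>\<open>m + n - 1\<close>, \<^emph>\<open>\<dots>\<close>, \<^emph>\<open>1\<close>.
\<close>

definition encode_pair :: "nat \<Rightarrow> com" where
  "encode_pair b =
     Seq (While b (Seq (Dec b) (Seq (Inc (b + 1)) (Inc (b + 2)))))
     (Seq (While (b + 1) (Seq (copy (b + 1) b (b + 3)) (Dec (b + 1))))
     (move_to (b + 2) b))"

lemma runs_encode_pair:
  assumes "R (b + 2) = 0" "R (b + 3) = 0"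
  shows "runs (encode_pair b) R (R(b := pair (R b) (R (b + 1)), b + 1 := 0))"
proof -
  let ?s = "R b + R (b + 1)"
  let ?R1 = "R(b := 0, b + 1 := ?s, b + 2 := R b)"
  let ?R2 = "R(b := triangle ?s, b + 1 := 0, b + 2 := R b)"
  let ?\<rho> = "\<lambda>i. R(b := R b - i, b + 1 := R (b + 1) + i, b + 2 := i)"
  have step1: "runs (Seq (Dec b) (Seq (Inc (b + 1)) (Inc (b + 2)))) (?\<rho> i) (?\<rho> (Suc i))" for i
    by (rule runs_eq[OF runs_Seq[OF runs_Dec runs_Seq[OF runs_Inc runs_Inc]]]) (auto simp: fun_eq_iff)
  have 1: "runs (While b (Seq (Dec b) (Seq (Inc (b + 1)) (Inc (b + 2))))) R ?R1"
    by (rule runs_While_iterate[where n = "R b" and \<rho> = ?\<rho>])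
      (use assms step1 in \<open>auto simp: fun_eq_iff\<close>)
  define T where "T i = triangle ?s - triangle (?s - i)" for i
  have T_Suc: "T i + (?s - i) = T (Suc i)" if lt: "i < ?s" for i
  proof -
    obtain m where m: "?s - i = Suc m" using lt by (cases "?s - i") auto
    have "triangle (Suc m) \<le> triangle ?s"
      unfolding m[symmetric] triangle_def by (intro div_le_mono mult_le_mono) auto
    moreover have "?s - Suc i = m" using m by simp
    ultimately show ?thesis unfolding T_def m by simp
  qed
  have T_ends: "T 0 = 0" "T ?s = triangle ?s" by (simp_all add: T_def)
  let ?\<rho>' = "\<lambda>i. R(b := T i, b + 1 := ?s - i, b + 2 := R b)"
  have step2: "runs (Seq (copy (b + 1) b (b + 3)) (Dec (b + 1))) (?\<rho>' i) (?\<rho>' (Suc i))"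
    if lt: "i < ?s" for i
    by (rule runs_eq[OF runs_Seq[OF runs_copy runs_Dec]])
      (auto simp: fun_eq_iff assms T_Suc[OF lt, symmetric])
  have 2: "runs (While (b + 1) (Seq (copy (b + 1) b (b + 3)) (Dec (b + 1)))) ?R1 ?R2"
  proof (rule runs_While_iterate[where n = "?s" and \<rho> = ?\<rho>'])
    show "?\<rho>' i (b + 1) \<noteq> 0 \<and>
        runs (Seq (copy (b + 1) b (b + 3)) (Dec (b + 1))) (?\<rho>' i) (?\<rho>' (Suc i))" if "i < ?s" for i
      using step2[OF that] that by simp
  qed (simp_all add: T_ends[simplified] fun_eq_iff)
  show ?thesis
    unfolding encode_pair_def
    by (rule runs_eq[OF runs_Seq[OF 1 runs_Seq[OF 2 runs_move_to]]])
      (use assms in \<open>auto simp: fun_eq_iff prod_encode_def\<close>)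
qed

text \<open>
  The successor in the enumeration of pairs by their codes. Decoding counts up to the code along this
  enumeration, which avoids inverting the triangle numbers.
\<close>

definition next_pair :: "nat \<times> nat \<Rightarrow> nat \<times> nat" where
  "next_pair = (\<lambda>(m, n). if n = 0 then (0, Suc m) else (Suc m, n - 1))"

lemma prod_encode_next_pair: "prod_encode (next_pair x) = Suc (prod_encode x)"
  by (cases x; cases "snd x") (auto simp: next_pair_def prod_encode_def)

lemma next_pair_iterate: "(next_pair ^^ n) (0, 0) = prod_decode n"
proof -
  have "prod_encode ((next_pair ^^ n) (0, 0)) = n"
    by (induction n) (simp_all add: prod_encode_next_pair, simp add: prod_encode_def)
  then show ?thesis by (metis prod_encode_inverse)
qed

definition decode_pair :: "nat \<Rightarrow> com" where
  "decode_pair b =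
     Seq (While b (Seq (Dec b)
       (Branch (b + 2) (Seq (Inc (b + 1)) (Dec (b + 2))) (Seq (move_to (b + 1) (b + 2)) (Inc (b + 2))))))
     (Seq (move_to (b + 1) b) (move_to (b + 2) (b + 1)))"

lemma runs_decode_pair:
  assumes "R (b + 1) = 0" "R (b + 2) = 0"
  shows "runs (decode_pair b) R (R(b := pfst (R b), b + 1 := psnd (R b)))"
proof -
  define it where "it i = (next_pair ^^ i) (0, 0)" for i
  let ?R1 = "R(b := 0, b + 1 := pfst (R b), b + 2 := psnd (R b))"
  let ?body = "Seq (Dec b)
       (Branch (b + 2) (Seq (Inc (b + 1)) (Dec (b + 2))) (Seq (move_to (b + 1) (b + 2)) (Inc (b + 2))))"
  define \<rho> where "\<rho> i = R(b := R b - i, b + 1 := fst (it i), b + 2 := snd (it i))" for i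
  have 1: "runs (While b ?body) R ?R1"
  proof (rule runs_While_iterate[where n = "R b" and \<rho> = \<rho>])
    fix i assume i: "i < R b"
    obtain m n where mn: "it i = (m, n)" by force
    have mn': "it (Suc i) = next_pair (m, n)" by (simp add: it_def flip: mn)
    have "runs ?body (\<rho> i) (\<rho> (Suc i))"
    proof (rule runs_Seq[OF runs_Dec runs_Branch])
      let ?R = "(\<rho> i)(b := \<rho> i b - 1)"
      show "runs (if ?R (b + 2) \<noteq> 0 then Seq (Inc (b + 1)) (Dec (b + 2))
          else Seq (move_to (b + 1) (b + 2)) (Inc (b + 2))) ?R (\<rho> (Suc i))"
      proof (cases "n = 0")
        case True
        have "runs (Seq (move_to (b + 1) (b + 2)) (Inc (b + 2))) ?R (\<rho> (Suc i))"
          by (rule runs_eq[OF runs_Seq[OF runs_move_to runs_Inc]])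
            (auto simp: \<rho>_def mn mn' True next_pair_def fun_eq_iff)
        then show ?thesis using True by (simp add: \<rho>_def mn)
      next
        case False
        have "runs (Seq (Inc (b + 1)) (Dec (b + 2))) ?R (\<rho> (Suc i))"
          by (rule runs_eq[OF runs_Seq[OF runs_Inc runs_Dec]])
            (use False in \<open>auto simp: \<rho>_def mn mn' next_pair_def fun_eq_iff\<close>)
        then show ?thesis using False by (simp add: \<rho>_def mn)
      qed
    qed
    then show "\<rho> i b \<noteq> 0 \<and> runs ?body (\<rho> i) (\<rho> (Suc i))" using i by (simp add: \<rho>_def)
  qed (use assms in \<open>auto simp: \<rho>_def it_def next_pair_iterate fun_eq_iff\<close>)
  show ?thesis
    unfolding decode_pair_def
    by (rule runs_eq[OF runs_Seq[OF 1 runs_Seq[OF runs_move_to runs_move_to]]])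
      (use assms in \<open>auto simp: fun_eq_iff\<close>)
qed

section \<open>Counter programs for recursive functions\<close>

text \<open>
  Counters above \<^emph>\<open>b\<close> are scratch space, cleared on entry and on exit, and the counters below \<^emph>\<open>b\<close> are
  not touched. A subprogram can therefore be placed above any data that have to survive its execution.
\<close>

definition computes :: "nat \<Rightarrow> com \<Rightarrow> (nat \<Rightarrow> nat) \<Rightarrow> bool" where
  "computes b c f \<longleftrightarrow> (\<forall>R. (\<forall>r > b. R r = 0) \<longrightarrow> runs c R (R(b := f (R b))))"

lemma computesI: "(\<And>R. (\<And>r. r > b \<Longrightarrow> R r = 0) \<Longrightarrow> runs c R (R(b := f (R b)))) \<Longrightarrow> computes b c f"
  by (simp add: computes_def)

lemma computes_runs:
  "computes b c f \<Longrightarrow> (\<And>r. r > b \<Longrightarrow> R r = 0) \<Longrightarrow> R' = R(b := f (R b)) \<Longrightarrow> runs c R R'"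
  by (simp add: computes_def)

lemma computes_pair:
  assumes f: "computes (b + 2) c f" and g: "computes (b + 1) d g"
  shows "computes b
    (Seq (copy b (b + 1) (b + 2)) (Seq d (Seq (copy b (b + 2) (b + 3)) (Seq c
      (Seq (clear b) (Seq (move_to (b + 2) b) (encode_pair b))))))) (\<lambda>x. pair (f x) (g x))"
proof (rule computesI)
  fix R :: "nat \<Rightarrow> nat" assume R: "\<And>r. r > b \<Longrightarrow> R r = 0"
  let ?x = "R b"
  let ?R1 = "R(b + 1 := ?x)" and ?R2 = "R(b + 1 := g ?x)" and ?R3 = "R(b + 1 := g ?x, b + 2 := ?x)"
    and ?R4 = "R(b + 1 := g ?x, b + 2 := f ?x)"
  have 1: "runs (copy b (b + 1) (b + 2)) R ?R1"
    by (rule runs_eq[OF runs_copy]) (use R in auto)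
  have 2: "runs d ?R1 ?R2"
    by (rule computes_runs[OF g]) (use R in \<open>auto\<close>)
  have 3: "runs (copy b (b + 2) (b + 3)) ?R2 ?R3"
    by (rule runs_eq[OF runs_copy]) (use R in auto)
  have 4: "runs c ?R3 ?R4"
    by (rule computes_runs[OF f]) (use R in \<open>auto\<close>)
  show "runs (Seq (copy b (b + 1) (b + 2)) (Seq d (Seq (copy b (b + 2) (b + 3)) (Seq c
      (Seq (clear b) (Seq (move_to (b + 2) b) (encode_pair b))))))) R (R(b := pair (f ?x) (g ?x)))"
    by (rule runs_eq[OF runs_Seq[OF 1 runs_Seq[OF 2 runs_Seq[OF 3 runs_Seq[OF 4
          runs_Seq[OF runs_clear runs_Seq[OF runs_move_to runs_encode_pair]]]]]]])
      (use R in \<open>auto simp: fun_eq_iff\<close>)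
qed

lemma computes_iter:
  assumes f: "computes (b + 1) c f"
  shows "computes b (Seq (decode_pair b) (Seq (While b (Seq (Dec b) c)) (move_to (b + 1) b)))
    (\<lambda>x. (f ^^ pfst x) (psnd x))"
proof (rule computesI)
  fix R :: "nat \<Rightarrow> nat" assume R: "\<And>r. r > b \<Longrightarrow> R r = 0"
  let ?n = "pfst (R b)" and ?x = "psnd (R b)"
  let ?R1 = "R(b := ?n, b + 1 := ?x)" and ?R2 = "R(b := 0, b + 1 := (f ^^ ?n) ?x)"
  have 1: "runs (decode_pair b) R ?R1"
    by (rule runs_decode_pair) (use R in auto)
  have 2: "runs (While b (Seq (Dec b) c)) ?R1 ?R2"
  proof (rule runs_While_iterate[where n = ?n and \<rho> = "\<lambda>i. R(b := ?n - i, b + 1 := (f ^^ i) ?x)"])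
    fix i assume i: "i < ?n"
    let ?\<rho> = "\<lambda>i. R(b := ?n - i, b + 1 := (f ^^ i) ?x)"
    have "runs (Seq (Dec b) c) (?\<rho> i) (?\<rho> (Suc i))"
      by (rule runs_Seq[OF runs_Dec computes_runs[OF f]]) (use R i in \<open>auto simp: fun_eq_iff\<close>)
    then show "?\<rho> i b \<noteq> 0 \<and> runs (Seq (Dec b) c) (?\<rho> i) (?\<rho> (Suc i))" using i by simp
  qed (use R in auto)
  show "runs (Seq (decode_pair b) (Seq (While b (Seq (Dec b) c)) (move_to (b + 1) b))) R
      (R(b := (f ^^ ?n) ?x))"
    by (rule runs_eq[OF runs_Seq[OF 1 runs_Seq[OF 2 runs_move_to]]]) (use R in \<open>auto simp: fun_eq_iff\<close>)
qed

text \<open>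
  Counter \<^emph>\<open>b + 1\<close> runs through the candidates, and \<^emph>\<open>test\<close> puts the value at the current one into
  counter \<^emph>\<open>b + 2\<close>.
\<close>

lemma computes_mu:
  assumes f: "computes (b + 2) c f" and ex: "\<And>x. \<exists>n. f (pair n x) = 0"
  defines "test \<equiv> Seq (copy (b + 1) (b + 2) (b + 4)) (Seq (copy b (b + 3) (b + 4)) (Seq (encode_pair (b + 2)) c))"
  shows "computes b (Seq test (Seq (While (b + 2) (Seq (clear (b + 2)) (Seq (Inc (b + 1)) test)))
      (Seq (clear b) (move_to (b + 1) b)))) (\<lambda>x. LEAST n. f (pair n x) = 0)"
proof (rule computesI)
  fix R :: "nat \<Rightarrow> nat" assume R: "\<And>r. r > b \<Longrightarrow> R r = 0"
  let ?x = "R b"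
  define k where "k = (LEAST n. f (pair n ?x) = 0)"
  have k: "f (pair k ?x) = 0" unfolding k_def by (rule LeastI_ex) (rule ex)
  have less: "f (pair n ?x) \<noteq> 0" if "n < k" for n using that unfolding k_def by (rule not_less_Least)
  define \<rho> where "\<rho> n = R(b + 1 := n, b + 2 := f (pair n ?x))" for n
  have test: "runs test (R(b + 1 := n)) (\<rho> n)" for n
  proof -
    have 1: "runs (copy (b + 1) (b + 2) (b + 4)) (R(b + 1 := n)) (R(b + 1 := n, b + 2 := n))"
      by (rule runs_eq[OF runs_copy]) (use R in auto)
    have 2: "runs (copy b (b + 3) (b + 4)) (R(b + 1 := n, b + 2 := n)) (R(b + 1 := n, b + 2 := n, b + 3 := ?x))"
      by (rule runs_eq[OF runs_copy]) (use R in auto)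
    have 3: "runs (encode_pair (b + 2)) (R(b + 1 := n, b + 2 := n, b + 3 := ?x)) (R(b + 1 := n, b + 2 := pair n ?x))"
      by (rule runs_eq[OF runs_encode_pair]) (use R in \<open>auto simp: fun_eq_iff\<close>)
    have 4: "runs c (R(b + 1 := n, b + 2 := pair n ?x)) (\<rho> n)"
      by (rule computes_runs[OF f]) (use R in \<open>auto simp: \<rho>_def\<close>)
    show ?thesis unfolding test_def by (rule runs_Seq[OF 1 runs_Seq[OF 2 runs_Seq[OF 3 4]]])
  qed
  have loop: "runs (While (b + 2) (Seq (clear (b + 2)) (Seq (Inc (b + 1)) test))) (\<rho> 0) (\<rho> k)"
  proof (rule runs_While_iterate[where n = k and \<rho> = \<rho>])
    fix i assume i: "i < k"
    have "((\<rho> i)(b + 2 := 0))(b + 1 := Suc (((\<rho> i)(b + 2 := 0)) (b + 1))) = R(b + 1 := Suc i)"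
      using R by (auto simp: \<rho>_def fun_eq_iff)
    then have "runs (Seq (clear (b + 2)) (Seq (Inc (b + 1)) test)) (\<rho> i) (\<rho> (Suc i))"
      by (intro runs_Seq[OF runs_clear runs_Seq[OF runs_Inc]]) (simp only: test)
    then show "\<rho> i (b + 2) \<noteq> 0 \<and> runs (Seq (clear (b + 2)) (Seq (Inc (b + 1)) test)) (\<rho> i) (\<rho> (Suc i))"
      using less[OF i] by (simp add: \<rho>_def)
  qed (simp_all add: \<rho>_def k)
  have "R(b + 1 := 0) = R" using R by auto
  then have start: "runs test R (\<rho> 0)" using test[of 0] by simp
  show "runs (Seq test (Seq (While (b + 2) (Seq (clear (b + 2)) (Seq (Inc (b + 1)) test)))
      (Seq (clear b) (move_to (b + 1) b)))) R (R(b := LEAST n. f (pair n ?x) = 0))"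
    by (rule runs_eq[OF runs_Seq[OF start runs_Seq[OF loop runs_Seq[OF runs_clear runs_move_to]]]])
      (use R k in \<open>auto simp: \<rho>_def fun_eq_iff k_def[symmetric]\<close>)
qed

lemma computes_Seq:
  assumes "computes b c f" and "computes b d g"
  shows "computes b (Seq c d) (\<lambda>x. g (f x))"
proof (rule computesI)
  fix R :: "nat \<Rightarrow> nat" assume R: "\<And>r. r > b \<Longrightarrow> R r = 0"
  show "runs (Seq c d) R (R(b := g (f (R b))))"
    by (rule runs_Seq[OF computes_runs[OF assms(1) _ refl] computes_runs[OF assms(2)]]) (use R in auto)
qed

lemma computes_decode:
  "computes b (Seq (decode_pair b) (clear (b + 1))) pfst"
  "computes b (Seq (decode_pair b) (Seq (clear b) (move_to (b + 1) b))) psnd"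
  by (auto intro!: computesI runs_eq[OF runs_Seq[OF runs_decode_pair runs_clear]]
      runs_eq[OF runs_Seq[OF runs_decode_pair runs_Seq[OF runs_clear runs_move_to]]] simp: fun_eq_iff)

lemma recursive_computes: "recursive f \<Longrightarrow> \<exists>c. computes b c f"
proof (induction f arbitrary: b rule: recursive.induct)
  case rec_id
  have "computes b (Seq (Inc b) (Dec b)) (\<lambda>x. x)"
    by (auto intro!: computesI runs_eq[OF runs_Seq[OF runs_Inc runs_Dec]])
  then show ?case by blast
next
  case rec_zero
  have "computes b (clear b) (\<lambda>x. 0)"
    by (auto intro!: computesI runs_clear)
  then show ?case by blast
next
  case (rec_Suc f)
  have "computes b (Inc b) Suc"
    by (auto intro!: computesI runs_Inc)
  then show ?case using rec_Suc.IH[of b] computes_Seq by blast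
next
  case (rec_pfst f)
  then show ?case using computes_decode(1) computes_Seq by blast
next
  case (rec_psnd f)
  then show ?case using computes_decode(2) computes_Seq by blast
next
  case (rec_comp f g)
  then show ?case using computes_Seq by blast
next
  case (rec_pair f g)
  then show ?case using computes_pair by blast
next
  case (rec_iter f)
  then show ?case using computes_iter by blast
next
  case (rec_mu f)
  then show ?case using computes_mu by blast
qed

section \<open>Closure properties of recursive functions\<close>

lemma rec_const: "recursive (\<lambda>_. k)"
  by (induction k) (auto intro: recursive.intros)

lemma rec_comp2:
  assumes "recursive (\<lambda>z. h (pfst z) (psnd z))" "recursive f" "recursive g"
  shows "recursive (\<lambda>x. h (f x) (g x))"
  using rec_comp[OF assms(1) rec_pair[OF assms(2,3)]] by simp

text \<open>
  The iteration allowed in the definition has no parameters. A parameter is carried along in the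
  first component of the iterated pair.
\<close>

lemma rec_iterate:
  assumes h: "recursive (\<lambda>z. h (pfst z) (psnd z))" and n: "recursive n" and a: "recursive a"
  shows "recursive (\<lambda>x. (h x ^^ n x) (a x))"
proof -
  define s where "s z = pair (pfst z) (h (pfst z) (psnd z))" for z
  have s: "recursive s"
    unfolding s_def by (intro rec_pair rec_pfst rec_id h)
  have "recursive (\<lambda>x. psnd ((s ^^ pfst (pair (n x) (pair x (a x)))) (psnd (pair (n x) (pair x (a x))))))"
    by (intro rec_psnd rec_comp[OF rec_iter[OF s]] rec_pair rec_id n a)
  moreover have "(s ^^ k) (pair x y) = pair x ((h x ^^ k) y)" for k x y
    by (induction k) (simp_all add: s_def)
  ultimately show ?thesis by simp
qed

lemma rec_primrec:
  assumes h: "recursive (\<lambda>z. h (pfst z) (pfst (psnd z)) (psnd (psnd z)))"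
    and n: "recursive n" and a: "recursive a"
  shows "recursive (\<lambda>x. rec_nat (a x) (h x) (n x))"
proof -
  define s where "s x z = pair (Suc (pfst z)) (h x (pfst z) (psnd z))" for x z
  have "recursive (\<lambda>x. psnd ((s x ^^ n x) (pair 0 (a x))))"
    unfolding s_def by (intro rec_psnd rec_iterate rec_pair rec_Suc rec_pfst rec_id h n a rec_zero)
  moreover have "(s x ^^ k) (pair 0 y) = pair k (rec_nat y (h x) k)" for k x y
    by (induction k) (simp_all add: s_def)
  ultimately show ?thesis by simp
qed

lemma rec_add:
  assumes "recursive f" "recursive g" shows "recursive (\<lambda>x. f x + g x)"
proof -
  have "recursive (\<lambda>x. ((\<lambda>_. Suc) x ^^ g x) (f x))"
    by (intro rec_iterate rec_Suc rec_psnd rec_id assms)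
  moreover have "(Suc ^^ k) y = y + k" for k y by (induction k) auto
  ultimately show ?thesis by (simp add: add.commute)
qed

lemma rec_mult:
  assumes "recursive f" "recursive g" shows "recursive (\<lambda>x. f x * g x)"
proof -
  have "recursive (\<lambda>x. ((\<lambda>x y. y + f x) x ^^ g x) 0)"
    by (intro rec_iterate rec_add rec_comp[OF assms(1)] rec_pfst rec_psnd rec_id rec_zero assms)
  moreover have "((\<lambda>y. y + c) ^^ k) 0 = c * k" for k c :: nat by (induction k) auto
  ultimately show ?thesis by simp
qed

lemma rec_diff:
  assumes "recursive f" "recursive g" shows "recursive (\<lambda>x. f x - g x)"
proof -
  define s where "s z = pair (psnd z) (Suc (psnd z))" for z
  have s: "(s ^^ k) (pair 0 0) = pair (k - 1) k" for k
    by (induction k) (auto simp: s_def)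
  have "recursive (\<lambda>x. pfst (((\<lambda>_. s) x ^^ x) (pair 0 0)))"
    unfolding s_def by (intro rec_pfst rec_iterate rec_pair rec_Suc rec_psnd rec_id rec_zero)
  then have pred: "recursive (\<lambda>x. x - 1)" by (simp add: s)
  have "recursive (\<lambda>x. ((\<lambda>_ y. y - 1) x ^^ g x) (f x))"
    by (intro rec_iterate rec_comp[OF pred] rec_psnd rec_id assms)
  moreover have "((\<lambda>y. y - 1) ^^ k) y = y - k" for k y :: nat by (induction k) auto
  ultimately show ?thesis by simp
qed

text \<open>
  Truth is coded by 0, as minimization searches for zeros.
\<close>

definition decidable :: "(nat \<Rightarrow> bool) \<Rightarrow> bool" where
  "decidable P \<longleftrightarrow> recursive (\<lambda>x. if P x then 0 else 1)"

text \<open>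
  The choice is an iteration of a constant function, performed zero times or once.
\<close>

lemma rec_if:
  assumes "decidable P" "recursive f" "recursive g"
  shows "recursive (\<lambda>x. if P x then f x else g x)"
proof -
  have "recursive (\<lambda>x. ((\<lambda>x _. g x) x ^^ (if P x then 0 else 1)) (f x))"
    using assms(1) unfolding decidable_def
    by (intro rec_iterate rec_comp[OF assms(3)] rec_pfst rec_id assms(2))
  moreover have "((\<lambda>_. g x) ^^ (if P x then 0 else 1)) (f x) = (if P x then f x else g x)" for x
    by simp
  ultimately show ?thesis by simp
qed

lemma dec_zero:
  assumes "recursive f" shows "decidable (\<lambda>x. f x = 0)"
proof -
  have "recursive (\<lambda>x. 1 - (1 - f x))"
    by (intro rec_diff rec_const assms)
  moreover have "1 - (1 - f x) = (if f x = 0 then 0 else 1)" for x by auto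
  ultimately show ?thesis by (simp add: decidable_def)
qed

lemma dec_le:
  assumes "recursive f" "recursive g" shows "decidable (\<lambda>x. f x \<le> g x)"
  using dec_zero[OF rec_diff[OF assms]] by simp

lemma dec_not:
  assumes "decidable P" shows "decidable (\<lambda>x. \<not> P x)"
  using rec_if[OF assms rec_const[of 1] rec_zero] unfolding decidable_def
  by (rule back_subst[of recursive]) auto

lemma dec_conj:
  assumes "decidable P" "decidable Q" shows "decidable (\<lambda>x. P x \<and> Q x)"
  using rec_if[OF assms(1) assms(2)[unfolded decidable_def] rec_const[of 1]] unfolding decidable_def
  by (rule back_subst[of recursive]) auto

lemma dec_less:
  assumes "recursive f" "recursive g" shows "decidable (\<lambda>x. f x < g x)"
  using dec_not[OF dec_le[OF assms(2,1)]] by (simp add: not_le)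

lemma dec_eq:
  assumes "recursive f" "recursive g" shows "decidable (\<lambda>x. f x = g x)"
  using dec_conj[OF dec_le[OF assms] dec_le[OF assms(2,1)]] by (simp add: order_eq_iff)

lemma rec_Least:
  assumes P: "decidable (\<lambda>z. P (pfst z) (psnd z))" and ex: "\<And>x. \<exists>n. P x n"
  shows "recursive (\<lambda>x. LEAST n. P x n)"
proof -
  let ?f = "\<lambda>z. if P (psnd z) (pfst z) then 0 else 1 :: nat"
  have "recursive ?f"
    using rec_comp[OF P[unfolded decidable_def] rec_pair[OF rec_psnd[OF rec_id] rec_pfst[OF rec_id]]]
    by simp
  moreover have eq: "((if Q then 0 else 1 :: nat) = 0) = Q" for Q by simp
  ultimately show ?thesis
    using rec_mu[of ?f] ex by (simp only: prod_encode_inverse fst_conv snd_conv eq)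
qed

lemmas rec_intros = rec_id rec_Suc rec_pfst rec_psnd rec_pair rec_const rec_add rec_mult rec_diff
  rec_if dec_eq dec_le dec_less dec_not dec_conj

section \<open>Machines that translate blocks of ones\<close>

definition block_pos :: "(nat \<Rightarrow> nat) \<Rightarrow> nat \<Rightarrow> nat" where
  "block_pos a i = (\<Sum>j<i. Suc (a j))"

text \<open>
  The word is made of blocks of ones of the lengths \<^emph>\<open>a 0\<close>, \<^emph>\<open>a 1\<close>, \<^emph>\<open>\<dots>\<close>, each of them ended by a 0. Names of natural
  numbers as well as Cauchy names have this form, the latter with an empty first block.
\<close>

definition codes_blocks :: "(nat \<Rightarrow> 's::zero_neq_one) \<Rightarrow> (nat \<Rightarrow> nat) \<Rightarrow> bool" where
  "codes_blocks p a \<longleftrightarrow>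
     (\<forall>i. (\<forall>d < a i. p (block_pos a i + d) \<noteq> 0) \<and> p (block_pos a i + a i) = 0)"

text \<open>
  The value 0 stands for silence and \<^emph>\<open>Suc y\<close> for a block of \<^emph>\<open>y\<close> ones. Silence is needed when
  more blocks have to be read before the next one can be written.
\<close>

definition emission :: "nat \<Rightarrow> bool list" where
  "emission z = (if z = 0 then [] else replicate (z - 1) True @ [False])"

text \<open>
  In each round the machine reads a block \<^emph>\<open>a i\<close>, updates its state \<^emph>\<open>v i\<close> by \<^emph>\<open>S\<close>, and writes what \<^emph>\<open>W\<close> makes
  of the new state. Counter 0 holds the state, and the counters above it are empty between the rounds.
\<close>

lemma transducer_machine:
  assumes S: "recursive S" and W: "recursive W"
  shows "\<exists>M :: 's::{finite, zero_neq_one} machine. wf_machine M \<and>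
    (\<forall>p q a v. codes_blocks p a \<longrightarrow> v 0 = 0 \<longrightarrow> (\<forall>i. v (Suc i) = S (pair (v i) (a i))) \<longrightarrow>
      (\<forall>n. map bit_symbol (concat (map (\<lambda>i. emission (W (v (Suc i)))) [0..<n])) =
        map q [0..<length (concat (map (\<lambda>i. emission (W (v (Suc i)))) [0..<n]))]) \<longrightarrow>
      (\<forall>m. \<exists>n. length (concat (map (\<lambda>i. emission (W (v (Suc i)))) [0..<n])) \<ge> m) \<longrightarrow>
      transforms M p q)"
proof -
  obtain cS where cS: "computes 0 cS S" using recursive_computes[OF S] by blast
  obtain cW where cW: "computes 1 cW W" using recursive_computes[OF W] by blast
  define rd where "rd = Seq (WhileInput (Seq Advance (Inc 1))) Advance"
  define mid where "mid = Seq (encode_pair 0) (Seq cS (Seq (copy 0 1 2) cW))"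
  define wr where "wr = While 1 (Seq (Dec 1) (Seq (While 1 (Seq (Dec 1) (Emit True))) (Emit False)))"
  define body where "body = Seq rd (Seq mid wr)"
  obtain M :: "'s machine" where wf: "wf_machine M"
    and M: "\<And>p q \<sigma>. \<lbrakk>\<sigma> 0 = (\<lambda>_. 0, 0, []); \<And>n. exec (\<lambda>i. p i \<noteq> 0) body (\<sigma> n) (\<sigma> (Suc n));
       \<And>n. map bit_symbol (snd (snd (\<sigma> n))) = map q [0..<length (snd (snd (\<sigma> n)))];
       \<And>m. \<exists>n. length (snd (snd (\<sigma> n))) \<ge> m\<rbrakk> \<Longrightarrow> transforms M p q"
    using forever_machine[of body] by blast
  have "transforms M p q" if p: "codes_blocks p a" and v: "v 0 = 0" "\<And>i. v (Suc i) = S (pair (v i) (a i))"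
    and o1: "\<And>n. map bit_symbol (concat (map (\<lambda>i. emission (W (v (Suc i)))) [0..<n])) =
        map q [0..<length (concat (map (\<lambda>i. emission (W (v (Suc i)))) [0..<n]))]"
    and o2: "\<And>m. \<exists>n. length (concat (map (\<lambda>i. emission (W (v (Suc i)))) [0..<n])) \<ge> m"
    for p q a v
  proof -
    let ?w = "\<lambda>i. p i \<noteq> 0"
    let ?out = "\<lambda>n. concat (map (\<lambda>i. emission (W (v (Suc i)))) [0..<n])"
    let ?R = "\<lambda>n. (\<lambda>_. 0)(0 := v n) :: nat \<Rightarrow> nat"
    define \<sigma> where "\<sigma> n = (?R n, block_pos a n, ?out n)" for n
    have run: "exec ?w body (\<sigma> n) (\<sigma> (Suc n))" for n
    proof -
      let ?b = "block_pos a n" and ?z = "W (v (Suc n))"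
      have 1: "exec ?w (WhileInput (Seq Advance (Inc 1))) (?R n, ?b, ?out n) ((?R n)(1 := a n), ?b + a n, ?out n)"
      proof -
        let ?\<sigma> = "\<lambda>i. ((?R n)(1 := i), ?b + i, ?out n)"
        have "exec ?w (Seq Advance (Inc 1)) (?\<sigma> i) (?\<sigma> (Suc i))" for i
        proof (rule exec_Seq[OF exec_Advance])
          show "exec ?w (Inc 1) ((?R n)(1 := i), Suc (?b + i), ?out n) (?\<sigma> (Suc i))"
            using exec_Inc[of ?w 1 "(?R n)(1 := i)" "Suc (?b + i)" "?out n"] by simp
        qed
        then have "exec ?w (WhileInput (Seq Advance (Inc 1))) (?\<sigma> 0) (?\<sigma> (a n))"
          using p unfolding codes_blocks_def
          by (intro exec_WhileInput_iterate[where \<sigma> = ?\<sigma>]) simp_all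
        moreover have "(?R n)(1 := 0) = ?R n" by (simp add: fun_eq_iff)
        ultimately show ?thesis by simp
      qed
      have rd: "exec ?w rd (\<sigma> n) ((?R n)(1 := a n), block_pos a (Suc n), ?out n)"
        unfolding rd_def \<sigma>_def using exec_Seq[OF 1 exec_Advance] by (simp add: block_pos_def)
      have mid: "runs mid ((?R n)(1 := a n)) ((?R (Suc n))(1 := ?z))"
      proof -
        have 1: "runs (encode_pair 0) ((?R n)(1 := a n)) ((\<lambda>_. 0)(0 := pair (v n) (a n)))"
          by (rule runs_eq[OF runs_encode_pair]) (auto simp: fun_eq_iff)
        have 2: "runs cS ((\<lambda>_. 0)(0 := pair (v n) (a n))) (?R (Suc n))"
          by (rule computes_runs[OF cS]) (auto simp: fun_eq_iff v)
        have 3: "runs (copy 0 1 2) (?R (Suc n)) ((?R (Suc n))(1 := v (Suc n)))"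
          by (rule runs_eq[OF runs_copy]) auto
        have 4: "runs cW ((?R (Suc n))(1 := v (Suc n))) ((?R (Suc n))(1 := ?z))"
          by (rule computes_runs[OF cW]) (auto simp: fun_eq_iff)
        show ?thesis unfolding mid_def by (rule runs_Seq[OF 1 runs_Seq[OF 2 runs_Seq[OF 3 4]]])
      qed
      let ?i = "block_pos a (Suc n)"
      have wr: "exec ?w wr ((?R (Suc n))(1 := z), ?i, out) (?R (Suc n), ?i, out @ emission z)" for z out
      proof (cases z)
        case 0
        have "(?R (Suc n))(1 := 0) = ?R (Suc n)" by (simp add: fun_eq_iff)
        then show ?thesis
          using exec_While_False[of "(?R (Suc n), ?i, out)" 1] by (simp add: wr_def 0 emission_def)
      next
        case (Suc y)
        let ?\<sigma> = "\<lambda>k. ((?R (Suc n))(1 := y - k), ?i, out @ replicate k True)"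
        have "exec ?w (Seq (Dec 1) (Emit True)) (?\<sigma> k) (?\<sigma> (Suc k))" if "k < y" for k
          using exec_Seq[OF exec_Dec[of ?w 1 "(?R (Suc n))(1 := y - k)" ?i "out @ replicate k True"]
              exec_Emit[of ?w True]]
          by (simp add: replicate_append_same)
        then have "exec ?w (While 1 (Seq (Dec 1) (Emit True))) (?\<sigma> 0) (?\<sigma> y)"
          by (intro exec_While_iterate[where \<sigma> = ?\<sigma>]) simp_all
        then have in1: "exec ?w (While 1 (Seq (Dec 1) (Emit True)))
            ((?R (Suc n))(1 := y), ?i, out) (?R (Suc n), ?i, out @ replicate y True)"
          by (simp add: fun_upd_idem)
        have dec: "exec ?w (Dec 1) ((?R (Suc n))(1 := z), ?i, out) ((?R (Suc n))(1 := y), ?i, out)"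
          using exec_Dec[of ?w 1 "(?R (Suc n))(1 := z)" ?i out] by (simp add: Suc)
        have "exec ?w (Seq (Dec 1) (Seq (While 1 (Seq (Dec 1) (Emit True))) (Emit False)))
            ((?R (Suc n))(1 := z), ?i, out) (?R (Suc n), ?i, out @ emission z)"
          using exec_Seq[OF dec exec_Seq[OF in1 exec_Emit[of ?w False]]] by (simp add: emission_def Suc)
        from exec_While_True[OF _ this exec_While_False] show ?thesis
          unfolding wr_def by (simp add: Suc)
      qed
      have mid': "exec ?w mid ((?R n)(1 := a n), ?i, ?out n) ((?R (Suc n))(1 := ?z), ?i, ?out n)"
        using mid unfolding runs_def by blast
      show ?thesis unfolding body_def
        using exec_Seq[OF rd exec_Seq[OF mid' wr]] by (simp add: \<sigma>_def)
    qed
    have \<sigma>0: "\<sigma> 0 = (\<lambda>_. 0, 0, [])"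
      by (simp add: \<sigma>_def block_pos_def v fun_eq_iff)
    show ?thesis
      by (rule M[of \<sigma>, OF \<sigma>0 run]) (use o1 o2 in \<open>simp_all add: \<sigma>_def\<close>)
  qed
  with wf show ?thesis by blast
qed

lemma seq_name_block_start: "seq_name n (block_start n i) = 0"
  by (simp add: seq_name_def)

lemma seq_name_inside:
  assumes "d \<le> n i" shows "seq_name n (Suc (block_start n i + d)) = 1"
proof -
  have "block_start n j \<noteq> Suc (block_start n i + d)" for j
  proof
    assume j: "block_start n j = Suc (block_start n i + d)"
    then have "block_start n i < block_start n j" "block_start n j < block_start n (Suc i)"
      using assms by (simp_all add: block_start_def)
    then have "i < j" "j < Suc i" by (simp_all add: strict_mono_less[OF strict_mono_block_start])
    then show False by simp
  qed
  then show ?thesis by (auto simp: seq_name_def image_iff dest: sym)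
qed

lemma codes_blocks_seq_name:
  "codes_blocks (seq_name n :: nat \<Rightarrow> 'a::zero_neq_one) (\<lambda>i. case i of 0 \<Rightarrow> 0 | Suc i \<Rightarrow> Suc (n i))"
proof -
  let ?a = "\<lambda>i. case i of 0 \<Rightarrow> 0 | Suc i \<Rightarrow> Suc (n i)"
  have pos: "block_pos ?a (Suc i) = Suc (block_start n i)" for i
    by (induction i) (simp_all add: block_pos_def block_start_def)
  let ?p = "seq_name n :: nat \<Rightarrow> 'a"
  have "(\<forall>d < ?a i. ?p (block_pos ?a i + d) \<noteq> 0) \<and> ?p (block_pos ?a i + ?a i) = 0" for i
  proof (cases i)
    case 0
    then show ?thesis
      using seq_name_block_start[of n 0, where ?'a = 'a] by (simp add: block_pos_def block_start_def)
  next
    case (Suc j)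
    have "block_pos ?a (Suc j) + ?a (Suc j) = block_start n (Suc j)"
      unfolding pos by (simp add: block_start_def)
    moreover have "block_pos ?a (Suc j) + d = Suc (block_start n j + d)" for d
      unfolding pos by simp
    ultimately show ?thesis
      unfolding Suc by (simp add: less_Suc_eq_le seq_name_inside seq_name_block_start)
  qed
  then show ?thesis unfolding codes_blocks_def by blast
qed

lemma codes_blocks_nat_name:
  "codes_blocks (nat_name k) (\<lambda>i. if i = 0 then k else 0)"
proof -
  have "block_pos (\<lambda>i. if i = 0 then k else 0) i = (if i = 0 then 0 else k + i)" for i
    by (induction i) (auto simp: block_pos_def)
  then show ?thesis by (auto simp: codes_blocks_def nat_name_def)
qed

lemma map_seq_name:
  "map bit_symbol ([False] @ concat (map (\<lambda>i. emission (m i + 2)) [0..<n])) =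
    map (seq_name m :: nat \<Rightarrow> 'a::zero_neq_one) [0..<Suc (block_start m n)]"
proof (induction n)
  case 0
  then show ?case using seq_name_block_start[of m 0, where ?'a = 'a] by (simp add: block_start_def bit_symbol_def)
next
  case (Suc n)
  let ?p = "seq_name m :: nat \<Rightarrow> 'a"
  have "map bit_symbol (emission (m n + 2)) = map ?p [Suc (block_start m n)..<Suc (block_start m (Suc n))]"
  proof (rule nth_equalityI)
    show "length (map bit_symbol (emission (m n + 2))) =
        length (map ?p [Suc (block_start m n)..<Suc (block_start m (Suc n))])"
      by (simp add: emission_def block_start_def)
  next
    fix d assume "d < length (map bit_symbol (emission (m n + 2)))"
    then have d: "d < Suc (Suc (m n))" by (simp add: emission_def)
    have L: "map bit_symbol (emission (m n + 2)) ! d = (if d \<le> m n then 1 else 0 :: 'a)"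
      using d by (auto simp: emission_def bit_symbol_def nth_append simp del: replicate_Suc)
    have R: "map ?p [Suc (block_start m n)..<Suc (block_start m (Suc n))] ! d = ?p (Suc (block_start m n) + d)"
      using d by (subst nth_map_upt) (simp_all add: block_start_def)
    have "?p (Suc (block_start m n) + d) = (if d \<le> m n then 1 else 0)"
    proof (cases "d \<le> m n")
      case True
      then show ?thesis using seq_name_inside[of d m n, where ?'a = 'a] by simp
    next
      case False
      then have "Suc (block_start m n) + d = block_start m (Suc n)"
        using d by (simp add: block_start_def)
      then show ?thesis
        using False seq_name_block_start[of m "Suc n", where ?'a = 'a] by simp
    qed
    then show "map bit_symbol (emission (m n + 2)) ! d =
        map ?p [Suc (block_start m n)..<Suc (block_start m (Suc n))] ! d"
      unfolding L R by simp
  qed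
  then have "map bit_symbol ([False] @ concat (map (\<lambda>i. emission (m i + 2)) [0..<Suc n])) =
      map ?p ([0..<Suc (block_start m n)] @ [Suc (block_start m n)..<Suc (block_start m (Suc n))])"
    using Suc.IH by simp
  moreover have "[0..<Suc (block_start m n)] @ [Suc (block_start m n)..<Suc (block_start m (Suc n))] =
      [0..<Suc (block_start m (Suc n))]"
    using upt_add_eq_append[of 0 "Suc (block_start m n)" "m n + 2"]
    by (simp add: block_start_def del: upt_Suc)
  ultimately show ?case by (simp only:)
qed

text \<open>
  The shape of the output when a Cauchy name is written: the leading 0, then \<^emph>\<open>c\<close> silent rounds, then a
  block in every round.
\<close>

lemma output_seq_name:
  assumes z: "z 0 = 1" "\<And>i. i < c \<Longrightarrow> z (Suc i) = 0" "\<And>i. z (Suc (c + i)) = m i + 2"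
  shows "\<And>n. map bit_symbol (concat (map (\<lambda>i. emission (z i)) [0..<n])) =
      map (seq_name m :: nat \<Rightarrow> 's::zero_neq_one) [0..<length (concat (map (\<lambda>i. emission (z i)) [0..<n]))]"
    and "\<And>k. \<exists>n. length (concat (map (\<lambda>i. emission (z i)) [0..<n])) \<ge> k"
proof -
  let ?out = "\<lambda>n. concat (map (\<lambda>i. emission (z i)) [0..<n])"
  have early: "?out (Suc n) = [False]" if "n \<le> c" for n
    using that
  proof (induction n)
    case 0
    then show ?case by (simp add: z emission_def)
  next
    case (Suc n)
    then show ?case using z(2)[of n] by (simp add: emission_def)
  qed
  have late: "?out (Suc (c + i)) = [False] @ concat (map (\<lambda>i. emission (m i + 2)) [0..<i])" for i
  proof (induction i)
    case 0
    then show ?case using early[of c] by simp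
  next
    case (Suc i)
    then show ?case using z(3)[of i] by simp
  qed
  have cases: "n = 0 \<or> (\<exists>n'\<le>c. n = Suc n') \<or> (\<exists>i. n = Suc (c + i))" for n
    by (cases n) (auto, metis le_add_diff_inverse nat_le_linear)
  have len: "length (?out (Suc (c + i))) = Suc (block_start m i)" for i
    unfolding late using arg_cong[OF map_seq_name[of m i, where ?'a = real], of length] by simp
  show "map bit_symbol (?out n) = map (seq_name m :: nat \<Rightarrow> 's) [0..<length (?out n)]" for n
    using cases[of n]
  proof (elim disjE exE conjE)
    assume "n = 0"
    then show ?thesis by simp
  next
    fix n' assume "n' \<le> c" "n = Suc n'"
    then have "?out n = [False]" using early by blast
    then show ?thesis
      using map_seq_name[of m 0, where ?'a = 's] by (simp add: block_start_def)
  next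
    fix i assume n: "n = Suc (c + i)"
    show ?thesis unfolding n len unfolding late by (rule map_seq_name)
  qed
  fix k
  have "k \<le> block_start m k"
    by (rule strict_mono_imp_increasing[OF strict_mono_block_start])
  then show "\<exists>n. length (?out n) \<ge> k" using len[of k] by (intro exI[of _ "Suc (c + k)"]) linarith
qed

lemma computable_on_wordsI:
  assumes "wf_machine M" and "\<And>n. transforms M (P n) (Q n)" and inj: "\<And>m n. P m = P n \<Longrightarrow> Q m = Q n"
  shows "\<exists>F. computable_on_words F \<and> (\<forall>n. F (P n) = Some (Q n))"
proof -
  define F where "F p = (if p \<in> range P then Some (Q (SOME n. p = P n)) else None)" for p
  have F: "F (P n) = Some (Q n)" for n
  proof -
    have "P n = P (SOME k. P n = P k)" by (rule someI[of _ n]) simp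
    then have "Q n = Q (SOME k. P n = P k)" by (rule inj)
    then show ?thesis by (simp add: F_def)
  qed
  have "dom F = range P" by (auto simp: F_def split: if_splits)
  then have "\<forall>p \<in> dom F. transforms M p (the (F p))" using assms(2) F by auto
  then have "computable_on_words F" unfolding computable_on_words_def using assms(1) by blast
  with F show ?thesis by blast
qed

text \<open>
  The constant \<^emph>\<open>c\<close> is a delay: it allows the \<^emph>\<open>i\<close>-th output to depend on a better approximation of the
  input than the \<^emph>\<open>i\<close>-th one. The state consists of the number of rounds and the current block. Round 1
  reads the empty block in front of the leading 0, the next \<^emph>\<open>c\<close> rounds are silent, and round \<^emph>\<open>i + c + 2\<close>
  writes block \<^emph>\<open>i\<close>.
\<close>

lemma computable_block_map:
  assumes H: "recursive H"
  shows "\<exists>F. computable_on_words F \<and> (\<forall>n. F (seq_name n :: nat \<Rightarrow> 's::{finite, zero_neq_one}) =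
    Some (seq_name (\<lambda>i. H (pair i (n (c + i))))))"
proof -
  define S where "S z = pair (Suc (pfst (pfst z))) (psnd z)" for z
  define W where "W v = (if pfst v = 1 then 1 else if pfst v \<le> Suc c then 0
      else H (pair (pfst v - Suc (Suc c)) (psnd v - 1)) + 2)" for v
  have "recursive S" unfolding S_def by (intro rec_intros)
  moreover have "recursive W" unfolding W_def by (intro rec_intros rec_comp[OF H])
  ultimately obtain M :: "'s machine" where wf: "wf_machine M"
    and M: "\<And>p q a v. \<lbrakk>codes_blocks p a; v 0 = 0; \<And>i. v (Suc i) = S (pair (v i) (a i));
      \<And>n. map bit_symbol (concat (map (\<lambda>i. emission (W (v (Suc i)))) [0..<n])) =
        map q [0..<length (concat (map (\<lambda>i. emission (W (v (Suc i)))) [0..<n]))];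
      \<And>m. \<exists>n. length (concat (map (\<lambda>i. emission (W (v (Suc i)))) [0..<n])) \<ge> m\<rbrakk> \<Longrightarrow> transforms M p q"
    using transducer_machine[of S W, where ?'s = 's] by blast
  have "transforms M (seq_name n) (seq_name (\<lambda>i. H (pair i (n (c + i)))))" for n
  proof -
    define a where "a i = (case i of 0 \<Rightarrow> 0 | Suc i \<Rightarrow> Suc (n i))" for i
    define v where "v i = (case i of 0 \<Rightarrow> 0 | Suc j \<Rightarrow> pair i (a j))" for i
    have pf0: "pfst 0 = 0" using prod_encode_inverse[of "(0, 0)"] by (simp add: prod_encode_def)
    have v: "v 0 = 0" "v (Suc i) = S (pair (v i) (a i))" for i
      by (auto simp: v_def S_def pf0 split: nat.split)
    show ?thesis
      by (rule M[OF _ v output_seq_name[where c = c]])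
        (auto simp: a_def[abs_def] codes_blocks_seq_name W_def v_def)
  qed
  then show ?thesis
    by (intro computable_on_wordsI[OF wf, of seq_name]) (auto dest: seq_name_inject)
qed

text \<open>
  After the block \<^emph>\<open>1\<dots>1\<close> of length \<^emph>\<open>k\<close> the name of \<^emph>\<open>k\<close> has only empty blocks, so the sum of the
  blocks read is \<^emph>\<open>k\<close> in every round.
\<close>

lemma computable_block_sequence:
  assumes G: "recursive G"
  shows "\<exists>F. computable_on_words F \<and> (\<forall>k. F (nat_name k :: nat \<Rightarrow> 's::{finite, zero_neq_one}) =
    Some (seq_name (\<lambda>i. G (pair k i))))"
proof -
  define S where "S z = pair (Suc (pfst (pfst z))) (psnd (pfst z) + psnd z)" for z
  define W where "W v = (if pfst v = 1 then 1 else G (pair (psnd v) (pfst v - 2)) + 2)" for v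
  have "recursive S" unfolding S_def by (intro rec_intros)
  moreover have "recursive W" unfolding W_def by (intro rec_intros rec_comp[OF G])
  ultimately obtain M :: "'s machine" where wf: "wf_machine M"
    and M: "\<And>p q a v. \<lbrakk>codes_blocks p a; v 0 = 0; \<And>i. v (Suc i) = S (pair (v i) (a i));
      \<And>n. map bit_symbol (concat (map (\<lambda>i. emission (W (v (Suc i)))) [0..<n])) =
        map q [0..<length (concat (map (\<lambda>i. emission (W (v (Suc i)))) [0..<n]))];
      \<And>m. \<exists>n. length (concat (map (\<lambda>i. emission (W (v (Suc i)))) [0..<n])) \<ge> m\<rbrakk> \<Longrightarrow> transforms M p q"
    using transducer_machine[of S W, where ?'s = 's] by blast
  have "transforms M (nat_name k) (seq_name (\<lambda>i. G (pair k i)))" for k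
  proof -
    define v where "v i = (if i = 0 then 0 else pair i k)" for i
    have pf0: "pfst 0 = 0" "psnd 0 = 0"
      using prod_encode_inverse[of "(0, 0)"] by (simp_all add: prod_encode_def)
    have v: "v 0 = 0" "v (Suc i) = S (pair (v i) (if i = 0 then k else 0))" for i
      by (auto simp: v_def S_def pf0)
    show ?thesis
      by (rule M[OF codes_blocks_nat_name v output_seq_name[where c = 0]]) (auto simp: W_def v_def)
  qed
  then show ?thesis
    by (intro computable_on_wordsI[OF wf, of nat_name]) (auto dest: nat_name_inject)
qed

section \<open>Machines as recursive functions\<close>

text \<open>
  An infinite sequence of symbol codes, almost all of them 0, is coded by iterated pairing: the first
  component is the first entry, and the second component codes the rest. As \<^emph>\<open>pair 0 0 = 0\<close>, the number 0
  codes the sequence of blanks.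
\<close>

definition entry :: "nat \<Rightarrow> nat \<Rightarrow> nat" where
  "entry x i = pfst ((psnd ^^ i) x)"

lemma pair_0: "pfst 0 = 0" "psnd 0 = 0"
  using prod_encode_inverse[of "(0, 0)"] by (simp_all add: prod_encode_def)

lemma entry_simps:
  "entry (pair a x) 0 = a" "entry (pair a x) (Suc i) = entry x i"
  "entry (psnd x) i = entry x (Suc i)" "pfst x = entry x 0" "entry 0 i = 0"
proof -
  have "(psnd ^^ i) 0 = 0" by (induction i) (simp_all add: pair_0)
  then show "entry 0 i = 0" by (simp add: entry_def pair_0)
qed (simp_all add: entry_def funpow_Suc_right del: funpow.simps(2))

text \<open>
  A tape is coded relative to its head: the second component codes the cells from the head to the right,
  the first component the cells to the left of the head, read leftwards.
\<close>

fun tape_rep :: "('s option \<Rightarrow> nat) \<Rightarrow> (int \<Rightarrow> 's option) \<times> int \<Rightarrow> nat \<Rightarrow> bool" where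
  "tape_rep enc (T, h) t \<longleftrightarrow>
     (\<forall>i. entry (psnd t) i = enc (T (h + int i)) \<and> entry (pfst t) i = enc (T (h - 1 - int i)))"

fun move_code :: "move \<Rightarrow> nat" where
  "move_code MoveLeft = 0"
| "move_code Stay = 1"
| "move_code MoveRight = 2"

fun act_code :: "('s option \<Rightarrow> nat) \<Rightarrow> 's option \<times> move \<Rightarrow> nat" where
  "act_code enc (b, m) = pair (enc b) (move_code m)"

definition tape_act :: "nat \<Rightarrow> nat \<Rightarrow> nat" where
  "tape_act a t =
     (let l = pfst t; r = pair (pfst a) (psnd (psnd t)) in
      if psnd a = 0 then pair (psnd l) (pair (pfst l) r)
      else if psnd a = 1 then pair l r
      else pair (pair (pfst a) l) (psnd (psnd t)))"

lemma tape_rep_update: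
  assumes "tape_rep enc T t"
  shows "tape_rep enc (update_tape a T) (tape_act (act_code enc a) t)"
proof -
  obtain b m where a: "a = (b, m)" by force
  obtain C h where T: "T = (C, h)" by force
  have R: "entry (psnd t) i = enc (C (h + int i))" and L: "entry (pfst t) i = enc (C (h - 1 - int i))" for i
    using assms by (auto simp: T)
  have R': "entry (psnd (psnd t)) i = enc (C (h + int (Suc i)))" for i
    using R[of "Suc i"] by (simp only: entry_simps)
  have L': "entry (psnd (pfst t)) i = enc (C (h - 1 - int (Suc i)))" for i
    using L[of "Suc i"] by (simp only: entry_simps)
  have L0: "pfst (pfst t) = enc (C (h - 1))"
    using L[of 0] by (simp add: entry_def)
  show ?thesis
  proof (cases m)
    case MoveLeft
    have "entry (pair (enc (C (h - 1))) (pair (enc b) (psnd (psnd t)))) i = enc ((C(h := b)) (h - 1 + int i))" for i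
    proof (cases i)
      case (Suc j)
      then show ?thesis using R' by (cases j) (auto simp: entry_simps(1,2) algebra_simps)
    qed (simp add: entry_simps(1))
    then show ?thesis
      using L' by (simp add: a T MoveLeft tape_act_def Let_def L0 algebra_simps)
  next
    case Stay
    have "entry (pair (enc b) (psnd (psnd t))) i = enc ((C(h := b)) (h + int i))" for i
      using R' by (cases i) (auto simp: entry_simps(1,2))
    then show ?thesis
      using L by (simp add: a T Stay tape_act_def Let_def)
  next
    case MoveRight
    have "entry (pair (enc b) (pfst t)) i = enc ((C(h := b)) (h - int i))" for i
      using L by (cases i) (auto simp: entry_simps(1,2) algebra_simps)
    then show ?thesis
      using R' by (simp add: a T MoveRight tape_act_def Let_def algebra_simps)
  qed
qed

fun tapes_rep :: "('s option \<Rightarrow> nat) \<Rightarrow> ((int \<Rightarrow> 's option) \<times> int) list \<Rightarrow> nat \<Rightarrow> bool" where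
  "tapes_rep enc [] c \<longleftrightarrow> True"
| "tapes_rep enc (T # Ts) c \<longleftrightarrow> tape_rep enc T (pfst c) \<and> tapes_rep enc Ts (psnd c)"

fun list_code :: "('a \<Rightarrow> nat) \<Rightarrow> 'a list \<Rightarrow> nat" where
  "list_code f [] = 0"
| "list_code f (x # xs) = pair (f x) (list_code f xs)"

fun scan :: "nat \<Rightarrow> nat \<Rightarrow> nat" where
  "scan 0 c = 0"
| "scan (Suc k) c = pair (pfst (psnd (pfst c))) (scan k (psnd c))"

fun tapes_act :: "nat \<Rightarrow> nat \<Rightarrow> nat \<Rightarrow> nat" where
  "tapes_act 0 a c = 0"
| "tapes_act (Suc k) a c = pair (tape_act (pfst a) (pfst c)) (tapes_act k (psnd a) (psnd c))"

lemma scan_rep: "tapes_rep enc Ts c \<Longrightarrow> scan (length Ts) c = list_code enc (map (\<lambda>(T, h). T h) Ts)"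
proof (induction Ts arbitrary: c)
  case (Cons T Ts)
  then show ?case
    by (cases T) (auto simp: entry_def dest: spec[where x = 0])
qed simp

lemma tapes_rep_update:
  "tapes_rep enc Ts c \<Longrightarrow> length acts = length Ts \<Longrightarrow>
   tapes_rep enc (map2 update_tape acts Ts) (tapes_act (length Ts) (list_code (act_code enc) acts) c)"
proof (induction Ts arbitrary: c acts)
  case (Cons T Ts)
  then obtain a acts' where "acts = a # acts'" by (cases acts) auto
  with Cons show ?case by (simp add: tape_rep_update)
qed simp

lemma tapes_rep_blank:
  assumes "enc None = 0" shows "tapes_rep enc (replicate k (\<lambda>_. None, 0)) 0"
  by (induction k) (simp_all add: assms pair_0 entry_simps(5))

lemma list_code_inject:
  assumes "inj enc"
  shows "length xs = length ys \<Longrightarrow> list_code enc xs = list_code enc ys \<Longrightarrow> xs = ys"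
  by (induction xs ys rule: list_induct2) (auto dest: injD[OF assms])

lemma rec_tape_act:
  assumes "recursive f" "recursive g"
  shows "recursive (\<lambda>x. tape_act (f x) (g x))"
  unfolding tape_act_def Let_def by (intro rec_intros assms)

lemma rec_scan: "recursive f \<Longrightarrow> recursive (\<lambda>x. scan k (f x))"
  by (induction k arbitrary: f) (auto intro!: rec_intros)

lemma rec_tapes_act: "recursive f \<Longrightarrow> recursive g \<Longrightarrow> recursive (\<lambda>x. tapes_act k (f x) (g x))"
  by (induction k arbitrary: f g) (auto intro!: rec_intros rec_tape_act)

text \<open>
  Transition functions become recursive in this way, since only finitely many of their arguments matter.
\<close>

lemma finite_table_recursive:
  assumes "finite D" and "inj_on key D"
  shows "\<exists>F. recursive F \<and> (\<forall>d \<in> D. F (key d) = val d)"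
  using assms
proof (induction D rule: finite_induct)
  case (insert d D)
  then obtain F where F: "recursive F" "\<forall>d \<in> D. F (key d) = val d" by auto
  let ?F = "\<lambda>x. if x = key d then val d else F x"
  have "recursive ?F" by (intro rec_intros F(1))
  moreover have "\<forall>d' \<in> insert d D. ?F (key d') = val d'"
    using F(2) insert.prems by (auto simp: inj_on_def)
  ultimately show ?case by (intro exI[of _ ?F]) blast
qed (use rec_zero in auto)

text \<open>
  For fixed \<^emph>\<open>j\<close> and \<^emph>\<open>m\<close>, the run of the machine on the \<^emph>\<open>j\<close>-th input is an iteration on codes of
  configurations, in which the output is replaced by its length and by its symbol number \<^emph>\<open>m\<close>.
  Minimization finds a time at which this symbol has been written. It terminates because the
  output is infinite for every \<^emph>\<open>j\<close>.
\<close>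

lemma simulation:
  fixes M :: "'s::{finite, zero_neq_one} machine"
  assumes wf: "wf_machine M" and inp: "recursive inp"
    and tr: "\<And>j. transforms M (\<lambda>i. bit_symbol (inp (pair j i) \<noteq> 0)) (q j)"
  shows "\<exists>f. recursive f \<and> (\<forall>j m. f (pair j m) = 0 \<longleftrightarrow> q j m = 0)"
proof -
  define k where "k = num_tapes M"
  obtain e :: "'s \<Rightarrow> nat" where e: "inj e"
    using finite_imp_inj_to_nat_seg[of "UNIV :: 's set"] by auto
  define enc where "enc x = (case x of None \<Rightarrow> 0 | Some a \<Rightarrow> Suc (e a))" for x
  have enc0: "enc None = 0" by (simp add: enc_def)
  have enc: "inj enc" using e by (auto simp: enc_def inj_on_def split: option.splits)
  define D where "D = {..<num_states M} \<times> {0, 1 :: nat} \<times> {w :: 's option list. length w = k}"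
  define key where "key = (\<lambda>(s, b :: nat, w). pair s (pair b (list_code enc w)))"
  define val where "val = (\<lambda>(s, b :: nat, w). case transition M s (bit_symbol (b \<noteq> 0)) w of
      (s', adv, acts, out) \<Rightarrow> pair s' (pair (of_bool adv) (pair (list_code (act_code enc) acts)
        (case out of None \<Rightarrow> 0 | Some a \<Rightarrow> if a = 0 then 1 else 2))))"
  have "finite {w :: 's option list. set w \<subseteq> UNIV \<and> length w = k}"
    by (rule finite_lists_length_eq) simp
  then have "finite D" by (simp add: D_def)
  moreover have "inj_on key D"
    by (auto simp: inj_on_def D_def key_def dest: list_code_inject[OF enc, rotated])
  ultimately obtain F where F: "recursive F" "\<And>d. d \<in> D \<Longrightarrow> F (key d) = val d"
    using finite_table_recursive[of D key val] by blast
  \<comment> \<open>\<^emph>\<open>t\<close> is an entry of the table: next state, input advance, actions on the tapes, output\<close>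
  define upd where "upd x t pos tapes len res =
      pair (pfst t) (pair (pos + pfst (psnd t)) (pair (tapes_act k (pfst (psnd (psnd t))) tapes)
        (if psnd (psnd (psnd t)) = 0 then pair len res
         else pair (Suc len) (if len = psnd x then psnd (psnd (psnd t)) - 1 else res))))" for x t pos tapes len res
  define look where "look x z = F (pair (pfst z) (pair (if inp (pair (pfst x) (pfst (psnd z))) = 0 then 0 else 1)
      (scan k (pfst (psnd (psnd z))))))" for x z
  define sim where "sim x z = upd x (look x z) (pfst (psnd z)) (pfst (psnd (psnd z)))
      (pfst (psnd (psnd (psnd z)))) (psnd (psnd (psnd (psnd z))))" for x z
  have rec_run: "recursive (\<lambda>x. (sim (a x) ^^ t x) 0)" if "recursive a" "recursive t" for a t
    unfolding sim_def upd_def look_def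
    by (intro rec_iterate rec_intros rec_comp[OF F(1)] rec_comp[OF inp] rec_scan rec_tapes_act
        rec_comp[OF that(1)] that)
  define len where "len z = pfst (psnd (psnd (psnd z)))" for z
  define res where "res z = psnd (psnd (psnd (psnd z)))" for z
  have invariant: "\<exists>tapes r. (sim (pair j m) ^^ t) 0 = pair (ctrl c) (pair (input_pos c) (pair tapes (pair (length (written c)) r)))
      \<and> tapes_rep enc (work c) tapes \<and> length (work c) = k \<and> ctrl c < num_states M \<and>
      (m < length (written c) \<longrightarrow> r = of_bool (written c ! m \<noteq> 0))"
    if "c = (step M (\<lambda>i. bit_symbol (inp (pair j i) \<noteq> 0)) ^^ t) (init_config M)" for j m t c
    using that
  proof (induction t arbitrary: c)
    case 0
    have p00: "pair 0 0 = 0" by (simp add: prod_encode_def)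
    show ?case
      using wf tapes_rep_blank[of enc k, OF enc0] unfolding 0
      by - (intro exI[of _ 0], auto simp: init_config_def k_def wf_machine_def p00)
  next
    case (Suc t)
    let ?p = "\<lambda>i. bit_symbol (inp (pair j i) \<noteq> 0) :: 's"
    define c0 where "c0 = (step M ?p ^^ t) (init_config M)"
    obtain tapes r where IH: "(sim (pair j m) ^^ t) 0 = pair (ctrl c0) (pair (input_pos c0) (pair tapes (pair (length (written c0)) r)))"
      "tapes_rep enc (work c0) tapes" "length (work c0) = k" "ctrl c0 < num_states M"
      "m < length (written c0) \<Longrightarrow> r = of_bool (written c0 ! m \<noteq> 0)"
      using Suc.IH[OF c0_def] by blast
    define w where "w = map (\<lambda>(T, h). T h) (work c0)"
    define b :: nat where "b = (if inp (pair j (input_pos c0)) = 0 then 0 else 1)"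
    have bs: "?p (input_pos c0) = bit_symbol (b \<noteq> 0)" by (simp add: b_def)
    obtain s' adv acts out where t: "transition M (ctrl c0) (bit_symbol (b \<noteq> 0)) w = (s', adv, acts, out)"
      by (metis prod_cases4)
    have lw: "length w = k" by (simp add: w_def IH)
    have "case transition M (ctrl c0) (bit_symbol (b \<noteq> 0)) w of
        (q', adv, acts, out) \<Rightarrow> q' < num_states M \<and> length acts = num_tapes M"
      using wf[unfolded wf_machine_def] IH(4) lw[unfolded k_def] by (elim conjE allE impE) assumption+
    then have t_wf: "s' < num_states M" "length acts = k"
      unfolding t k_def by simp_all
    have c: "c = \<lparr> ctrl = s', input_pos = (if adv then Suc (input_pos c0) else input_pos c0),
            work = map2 update_tape acts (work c0),
            written = written c0 @ (case out of None \<Rightarrow> [] | Some a \<Rightarrow> [a]) \<rparr>"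
    proof -
      have "c = step M ?p c0" using Suc.prems by (simp add: c0_def)
      also have "\<dots> = (case transition M (ctrl c0) (bit_symbol (b \<noteq> 0)) w of (q, adv, acts, out) \<Rightarrow>
          \<lparr> ctrl = q, input_pos = (if adv then Suc (input_pos c0) else input_pos c0),
            work = map2 update_tape acts (work c0),
            written = written c0 @ (case out of None \<Rightarrow> [] | Some a \<Rightarrow> [a]) \<rparr>)"
        unfolding step_def w_def bs ..
      finally show ?thesis unfolding t by simp
    qed
    have "(ctrl c0, b, w) \<in> D" using IH(4) lw by (simp add: D_def b_def)
    from F(2)[OF this]
    have look: "look (pair j m) ((sim (pair j m) ^^ t) 0) = pair s' (pair (of_bool adv) (pair (list_code (act_code enc) acts)
        (case out of None \<Rightarrow> 0 | Some a \<Rightarrow> if a = 0 then 1 else 2)))"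
      using scan_rep[OF IH(2)] t by (simp add: look_def IH(1,3) key_def val_def b_def w_def)
    have "(sim (pair j m) ^^ Suc t) 0 = pair s' (pair (if adv then Suc (input_pos c0) else input_pos c0)
        (pair (tapes_act k (list_code (act_code enc) acts) tapes)
          (case out of None \<Rightarrow> pair (length (written c0)) r
           | Some a \<Rightarrow> pair (Suc (length (written c0))) (if length (written c0) = m then of_bool (a \<noteq> 0) else r))))"
      by (simp add: sim_def[of _ "(sim (pair j m) ^^ t) 0"] look, simp add: IH(1) upd_def split: option.split)
    moreover have "tapes_rep enc (work c) (tapes_act k (list_code (act_code enc) acts) tapes)"
      using tapes_rep_update[OF IH(2), of acts] IH(3) t_wf by (simp add: c)
    moreover have "length (work c) = k" by (simp add: c IH t_wf)
    ultimately show ?case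
      using IH(5) t_wf by (cases out) (auto simp: c nth_append)
  qed
  define T where "T x = (LEAST t. psnd x < len ((sim x ^^ t) 0))" for x
  have long: "\<exists>t. psnd x < len ((sim x ^^ t) 0)" for x
  proof -
    obtain j m where x: "x = pair j m" by (metis prod_decode_inverse surj_pair)
    let ?p = "\<lambda>i. bit_symbol (inp (pair j i) \<noteq> 0) :: 's"
    obtain t where t: "length (output_after M ?p t) \<ge> Suc m"
      using tr[of j] unfolding transforms_def by blast
    define c where "c = (step M ?p ^^ t) (init_config M)"
    obtain tapes r where "(sim (pair j m) ^^ t) 0 =
        pair (ctrl c) (pair (input_pos c) (pair tapes (pair (length (written c)) r)))"
      using invariant[OF c_def, of m] by blast
    then have "len ((sim (pair j m) ^^ t) 0) = length (written c)" by (simp add: len_def)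
    moreover have "length (written c) \<ge> Suc m"
      using t by (simp add: output_after_def c_def)
    ultimately show ?thesis unfolding x by (intro exI[of _ t]) simp
  qed
  have "recursive T" unfolding T_def[abs_def] len_def
    by (intro rec_Least rec_intros rec_run long[unfolded len_def])
  then have "recursive (\<lambda>x. res ((sim x ^^ T x) 0))"
    unfolding res_def by (intro rec_intros rec_run)
  moreover have "res ((sim (pair j m) ^^ T (pair j m)) 0) = 0 \<longleftrightarrow> q j m = 0" for j m
  proof -
    let ?p = "\<lambda>i. bit_symbol (inp (pair j i) \<noteq> 0) :: 's"
    define t where "t = T (pair j m)"
    define c where "c = (step M ?p ^^ t) (init_config M)"
    have "m < len ((sim (pair j m) ^^ t) 0)"
      using LeastI_ex[OF long[of "pair j m"]] unfolding t_def T_def by simp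
    then have m: "m < length (written c)" and r: "res ((sim (pair j m) ^^ t) 0) = of_bool (written c ! m \<noteq> 0)"
      using invariant[OF c_def, of m] by (auto simp: len_def res_def)
    have "written c = map (q j) [0..<length (written c)]"
      using tr[of j] unfolding transforms_def output_after_def c_def by blast
    then have "written c ! m = q j m" using m by (metis add_0 nth_map_upt diff_zero)
    with r show ?thesis by (simp add: t_def)
  qed
  ultimately show ?thesis by blast
qed

text \<open>
  The block \<^emph>\<open>n j i\<close> is determined by the distance of two consecutive zeros of the word.
\<close>

lemma block_recursive:
  fixes n :: "nat \<Rightarrow> nat \<Rightarrow> nat"
  assumes f: "recursive f" and bits: "\<And>j m. f (pair j m) = 0 \<longleftrightarrow> (seq_name (n j) m :: 's::zero_neq_one) = 0"
  shows "\<exists>g. recursive g \<and> (\<forall>j i. g (pair j i) = n j i)"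
proof -
  have bit: "f (pair j m) = 0 \<longleftrightarrow> m \<in> range (block_start (n j))" for j m
    unfolding bits by (simp add: seq_name_def)
  define nxt where "nxt j b = (LEAST m. b < m \<and> f (pair j m) = 0)" for j b
  define bs where "bs j i = (nxt j ^^ i) 0" for j i
  have ex: "\<exists>m. b < m \<and> f (pair j m) = 0" for j b
  proof -
    have "b < block_start (n j) (Suc b)"
      using strict_mono_imp_increasing[OF strict_mono_block_start, of "Suc b" "n j"] by simp
    then show ?thesis using bit by blast
  qed
  have nxt: "nxt j (block_start (n j) i) = block_start (n j) (Suc i)" for j i
    unfolding nxt_def
  proof (rule Least_equality)
    fix m assume "block_start (n j) i < m \<and> f (pair j m) = 0"
    then obtain i' where "m = block_start (n j) i'" "block_start (n j) i < block_start (n j) i'"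
      using bit by auto
    then show "block_start (n j) (Suc i) \<le> m"
      by (simp add: strict_mono_less[OF strict_mono_block_start] strict_mono_less_eq[OF strict_mono_block_start])
  qed (auto simp: bit strict_mono_less[OF strict_mono_block_start])
  have bs: "bs j i = block_start (n j) i" for j i
    by (induction i) (simp_all add: bs_def nxt, simp add: block_start_def)
  have rec_nxt: "recursive (\<lambda>z. nxt (pfst z) (psnd z))"
    unfolding nxt_def by (intro rec_Least rec_intros rec_comp[OF f] ex)
  have rec_bs: "recursive (\<lambda>x. bs (a x) (i x))" if a: "recursive a" and i: "recursive i" for a i
    unfolding bs_def
    using rec_iterate[of "\<lambda>x. nxt (a x)",
        OF rec_comp2[OF rec_nxt rec_comp[OF a rec_pfst[OF rec_id]] rec_psnd[OF rec_id]] i rec_zero] .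
  have "recursive (\<lambda>x. bs (pfst x) (Suc (psnd x)) - bs (pfst x) (psnd x) - 2)"
    by (intro rec_intros rec_bs)
  moreover have "bs j (Suc i) - bs j i - 2 = n j i" for j i
    unfolding bs by (simp add: block_start_def)
  ultimately show ?thesis by (intro exI conjI) auto
qed

section \<open>Inner products\<close>

lemma to_complex_0: "to_complex (0 :: 'f::real_or_complex) = 0"
  using norm_to_complex[of "0 :: 'f"] by simp

lemma to_complex_1: "to_complex (1 :: 'f::real_or_complex) = 1"
proof -
  have "to_complex (1 :: 'f) * to_complex (1 :: 'f) = to_complex (1 :: 'f)"
    by (simp flip: to_complex_mult)
  moreover have "to_complex (1 :: 'f) \<noteq> 0"
    using norm_to_complex[of "1 :: 'f"] by auto
  ultimately show ?thesis by simp
qed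

lemma to_complex_of_real: "to_complex (of_real r :: 'f::real_or_complex) = of_real r"
  by (simp add: of_real_def to_complex_scaleR to_complex_1)

lemma to_complex_diff: "to_complex (x - y :: 'f::real_or_complex) = to_complex x - to_complex y"
  using to_complex_add[of "x - y" y] by simp

lemma to_complex_inject: "to_complex (x :: 'f::real_or_complex) = to_complex y \<longleftrightarrow> x = y"
  using norm_to_complex[of "x - y"] by (auto simp: to_complex_diff)

definition real_part :: "'f::real_or_complex \<Rightarrow> real" where
  "real_part x = Re (to_complex x)"

lemma real_part_add: "real_part (x + y) = real_part x + real_part y"
  by (simp add: real_part_def to_complex_add)

lemma real_part_sum: "real_part (sum f A) = (\<Sum>i\<in>A. real_part (f i))"
  by (induction A rule: infinite_finite_induct) (simp_all add: real_part_add, simp_all add: real_part_def to_complex_0)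

lemma real_part_of_real: "real_part (of_real r :: 'f::real_or_complex) = r"
  by (simp add: real_part_def to_complex_of_real)

lemma real_part_le_norm: "real_part (x :: 'f::real_or_complex) \<le> norm x"
  using complex_Re_le_cmod[of "to_complex x"] by (simp add: real_part_def norm_to_complex)

lemma real_part_scale: "real_part (of_real r * x :: 'f::real_or_complex) = r * real_part x"
  by (simp add: real_part_def to_complex_mult to_complex_of_real)

context hilbert_space begin

lemma ip_add_right: "ip z (x + y) = ip z x + ip z y"
proof -
  have "to_complex (ip z (x + y)) = to_complex (ip z x + ip z y)"
    by (simp add: to_complex_add ip_cnj[where y = z] ip_add_left)
  then show ?thesis by (simp add: to_complex_inject)
qed

lemma norm_ip_commute: "norm (ip x y) = norm (ip y x)"
  by (metis complex_mod_cnj ip_cnj norm_to_complex)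

text \<open>
  There is no conjugation on the abstract scalar field. Products of this form take its place.
\<close>

lemma ip_mult_ip: "ip x y * ip y x = of_real ((norm (ip x y))\<^sup>2)"
proof -
  have "to_complex (ip x y * ip y x) = to_complex (of_real ((norm (ip x y))\<^sup>2) :: 'f)"
    by (simp add: to_complex_mult ip_cnj[where y = y and x = x] to_complex_of_real complex_norm_square[symmetric] norm_to_complex
        del: of_real_power)
  then show ?thesis by (simp only: to_complex_inject)
qed

lemma real_part_ip_commute: "real_part (ip x y) = real_part (ip y x)"
  by (simp add: real_part_def ip_cnj[where y = y and x = x])

lemma ip_zero_left: "ip 0 y = 0"
  using ip_add_left[of 0 0 y] by simp

lemma ip_minus_left: "ip (- x) y = - ip x y"
  using ip_add_left[of x "- x" y] by (simp add: ip_zero_left minus_unique)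

lemma ip_diff_left: "ip (x - y) z = ip x z - ip y z"
  using ip_add_left[of x "- y" z] by (simp add: ip_minus_left)

lemma ip_sum_left: "ip (sum f A) y = (\<Sum>i\<in>A. ip (f i) y)"
  by (induction A rule: infinite_finite_induct) (simp_all add: ip_zero_left ip_add_left)

lemma ip_scaleR_left: "ip (r *\<^sub>R x) y = r *\<^sub>R ip x y"
  by (simp add: ip_scale_left scaleR_conv_of_real flip: smul_of_real)

lemma norm_add_square: "(norm (x + y))\<^sup>2 = (norm x)\<^sup>2 + 2 * real_part (ip x y) + (norm y)\<^sup>2"
proof -
  have "(norm (x + y))\<^sup>2 = real_part (ip (x + y) (x + y))"
    by (simp add: ip_self real_part_of_real del: of_real_power)
  also have "\<dots> = real_part (ip x x) + real_part (ip x y) + real_part (ip y x) + real_part (ip y y)"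
    by (simp add: ip_add_left ip_add_right real_part_add)
  finally show ?thesis
    by (simp add: ip_self real_part_of_real real_part_ip_commute[of y x] del: of_real_power)
qed

lemma norm_smul: "norm (smul a x) = norm a * norm x"
proof -
  have "(of_real ((norm (smul a x))\<^sup>2) :: 'f) = a * ip x (smul a x)"
    unfolding ip_self[symmetric] ip_scale_left ..
  then have "norm (of_real ((norm (smul a x))\<^sup>2) :: 'f) = norm a * norm (ip (smul a x) x)"
    by (simp add: norm_mult norm_ip_commute[of x])
  also have "\<dots> = norm a * (norm a * (norm x)\<^sup>2)"
    by (simp add: ip_scale_left norm_mult ip_self del: of_real_power)
  finally have "(norm (smul a x))\<^sup>2 = (norm a * norm x)\<^sup>2"
    unfolding norm_of_real by (simp add: power2_eq_square)
  then show ?thesis by (simp add: power2_eq_iff_nonneg)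
qed

lemma real_part_ip_le: "real_part (ip x y) \<le> norm x * norm y"
proof -
  have "norm (x + y) \<le> norm x + norm y" by (rule norm_triangle_ineq)
  then have "(norm (x + y))\<^sup>2 \<le> (norm x + norm y)\<^sup>2" by (simp add: power_mono)
  then show ?thesis by (simp add: norm_add_square power2_sum)
qed

lemma norm_ip_le: "norm (ip x y) \<le> norm x * norm y"
proof -
  have "(norm (ip x y))\<^sup>2 = real_part (ip (smul (ip y x) x) y)"
    by (simp add: ip_scale_left ip_mult_ip norm_ip_commute[of y x] real_part_of_real del: of_real_power)
  also have "\<dots> \<le> norm (ip x y) * (norm x * norm y)"
    using real_part_ip_le[of "smul (ip y x) x" y] by (simp add: norm_smul norm_ip_commute[of y x])
  finally show ?thesis
    by (cases "ip x y = 0") (simp_all add: power2_eq_square)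
qed

lemma bounded_linear_ip_left: "bounded_linear (\<lambda>x. ip x y)"
  by (rule bounded_linear_intro[where K = "norm y"]) (auto simp: ip_add_left ip_scaleR_left norm_ip_le)

lemma bounded_linear_smul: "bounded_linear (smul a)"
proof (rule bounded_linear_intro[where K = "norm a"])
  show "smul a (r *\<^sub>R x) = r *\<^sub>R smul a x" for r x
    by (simp add: mult.commute flip: smul_of_real)
qed (auto simp: scale_right_distrib norm_smul)

end

section \<open>Expansions in an orthonormal basis\<close>

locale hilbert_space_with_basis = hilbert_space smul ip
  for smul :: "'f::real_or_complex \<Rightarrow> 'h::banach \<Rightarrow> 'h" and ip :: "'h \<Rightarrow> 'h \<Rightarrow> 'f" +
  fixes e :: "nat \<Rightarrow> 'h"
  assumes orthonormal: "ip (e i) (e j) = (if i = j then 1 else 0)"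
    and total: "closure (span (range e)) = UNIV"
begin

definition partial_expansion :: "nat \<Rightarrow> 'h \<Rightarrow> 'h" where
  "partial_expansion n x = (\<Sum>k<n. smul (ip x (e k)) (e k))"

lemma ip_combination: "finite F \<Longrightarrow> ip (\<Sum>k\<in>F. smul (c k) (e k)) (e j) = (if j \<in> F then c j else 0)"
  by (simp add: ip_sum_left ip_scale_left orthonormal if_distrib[of "(*) _"] cong: if_cong)

lemma norm_combination:
  assumes "finite F"
  shows "(norm (\<Sum>k\<in>F. smul (c k) (e k)))\<^sup>2 = (\<Sum>k\<in>F. (norm (c k))\<^sup>2)"
proof -
  let ?s = "\<Sum>k\<in>F. smul (c k) (e k)"
  have "(norm ?s)\<^sup>2 = real_part (ip ?s ?s)"
    by (simp add: ip_self real_part_of_real del: of_real_power)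
  also have "\<dots> = (\<Sum>k\<in>F. real_part (c k * ip (e k) ?s))"
    by (subst ip_sum_left) (simp add: ip_scale_left real_part_sum)
  also have "\<dots> = (\<Sum>k\<in>F. (norm (c k))\<^sup>2)"
  proof (rule sum.cong)
    fix k assume "k \<in> F"
    then have "ip ?s (e k) = c k" using assms by (simp add: ip_combination)
    then have "c k * ip (e k) ?s = of_real ((norm (c k))\<^sup>2)" using ip_mult_ip[of ?s "e k"] by simp
    then show "real_part (c k * ip (e k) ?s) = (norm (c k))\<^sup>2" by (simp only: real_part_of_real)
  qed simp
  finally show ?thesis .
qed

text \<open>
  The partial expansion is the best approximation among the combinations of the first \<^emph>\<open>n\<close> basis vectors,
  by Pythagoras. This gives Bessel's inequality and, with the density of the span, the convergence of
  the expansion.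
\<close>

lemma norm_minus_combination:
  "(norm (x - (\<Sum>k<n. smul (c k) (e k))))\<^sup>2 =
    (norm (x - partial_expansion n x))\<^sup>2 + (\<Sum>k<n. (norm (ip x (e k) - c k))\<^sup>2)"
proof -
  let ?d = "\<Sum>k<n. smul (ip x (e k) - c k) (e k)"
  have d: "x - (\<Sum>k<n. smul (c k) (e k)) = ?d + (x - partial_expansion n x)"
    by (simp add: partial_expansion_def scale_left_diff_distrib sum_subtractf)
  have "ip (x - partial_expansion n x) (e k) = 0" if "k < n" for k
    using that by (simp add: ip_diff_left partial_expansion_def ip_combination)
  then have "ip (e k) (x - partial_expansion n x) = 0" if "k < n" for k
    using that norm_ip_commute by (metis norm_eq_zero)
  then have "ip ?d (x - partial_expansion n x) = 0"
    by (simp add: ip_sum_left ip_scale_left)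
  then show ?thesis
    unfolding d norm_add_square by (simp add: norm_combination real_part_def to_complex_0)
qed

lemma bessel: "(\<Sum>k<n. (norm (ip x (e k)))\<^sup>2) \<le> (norm x)\<^sup>2"
  using norm_minus_combination[of x "\<lambda>_. 0" n] by simp

lemma span_combination:
  assumes "s \<in> span (range e)"
  shows "\<exists>n c. s = (\<Sum>k<n. smul (c k) (e k))"
  using assms
proof (induction rule: span_induct_alt)
  case base
  show ?case by (rule exI[of _ 0]) simp
next
  case (step a x y)
  then obtain j n c where j: "x = e j" and y: "y = (\<Sum>k<n. smul (c k) (e k))" by blast
  define N where "N = max n (Suc j)"
  have "y = (\<Sum>k<N. smul (if k < n then c k else 0) (e k))"
    unfolding y by (rule sum.mono_neutral_cong_left) (auto simp: N_def)
  moreover have "smul a x = (\<Sum>k<N. smul (if k = j then a else 0) (e k))"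
    unfolding j by (subst sum.mono_neutral_cong_right[of _ "{j}" _ "\<lambda>k. smul a (e k)"]) (auto simp: N_def)
  ultimately have "smul a x + y = (\<Sum>k<N. smul ((if k = j then a else 0) + (if k < n then c k else 0)) (e k))"
    by (simp only: scale_left_distrib sum.distrib)
  then show ?case
    by (intro exI[of _ N] exI[of _ "\<lambda>k. (if k = j then a else 0) + (if k < n then c k else 0)"])
qed

lemma partial_expansion_tendsto: "(\<lambda>n. partial_expansion n x) \<longlonglongrightarrow> x"
proof (rule metric_LIMSEQ_I)
  fix r :: real assume "r > 0"
  then obtain s where s: "s \<in> span (range e)" "dist s x < r"
    using total by (metis UNIV_I closure_approachable)
  obtain n c where c: "s = (\<Sum>k<n. smul (c k) (e k))" using span_combination[OF s(1)] by blast
  have "dist (partial_expansion m x) x < r" if "m \<ge> n" for m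
  proof -
    have "s = (\<Sum>k<m. smul (if k < n then c k else 0) (e k))"
      unfolding c using that by (intro sum.mono_neutral_cong_left) auto
    then have "(norm (x - partial_expansion m x))\<^sup>2 \<le> (norm (x - s))\<^sup>2"
      using norm_minus_combination[of x "\<lambda>k. if k < n then c k else 0" m] by (simp add: sum_nonneg)
    then have "norm (x - partial_expansion m x) \<le> norm (x - s)" by simp
    then show ?thesis using s(2) by (simp add: dist_norm norm_minus_commute)
  qed
  then show "\<exists>n. \<forall>m\<ge>n. dist (partial_expansion m x) x < r" by blast
qed

section \<open>Frames and surjective operators\<close>

text \<open>
  The upper frame bound, dualized: for \<^emph>\<open>y = (\<Sum>k\<in>F. c k f k)\<close>, the inequality of Cauchy and Schwarz applied to
  \<^emph>\<open>\<langle>y, y\<rangle> = (\<Sum>k\<in>F. c k \<langle>f k, y\<rangle>)\<close> bounds \<^emph>\<open>\<parallel>y\<parallel>^2\<close> by the norm of \<^emph>\<open>c\<close> times \<^emph>\<open>\<surd>B \<parallel>y\<parallel>\<close>, and one factor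
  \<^emph>\<open>\<parallel>y\<parallel>\<close> cancels.
\<close>

lemma norm_synthesis_le:
  assumes B: "\<And>x. (\<Sum>k\<in>F. (norm (ip x (f k)))\<^sup>2) \<le> B * (norm x)\<^sup>2"
  shows "(norm (\<Sum>k\<in>F. smul (c k) (f k)))\<^sup>2 \<le> B * (\<Sum>k\<in>F. (norm (c k))\<^sup>2)"
proof -
  let ?y = "\<Sum>k\<in>F. smul (c k) (f k)" and ?C = "\<Sum>k\<in>F. (norm (c k))\<^sup>2"
  have "(norm ?y)\<^sup>2 = real_part (ip ?y ?y)"
    by (simp add: ip_self real_part_of_real del: of_real_power)
  also have "\<dots> = (\<Sum>k\<in>F. real_part (c k * ip (f k) ?y))"
    by (subst ip_sum_left) (simp add: ip_scale_left real_part_sum)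
  also have "\<dots> \<le> (\<Sum>k\<in>F. norm (c k) * norm (ip ?y (f k)))"
  proof (rule sum_mono)
    fix k
    show "real_part (c k * ip (f k) ?y) \<le> norm (c k) * norm (ip ?y (f k))"
      using real_part_le_norm[of "c k * ip (f k) ?y"] by (simp add: norm_mult norm_ip_commute[of ?y])
  qed
  finally have "((norm ?y)\<^sup>2)\<^sup>2 \<le> (\<Sum>k\<in>F. norm (c k) * norm (ip ?y (f k)))\<^sup>2"
    by (rule power_mono) simp
  also have "\<dots> \<le> ?C * (\<Sum>k\<in>F. (norm (ip ?y (f k)))\<^sup>2)"
    by (rule Cauchy_Schwarz_ineq_sum)
  also have "\<dots> \<le> ?C * (B * (norm ?y)\<^sup>2)"
    by (intro mult_left_mono B sum_nonneg) simp
  finally have 1: "(norm ?y)\<^sup>2 * (norm ?y)\<^sup>2 \<le> (B * ?C) * (norm ?y)\<^sup>2"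
    by (simp add: power2_eq_square mult_ac)
  show ?thesis
  proof (cases "?y = 0")
    case True
    \<comment> \<open>the hypothesis for the unit vector \<^emph>\<open>e 0\<close>\<close>
    have "0 \<le> B"
    proof -
      have "0 \<le> (\<Sum>k\<in>F. (norm (ip (e 0) (f k)))\<^sup>2)" by (simp add: sum_nonneg)
      also have "\<dots> \<le> B * (norm (e 0))\<^sup>2" by (rule B)
      also have "(norm (e 0))\<^sup>2 = 1" using norm_combination[of "{0}" "\<lambda>_. 1"] by simp
      finally show ?thesis by simp
    qed
    then show ?thesis using True by (simp add: sum_nonneg)
  next
    case False
    then have "(norm ?y)\<^sup>2 > 0" by simp
    then show ?thesis using 1 by (rule mult_right_le_imp_le[rotated])
  qed
qed

text \<open>
  By Baire's theorem one of the closed sets \<^emph>\<open>C m\<close> contains a ball, and on the differences of its elements all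
  \<^emph>\<open>\<langle>\<cdot>, z\<rangle>\<close> are bounded by \<^emph>\<open>2 m\<close>.
\<close>

lemma uniform_boundedness:
  assumes pw: "\<And>x. \<exists>m. \<forall>z\<in>Z. norm (ip x z) \<le> m"
  shows "\<exists>K. \<forall>z\<in>Z. norm z \<le> K"
proof -
  define C where "C m = {x. \<forall>z\<in>Z. norm (ip x z) \<le> real m}" for m
  have C_Inter: "C m = (\<Inter>z\<in>Z. {x. norm (ip x z) \<le> real m})" for m by (auto simp: C_def)
  have closed: "closed (C m)" for m
    unfolding C_Inter
    by (intro closed_INT ballI closed_Collect_le continuous_intros
        bounded_linear.continuous_on[OF bounded_linear_ip_left])
  have "\<Union>(range C) = UNIV"
  proof -
    have "\<exists>m. x \<in> C m" for x
    proof -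
      obtain r where "\<forall>z\<in>Z. norm (ip x z) \<le> r" using pw by blast
      then have "x \<in> C (nat \<lceil>r\<rceil>)" unfolding C_def using real_nat_ceiling_ge[of r] order_trans by fastforce
      then show ?thesis by blast
    qed
    then show ?thesis by auto
  qed
  then have "interior (\<Union>(range C)) \<noteq> {}" by simp
  then obtain m where m: "interior (C m) \<noteq> {}"
    using Baire_category_alt[of "euclidean :: 'h topology" "range C"] closed
    by (auto simp: completely_metrizable_space_euclidean closed_closedin[symmetric])
  then obtain a r where r: "r > 0" "ball a r \<subseteq> C m"
    by (meson ex_in_conv mem_interior)
  have "norm z \<le> 4 * real m / r" if z: "z \<in> Z" for z
  proof (cases "z = 0")
    case False
    define u where "u = (r / (2 * norm z)) *\<^sub>R z"
    have u: "norm u < r" using r False by (simp add: u_def)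
    have "norm (ip (a + u) z) \<le> real m" "norm (ip a z) \<le> real m"
      using r u z by (auto simp: C_def dist_norm subset_iff)
    moreover have "ip u z = ip (a + u) z - ip a z" by (simp add: ip_add_left)
    ultimately have "norm (ip u z) \<le> 2 * real m" using norm_triangle_ineq4[of "ip (a + u) z" "ip a z"] by simp
    moreover have "norm (ip u z) = r / (2 * norm z) * (norm z)\<^sup>2"
      using r by (simp add: u_def ip_scaleR_left ip_self del: of_real_power)
    ultimately show ?thesis using r False by (simp add: field_simps power2_eq_square)
  qed (use r in simp)
  then show ?thesis by blast
qed

text \<open>
  The upper bound comes from testing \<^emph>\<open>U\<close> on the combination with the coefficients \<^emph>\<open>\<langle>x, U (e k)\<rangle>\<close>. For the lower
  bound, expanding \<^emph>\<open>y\<close> in the basis gives \<^emph>\<open>|\<langle>U y, z\<rangle>| \<le> \<parallel>y\<parallel> \<surd>(S z)\<close>, where \<^emph>\<open>S z\<close> is the sum in the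
  definition of frames. Since \<^emph>\<open>U\<close> is onto, the \<^emph>\<open>z\<close> with \<^emph>\<open>S z \<le> 1\<close> satisfy the hypothesis of uniform
  boundedness, and the lower bound follows by scaling.
\<close>

lemma frame_of_surjective:
  assumes lin: "Vector_Spaces.linear smul smul U" and bd: "\<And>x. norm (U x) \<le> K * norm x" and surj: "surj U"
  shows "is_frame ip (\<lambda>k. U (e k))"
proof -
  interpret U: Vector_Spaces.linear smul smul U by (rule lin)
  have U_scaleR: "U (r *\<^sub>R x) = r *\<^sub>R U x" for r x
    using U.scale[of "of_real r" x] by (simp add: smul_of_real)
  have U_bl: "bounded_linear U"
    by (rule bounded_linear_intro[where K = K]) (auto simp: U.add U_scaleR bd mult.commute)
  let ?a = "\<lambda>x k. ip x (U (e k))"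
  have ip_U: "ip (U (\<Sum>k<n. smul (c k) (e k))) x = (\<Sum>k<n. c k * ip (U (e k)) x)" for c n x
    by (simp add: U.sum U.scale ip_sum_left ip_scale_left)
  have upper: "(\<Sum>k<n. (norm (?a x k))\<^sup>2) \<le> K\<^sup>2 * (norm x)\<^sup>2" for x n
  proof -
    let ?w = "\<Sum>k<n. smul (?a x k) (e k)" and ?S = "\<Sum>k<n. (norm (?a x k))\<^sup>2"
    have "ip (U ?w) x = of_real ?S"
      unfolding ip_U by (simp add: ip_mult_ip)
    then have "?S = norm (ip (U ?w) x)" by (simp add: sum_nonneg del: of_real_sum)
    also have "\<dots> \<le> K * norm ?w * norm x"
      using norm_ip_le[of "U ?w" x] mult_right_mono[OF bd[of ?w] norm_ge_zero[of x]] by linarith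
    finally have "?S\<^sup>2 \<le> (K * norm ?w * norm x)\<^sup>2"
      by (rule power_mono) (simp add: sum_nonneg)
    also have "\<dots> = K\<^sup>2 * (norm x)\<^sup>2 * ?S" by (simp add: power_mult_distrib norm_combination)
    finally have "?S * ?S \<le> K\<^sup>2 * (norm x)\<^sup>2 * ?S" by (simp add: power2_eq_square)
    moreover have "?S \<ge> 0" by (simp add: sum_nonneg)
    ultimately show ?thesis
      by (cases "?S = 0") (simp_all add: mult_le_cancel_right)
  qed
  have summ: "summable (\<lambda>k. (norm (?a x k))\<^sup>2)" for x
    by (rule summableI_nonneg_bounded[OF _ upper]) simp
  let ?S = "\<lambda>x. \<Sum>k. (norm (?a x k))\<^sup>2"
  have upper': "?S x \<le> K\<^sup>2 * (norm x)\<^sup>2" for x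
    by (rule suminf_le_const[OF summ upper])
  have S_nonneg: "?S x \<ge> 0" for x by (rule suminf_nonneg[OF summ]) simp
  have test: "norm (ip (U y) z) \<le> norm y * sqrt (?S z)" for y z
  proof -
    have lim: "(\<lambda>n. norm (ip (U (partial_expansion n y)) z)) \<longlonglongrightarrow> norm (ip (U y) z)"
      by (intro tendsto_norm bounded_linear.tendsto[OF bounded_linear_ip_left]
          bounded_linear.tendsto[OF U_bl] partial_expansion_tendsto)
    have "norm (ip (U (partial_expansion n y)) z) \<le> norm y * sqrt (?S z)" for n
    proof -
      have "norm (ip (U (partial_expansion n y)) z) \<le> (\<Sum>k<n. norm (ip y (e k)) * norm (?a z k))"
        unfolding partial_expansion_def ip_U
        by (rule sum_norm_le) (simp add: norm_mult norm_ip_commute[of z])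
      then have "(norm (ip (U (partial_expansion n y)) z))\<^sup>2 \<le> (\<Sum>k<n. norm (ip y (e k)) * norm (?a z k))\<^sup>2"
        by (rule power_mono) simp
      also have "\<dots> \<le> (\<Sum>k<n. (norm (ip y (e k)))\<^sup>2) * (\<Sum>k<n. (norm (?a z k))\<^sup>2)"
        by (rule Cauchy_Schwarz_ineq_sum)
      also have "\<dots> \<le> (norm y)\<^sup>2 * ?S z"
        by (intro mult_mono bessel sum_le_suminf summ sum_nonneg) simp_all
      also have "\<dots> = (norm y * sqrt (?S z))\<^sup>2" by (simp add: power_mult_distrib S_nonneg)
      finally show ?thesis by (rule power2_le_imp_le) (simp add: S_nonneg)
    qed
    then show ?thesis by (intro LIMSEQ_le_const2[OF lim]) blast
  qed
  define Z where "Z = {z. ?S z \<le> 1}"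
  have "\<exists>m. \<forall>z\<in>Z. norm (ip x z) \<le> m" for x
  proof -
    obtain y where y: "U y = x" using surj by (metis surjD)
    have "norm (ip x z) \<le> norm y" if "z \<in> Z" for z
    proof -
      have "norm y * sqrt (?S z) \<le> norm y * 1"
        using that by (intro mult_left_mono) (simp_all add: Z_def)
      then show ?thesis using test[of y z] y by simp
    qed
    then show ?thesis by blast
  qed
  then obtain L where L: "\<And>z. z \<in> Z \<Longrightarrow> norm z \<le> L" using uniform_boundedness[of Z] by blast
  have norm_scaleR: "?S (r *\<^sub>R z) = r\<^sup>2 * ?S z" for r z
    using summ[of z] by (simp add: ip_scaleR_left power_mult_distrib suminf_mult)
  define L' where "L' = max L 1"
  have lower: "(norm x)\<^sup>2 \<le> L'\<^sup>2 * ?S x" for x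
  proof (cases "?S x = 0")
    case True
    \<comment> \<open>all multiples of \<^emph>\<open>x\<close> lie in \<^emph>\<open>Z\<close>, which is bounded\<close>
    have "norm x = 0"
    proof (rule ccontr)
      assume x: "norm x \<noteq> 0"
      let ?t = "(L' + 1) / norm x"
      have "?t *\<^sub>R x \<in> Z" unfolding Z_def mem_Collect_eq norm_scaleR True by simp
      then have "norm (?t *\<^sub>R x) \<le> L'" using L L'_def by fastforce
      then show False using x by (simp add: L'_def split: if_splits)
    qed
    then show ?thesis using True by simp
  next
    case False
    then have S: "?S x > 0" using S_nonneg[of x] by linarith
    have "(1 / sqrt (?S x)) *\<^sub>R x \<in> Z"
      using S unfolding Z_def mem_Collect_eq norm_scaleR by (simp add: power_divide)
    then have "norm ((1 / sqrt (?S x)) *\<^sub>R x) \<le> L'" using L L'_def by fastforce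
    then have "norm x \<le> L' * sqrt (?S x)" using S by (simp add: field_simps)
    then have "(norm x)\<^sup>2 \<le> (L' * sqrt (?S x))\<^sup>2" by (rule power_mono) simp
    then show ?thesis using S by (simp add: power_mult_distrib)
  qed
  have L': "L' \<ge> 1" by (simp add: L'_def)
  show ?thesis
    unfolding is_frame_def
  proof (intro exI conjI allI)
    show "1 / L'\<^sup>2 > 0" using L' by simp
    show "K\<^sup>2 + 1 > 0" by (simp add: add_nonneg_pos)
    fix x
    show "1 / L'\<^sup>2 * (norm x)\<^sup>2 \<le> ?S x" using lower[of x] L' by (simp add: field_simps)
    show "?S x \<le> (K\<^sup>2 + 1) * (norm x)\<^sup>2" using upper'[of x] by (simp add: algebra_simps add_increasing)
  qed (rule summ)
qed

text \<open>
  The operator is the synthesis operator of the frame. Surjectivity is proved for the frame operator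
  \<^emph>\<open>S\<close>, which is \<^emph>\<open>U\<close> applied to the vector with the coefficients \<^emph>\<open>\<langle>x, f k\<rangle>\<close>. As in the lemma of Lax and
  Milgram, \<^emph>\<open>A \<parallel>x\<parallel>^2 \<le> \<langle>S x, x\<rangle>\<close> and \<^emph>\<open>\<parallel>S x\<parallel> \<le> B \<parallel>x\<parallel>\<close> suffice.
\<close>

lemma synthesis_operator:
  assumes frame: "is_frame ip f"
  shows "\<exists>U K. Vector_Spaces.linear smul smul U \<and> (\<forall>x. norm (U x) \<le> K * norm x) \<and> surj U \<and> (\<forall>k. U (e k) = f k)"
proof -
  obtain A B where A: "A > 0" and B: "B > 0"
    and summ: "\<And>x. summable (\<lambda>k. (norm (ip x (f k)))\<^sup>2)"
    and lo: "\<And>x. A * (norm x)\<^sup>2 \<le> (\<Sum>k. (norm (ip x (f k)))\<^sup>2)"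
    and hi: "\<And>x. (\<Sum>k. (norm (ip x (f k)))\<^sup>2) \<le> B * (norm x)\<^sup>2"
    using frame unfolding is_frame_def by metis
  have finB: "(\<Sum>k\<in>F. (norm (ip x (f k)))\<^sup>2) \<le> B * (norm x)\<^sup>2" if "finite F" for F x
    using sum_le_suminf[OF summ[of x] that] hi[of x] by (simp add: order_trans)
  have fin: "(norm (\<Sum>k\<in>F. smul (c k) (f k)))\<^sup>2 \<le> B * (\<Sum>k\<in>F. (norm (c k))\<^sup>2)" if "finite F" for F c
    by (rule norm_synthesis_le[OF finB[OF that]])
  have conv: "summable (\<lambda>k. smul (c k) (f k))" if c: "summable (\<lambda>k. (norm (c k))\<^sup>2)" for c
    unfolding summable_Cauchy
  proof (intro allI impI)
    fix r :: real assume r: "r > 0"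
    then have "r\<^sup>2 / B > 0" using B by simp
    then obtain N where N: "\<And>m n. m \<ge> N \<Longrightarrow> norm (\<Sum>k=m..<n. (norm (c k))\<^sup>2) < r\<^sup>2 / B"
      using c unfolding summable_Cauchy by blast
    have "norm (\<Sum>k=m..<n. smul (c k) (f k)) < r" if "m \<ge> N" for m n
    proof -
      have "(norm (\<Sum>k=m..<n. smul (c k) (f k)))\<^sup>2 \<le> B * (\<Sum>k=m..<n. (norm (c k))\<^sup>2)" by (rule fin) simp
      also have "\<dots> < r\<^sup>2" using N[OF that, of n] B by (simp add: sum_nonneg field_simps)
      finally show ?thesis using r by (simp add: power_less_imp_less_base)
    qed
    then show "\<exists>N. \<forall>m\<ge>N. \<forall>n. norm (\<Sum>k=m..<n. smul (c k) (f k)) < r" by blast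
  qed
  define syn where "syn c = (\<Sum>k. smul (c k) (f k))" for c
  have syn_bound: "(norm (syn c))\<^sup>2 \<le> B * T" if c: "\<And>n. (\<Sum>k<n. (norm (c k))\<^sup>2) \<le> T" for c T
  proof -
    have s: "summable (\<lambda>k. (norm (c k))\<^sup>2)" by (rule summableI_nonneg_bounded[OF _ c]) simp
    have "(\<lambda>n. (norm (\<Sum>k<n. smul (c k) (f k)))\<^sup>2) \<longlonglongrightarrow> (norm (syn c))\<^sup>2"
      unfolding syn_def by (intro tendsto_intros summable_LIMSEQ conv[OF s])
    moreover have "(norm (\<Sum>k<n. smul (c k) (f k)))\<^sup>2 \<le> B * T" for n
      by (rule order_trans[OF fin mult_left_mono[OF c]]) (use B in simp_all)
    ultimately show ?thesis by (intro LIMSEQ_le_const2) blast+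
  qed
  define U where "U x = syn (\<lambda>k. ip x (e k))" for x
  have coeff: "summable (\<lambda>k. (norm (ip x (e k)))\<^sup>2)" for x
    by (rule summableI_nonneg_bounded[OF _ bessel]) simp
  have U_add: "U (x + y) = U x + U y" for x y
    unfolding U_def syn_def
    by (subst suminf_add[OF conv[OF coeff] conv[OF coeff]]) (simp add: ip_add_left scale_left_distrib)
  have U_smul: "U (smul a x) = smul a (U x)" for a x
    unfolding U_def syn_def
    by (subst bounded_linear.suminf[OF bounded_linear_smul conv[OF coeff]]) (simp add: ip_scale_left)
  have lin: "Vector_Spaces.linear smul smul U"
    using vector_space_axioms by (simp add: Vector_Spaces.linear_iff U_add U_smul)
  have bd: "norm (U x) \<le> sqrt B * norm x" for x
  proof -
    have "(norm (U x))\<^sup>2 \<le> (sqrt B * norm x)\<^sup>2"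
      using syn_bound[OF bessel, of x] B by (simp add: U_def power_mult_distrib)
    then show ?thesis by (rule power2_le_imp_le) (use B in simp)
  qed
  have Ue: "U (e k) = f k" for k
  proof -
    have "U (e k) = (\<Sum>j\<in>{k}. smul (ip (e k) (e j)) (f j))"
      unfolding U_def syn_def by (rule suminf_finite) (auto simp: orthonormal)
    then show ?thesis by (simp add: orthonormal)
  qed
  have surj: "surj U"
  proof -
    define S where "S x = syn (\<lambda>k. ip x (f k))" for x
    have S_range: "S x \<in> range U" for x
    proof -
      define V where "V n = (\<Sum>k<n. smul (ip x (f k)) (e k))" for n
      have "summable (\<lambda>k. smul (ip x (f k)) (e k))"
        unfolding summable_Cauchy
      proof (intro allI impI)
        fix r :: real assume r: "r > 0"
        then obtain N where N: "\<And>m n. m \<ge> N \<Longrightarrow> norm (\<Sum>k=m..<n. (norm (ip x (f k)))\<^sup>2) < r\<^sup>2"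
          using summ[of x] unfolding summable_Cauchy by (meson zero_less_power)
        have "norm (\<Sum>k=m..<n. smul (ip x (f k)) (e k)) < r" if "m \<ge> N" for m n
        proof -
          have "(norm (\<Sum>k=m..<n. smul (ip x (f k)) (e k)))\<^sup>2 < r\<^sup>2"
            using N[OF that, of n] by (simp add: norm_combination sum_nonneg)
          then show ?thesis using r by (simp add: power_less_imp_less_base)
        qed
        then show "\<exists>N. \<forall>m\<ge>N. \<forall>n. norm (\<Sum>k=m..<n. smul (ip x (f k)) (e k)) < r" by blast
      qed
      then have sums: "(\<lambda>k. smul (ip x (f k)) (e k)) sums (\<Sum>k. smul (ip x (f k)) (e k))" by (rule summable_sums)
      let ?v = "\<Sum>k. smul (ip x (f k)) (e k)"
      have "ip ?v (e j) = ip x (f j)" for j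
      proof -
        have "(\<lambda>k. ip (smul (ip x (f k)) (e k)) (e j)) sums ip ?v (e j)"
          by (rule bounded_linear.sums[OF bounded_linear_ip_left sums])
        moreover have "(\<lambda>k. ip (smul (ip x (f k)) (e k)) (e j)) = (\<lambda>k. if k = j then ip x (f k) else 0)"
          by (auto simp: ip_scale_left orthonormal)
        ultimately show ?thesis using sums_single[of j "\<lambda>k. ip x (f k)"] sums_unique2 by metis
      qed
      then have "U ?v = S x" by (simp add: U_def S_def)
      then show ?thesis by (metis rangeI)
    qed
    have S_diff: "S (x - y) = S x - S y" for x y
      unfolding S_def syn_def
      by (subst suminf_diff[OF conv[OF summ] conv[OF summ]]) (simp add: ip_diff_left scale_left_diff_distrib)
    have S_bd: "norm (S x) \<le> B * norm x" for x
    proof -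
      have "(norm (S x))\<^sup>2 \<le> B * (B * (norm x)\<^sup>2)"
        unfolding S_def by (rule syn_bound) (rule finB, simp)
      then have "(norm (S x))\<^sup>2 \<le> (B * norm x)\<^sup>2" by (simp add: power2_eq_square mult_ac)
      then show ?thesis by (rule power2_le_imp_le) (use B in simp)
    qed
    have S_lo: "A * (norm x)\<^sup>2 \<le> real_part (ip (S x) x)" for x
    proof -
      have "(\<lambda>k. ip (smul (ip x (f k)) (f k)) x) sums ip (S x) x"
        unfolding S_def syn_def
        by (rule bounded_linear.sums[OF bounded_linear_ip_left summable_sums[OF conv[OF summ]]])
      moreover have "ip (smul (ip x (f k)) (f k)) x = of_real ((norm (ip x (f k)))\<^sup>2)" for k
        by (simp add: ip_scale_left ip_mult_ip del: of_real_power)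
      moreover have "(\<lambda>k. of_real ((norm (ip x (f k)))\<^sup>2) :: 'f) sums of_real (\<Sum>k. (norm (ip x (f k)))\<^sup>2)"
        by (rule sums_of_real[OF summable_sums[OF summ]])
      ultimately have "ip (S x) x = of_real (\<Sum>k. (norm (ip x (f k)))\<^sup>2)"
        using sums_unique2 by auto
      then show ?thesis using lo[of x] by (simp only: real_part_of_real)
    qed
    have S_onto: "y \<in> range S" for y
    proof -
      \<comment> \<open>the value of \<^emph>\<open>t\<close> that minimizes the contraction factor \<^emph>\<open>1 - 2 t A + t^2 B^2\<close>\<close>
      define t where "t = A / B\<^sup>2"
      have t: "t > 0" using A B by (simp add: t_def)
      define T where "T x = x - t *\<^sub>R (S x - y)" for x
      \<comment> \<open>the maximum with 0 saves the proof that \<^emph>\<open>A \<le> B\<close>\<close>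
      define q where "q = max 0 (1 - A\<^sup>2 / B\<^sup>2)"
      have q: "0 \<le> q" "q < 1" using A B by (auto simp: q_def)
      have contr: "dist (T x) (T x') \<le> sqrt q * dist x x'" for x x'
      proof -
        define d where "d = x - x'"
        have "T x - T x' = d + (- t) *\<^sub>R S d"
          by (simp add: T_def d_def S_diff algebra_simps)
        then have "(norm (T x - T x'))\<^sup>2 = (norm d)\<^sup>2 + 2 * real_part (ip d ((- t) *\<^sub>R S d)) + (norm ((- t) *\<^sub>R S d))\<^sup>2"
          by (simp only: norm_add_square)
        also have "real_part (ip d ((- t) *\<^sub>R S d)) = - t * real_part (ip (S d) d)"
          unfolding real_part_ip_commute[of d] ip_scaleR_left scaleR_conv_of_real by (rule real_part_scale)
        also have "(norm ((- t) *\<^sub>R S d))\<^sup>2 = t\<^sup>2 * (norm (S d))\<^sup>2" by (simp add: power_mult_distrib)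
        finally have "(norm (T x - T x'))\<^sup>2 =
            (norm d)\<^sup>2 - 2 * (t * real_part (ip (S d) d)) + t\<^sup>2 * (norm (S d))\<^sup>2" by simp
        also have "\<dots> \<le> (norm d)\<^sup>2 - 2 * (t * (A * (norm d)\<^sup>2)) + t\<^sup>2 * (B * norm d)\<^sup>2"
        proof -
          have "t * (A * (norm d)\<^sup>2) \<le> t * real_part (ip (S d) d)"
            by (rule mult_left_mono[OF S_lo]) (use t in simp)
          moreover have "t\<^sup>2 * (norm (S d))\<^sup>2 \<le> t\<^sup>2 * (B * norm d)\<^sup>2"
            by (intro mult_left_mono power_mono S_bd) simp_all
          ultimately show ?thesis by linarith
        qed
        also have "\<dots> = (1 - A\<^sup>2 / B\<^sup>2) * (norm d)\<^sup>2"
          using B by (simp add: t_def field_simps power2_eq_square)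
        also have "\<dots> \<le> q * (norm d)\<^sup>2" by (intro mult_right_mono) (simp_all add: q_def)
        also have "\<dots> = (sqrt q * norm d)\<^sup>2" using q by (simp add: power_mult_distrib)
        finally have "norm (T x - T x') \<le> sqrt q * norm d" by (rule power2_le_imp_le) (use q in simp)
        then show ?thesis by (simp add: dist_norm d_def)
      qed
      have "\<exists>!x. T x = x"
        by (rule banach_fix_type[of "sqrt q"]) (use q contr in \<open>auto simp: real_sqrt_lt_1_iff\<close>)
      then obtain x where "T x = x" by blast
      then have "S x = y" using t by (simp add: T_def)
      then show ?thesis by blast
    qed
    have "y \<in> range U" for y using S_onto[of y] S_range by auto
    then show ?thesis by auto
  qed
  show ?thesis using lin bd surj Ue by blast
qed

end

section \<open>Arithmetic on codes of scalars\<close>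

lemma rat_numbering_code:
  "rat_numbering c = (real (pfst c) - real (pfst (psnd c))) / (real (psnd (psnd c)) + 1)"
  by (simp add: rat_numbering_def numeral_2_eq_2 case_prod_beta)

definition rat_add :: "nat \<Rightarrow> nat \<Rightarrow> nat" where
  "rat_add c d =
     pair (pfst c * Suc (psnd (psnd d)) + pfst d * Suc (psnd (psnd c)))
      (pair (pfst (psnd c) * Suc (psnd (psnd d)) + pfst (psnd d) * Suc (psnd (psnd c)))
       (psnd (psnd c) * psnd (psnd d) + psnd (psnd c) + psnd (psnd d)))"

definition rat_mult :: "nat \<Rightarrow> nat \<Rightarrow> nat" where
  "rat_mult c d =
     pair (pfst c * pfst d + pfst (psnd c) * pfst (psnd d))
      (pair (pfst c * pfst (psnd d) + pfst (psnd c) * pfst d)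
       (psnd (psnd c) * psnd (psnd d) + psnd (psnd c) + psnd (psnd d)))"

definition rat_uminus :: "nat \<Rightarrow> nat" where
  "rat_uminus c = pair (pfst (psnd c)) (pair (pfst c) (psnd (psnd c)))"

lemma rat_numbering_add: "rat_numbering (rat_add c d) = rat_numbering c + rat_numbering d"
proof -
  have "real (psnd (psnd c)) + 1 \<noteq> 0" "real (psnd (psnd d)) + 1 \<noteq> 0" by linarith+
  then show ?thesis by (simp add: rat_numbering_code rat_add_def field_simps)
qed

lemma rat_numbering_mult: "rat_numbering (rat_mult c d) = rat_numbering c * rat_numbering d"
proof -
  have "real (psnd (psnd c)) + 1 \<noteq> 0" "real (psnd (psnd d)) + 1 \<noteq> 0" by linarith+
  then show ?thesis by (simp add: rat_numbering_code rat_mult_def field_simps)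
qed

lemma rat_numbering_uminus: "rat_numbering (rat_uminus c) = - rat_numbering c"
  by (simp add: rat_numbering_code rat_uminus_def minus_divide_left)

lemma pfst_le: "pfst c \<le> c" and psnd_le: "psnd c \<le> c"
  using le_prod_encode_1[of "pfst c" "psnd c"] le_prod_encode_2[of "psnd c" "pfst c"] by simp_all

lemma rat_numbering_bound: "\<bar>rat_numbering c\<bar> \<le> real c"
proof -
  have "pfst c \<le> c" "pfst (psnd c) \<le> c"
    using pfst_le order_trans[OF pfst_le psnd_le] by blast+
  then have "\<bar>real (pfst c) - real (pfst (psnd c))\<bar> \<le> real c" by linarith
  also have "real c * 1 \<le> real c * (real (psnd (psnd c)) + 1)" by (intro mult_left_mono) auto
  finally show ?thesis by (simp add: rat_numbering_code field_simps)
qed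

lemma rec_rat_uminus: "recursive f \<Longrightarrow> recursive (\<lambda>x. rat_uminus (f x))"
  unfolding rat_uminus_def by (intro rec_intros)

lemma rec_rat_add: "recursive f \<Longrightarrow> recursive g \<Longrightarrow> recursive (\<lambda>x. rat_add (f x) (g x))"
  unfolding rat_add_def by (intro rec_intros)

lemma rec_rat_mult: "recursive f \<Longrightarrow> recursive g \<Longrightarrow> recursive (\<lambda>x. rat_mult (f x) (g x))"
  unfolding rat_mult_def by (intro rec_intros)

text \<open>
  In the complex case a code is a pair of codes of rational numbers. The bound by the code itself is crude, but
  it makes the precision needed later a simple function of codes.
\<close>

lemma scalar_arithmetic:
  "\<exists>add mul. recursive (\<lambda>z. add (pfst z) (psnd z)) \<and> recursive (\<lambda>z. mul (pfst z) (psnd z)) \<and>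
    (\<forall>a b. (scalar_numbering (add a b) :: 'f::real_or_complex) = scalar_numbering a + scalar_numbering b) \<and>
    (\<forall>a b. (scalar_numbering (mul a b) :: 'f) = scalar_numbering a * scalar_numbering b) \<and>
    (\<forall>a. norm (scalar_numbering a :: 'f) \<le> 2 * real a)"
proof (cases "range (to_complex :: 'f \<Rightarrow> complex) = UNIV")
  case True
  have sc: "to_complex (scalar_numbering c :: 'f) = Complex (rat_numbering (pfst c)) (rat_numbering (psnd c))" for c
    using True by (simp add: scalar_numbering_def gauss_rat_numbering_def case_prod_beta f_inv_into_f)
  define add where "add a b = pair (rat_add (pfst a) (pfst b)) (rat_add (psnd a) (psnd b))" for a b
  define mul where "mul a b = pair
      (rat_add (rat_mult (pfst a) (pfst b)) (rat_uminus (rat_mult (psnd a) (psnd b))))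
      (rat_add (rat_mult (pfst a) (psnd b)) (rat_mult (psnd a) (pfst b)))" for a b
  have "recursive (\<lambda>z. add (pfst z) (psnd z))" "recursive (\<lambda>z. mul (pfst z) (psnd z))"
    unfolding add_def mul_def by (intro rec_intros rec_rat_add rec_rat_mult rec_rat_uminus)+
  moreover have "(scalar_numbering (add a b) :: 'f) = scalar_numbering a + scalar_numbering b" for a b
    by (rule to_complex_inject[THEN iffD1]) (simp add: to_complex_add sc add_def rat_numbering_add complex_eq_iff)
  moreover have "(scalar_numbering (mul a b) :: 'f) = scalar_numbering a * scalar_numbering b" for a b
    by (rule to_complex_inject[THEN iffD1])
      (simp add: to_complex_mult sc mul_def rat_numbering_add rat_numbering_mult rat_numbering_uminus complex_eq_iff)
  moreover have "norm (scalar_numbering a :: 'f) \<le> 2 * real a" for a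
  proof -
    have "norm (scalar_numbering a :: 'f) \<le> \<bar>rat_numbering (pfst a)\<bar> + \<bar>rat_numbering (psnd a)\<bar>"
      using cmod_le[of "Complex (rat_numbering (pfst a)) (rat_numbering (psnd a))"]
        norm_to_complex[of "scalar_numbering a :: 'f"]
      by (simp add: sc)
    also have "\<dots> \<le> real (pfst a) + real (psnd a)"
      by (intro add_mono rat_numbering_bound)
    also have "\<dots> \<le> 2 * real a" using pfst_le[of a] psnd_le[of a] by linarith
    finally show ?thesis .
  qed
  ultimately show ?thesis by blast
next
  case False
  then have sc: "(scalar_numbering c :: 'f) = of_real (rat_numbering c)" for c
    by (simp add: scalar_numbering_def)
  have "recursive (\<lambda>z. rat_add (pfst z) (psnd z))" "recursive (\<lambda>z. rat_mult (pfst z) (psnd z))"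
    by (intro rec_intros rec_rat_add rec_rat_mult)+
  moreover have "norm (scalar_numbering a :: 'f) \<le> 2 * real a" for a
    using rat_numbering_bound[of a] by (simp add: sc)
  ultimately show ?thesis
    by (intro exI[of _ rat_add] exI[of _ rat_mult]) (simp add: sc rat_numbering_add rat_numbering_mult)
qed

lemma scalar_numbering_0: "scalar_numbering 0 = (0 :: 'f::real_or_complex)"
proof -
  have r: "rat_numbering 0 = 0" by (simp add: rat_numbering_code pair_0)
  have "gauss_rat_numbering 0 = 0"
    using r by (simp add: gauss_rat_numbering_def case_prod_beta pair_0 complex_eq_iff)
  moreover have "inv to_complex 0 = (0 :: 'f)" if "range (to_complex :: 'f \<Rightarrow> complex) = UNIV"
    using f_inv_into_f[of 0 "to_complex :: 'f \<Rightarrow> complex" UNIV] that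
    by (metis UNIV_I to_complex_0 to_complex_inject)
  ultimately show ?thesis by (simp add: scalar_numbering_def r)
qed

section \<open>Codes of rational combinations\<close>

text \<open>
  The coefficients of a rational combination, continued by 0 beyond its length. The last entry of a tuple is not
  the first component of a pair, hence the second case.
\<close>

definition coefficient :: "nat \<Rightarrow> nat \<Rightarrow> nat" where
  "coefficient c j =
     (if j < pfst c then pfst ((psnd ^^ j) (psnd c))
      else if j = pfst c then (psnd ^^ j) (psnd c) else 0)"

lemma untuple_nth:
  "j \<le> k \<Longrightarrow> untuple k t ! j = (if j < k then pfst ((psnd ^^ j) t) else (psnd ^^ j) t)"
proof (induction k arbitrary: j t)
  case (Suc k)
  then show ?case
    by (cases j) (auto simp: case_prod_beta funpow_Suc_right simp del: funpow.simps(2))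
qed simp

lemma coefficient_le: "coefficient c j \<le> c"
proof -
  have "(psnd ^^ j) x \<le> x" for x
    by (induction j) (auto intro: order_trans[OF psnd_le])
  then have "(psnd ^^ j) (psnd c) \<le> c" using psnd_le order_trans by blast
  then show ?thesis using pfst_le order_trans unfolding coefficient_def by auto
qed

lemma rational_combination_coefficient:
  fixes e :: "nat \<Rightarrow> 'h::banach" and smul :: "'f::real_or_complex \<Rightarrow> 'h \<Rightarrow> 'h"
  assumes "vector_space smul" and "pfst c \<le> K"
  shows "rational_combination smul e c = (\<Sum>i\<le>K. smul (scalar_numbering (coefficient c i)) (e i))"
proof -
  interpret vector_space smul by fact
  have "rational_combination smul e c = (\<Sum>i\<le>pfst c. smul (scalar_numbering (coefficient c i)) (e i))"
    unfolding rational_combination_def case_prod_beta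
    by (rule sum.cong) (auto simp: coefficient_def untuple_nth)
  also have "\<dots> = (\<Sum>i\<le>K. smul (scalar_numbering (coefficient c i)) (e i))"
    by (rule sum.mono_neutral_left) (use assms(2) in \<open>auto simp: coefficient_def scalar_numbering_0\<close>)
  finally show ?thesis .
qed

text \<open>
  A tuple is built from its end: the \<^emph>\<open>j\<close>-th step of the recursion puts the entry number \<^emph>\<open>K - Suc j\<close> in front.
\<close>

definition tuple_code :: "(nat \<Rightarrow> nat) \<Rightarrow> nat \<Rightarrow> nat" where
  "tuple_code a K = rec_nat (a K) (\<lambda>j t. pair (a (K - Suc j)) t) K"

lemma untuple_tuple_code: "untuple K (tuple_code a K) = map a [0..<Suc K]"
proof -
  have "m \<le> K \<Longrightarrow> untuple m (rec_nat (a K) (\<lambda>j t. pair (a (K - Suc j)) t) m) = map a [K - m..<Suc K]" for m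
  proof (induction m)
    case (Suc m)
    have "[K - Suc m..<Suc K] = (K - Suc m) # [K - m..<Suc K]"
      using Suc.prems upt_conv_Cons[of "K - Suc m" "Suc K"] by (simp add: Suc_diff_Suc del: upt_Suc)
    with Suc show ?case by (simp del: upt_Suc)
  qed simp
  from this[of K] show ?thesis by (simp add: tuple_code_def)
qed

definition sum_code :: "(nat \<Rightarrow> nat \<Rightarrow> nat) \<Rightarrow> (nat \<Rightarrow> nat) \<Rightarrow> nat \<Rightarrow> nat" where
  "sum_code add a n = rec_nat 0 (\<lambda>j s. add s (a j)) n"

lemma rec_tuple_code:
  assumes a: "recursive (\<lambda>z. a (pfst z) (psnd z))" and K: "recursive K"
  shows "recursive (\<lambda>x. tuple_code (a x) (K x))"
proof -
  have a': "recursive (\<lambda>x. a (f x) (g x))" if "recursive f" "recursive g" for f g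
    using rec_comp2[OF a that] .
  show ?thesis unfolding tuple_code_def
    by (intro rec_primrec rec_pair a' rec_diff rec_comp[OF K] rec_Suc rec_pfst rec_psnd rec_id K)
qed

lemma rec_sum_code:
  assumes add: "recursive (\<lambda>z. add (pfst z) (psnd z))"
    and a: "recursive (\<lambda>z. a (pfst z) (psnd z))" and n: "recursive n"
  shows "recursive (\<lambda>x. sum_code add (a x) (n x))"
proof -
  have a': "recursive (\<lambda>x. a (f x) (g x))" if "recursive f" "recursive g" for f g
    using rec_comp2[OF a that] .
  have add': "recursive (\<lambda>x. add (f x) (g x))" if "recursive f" "recursive g" for f g
    using rec_comp2[OF add that] .
  show ?thesis unfolding sum_code_def
    by (intro rec_primrec add' a' rec_zero rec_pfst rec_psnd rec_id n)
qed

lemma rec_coefficient: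
  assumes "recursive f" "recursive g" shows "recursive (\<lambda>x. coefficient (f x) (g x))"
proof -
  have it: "recursive (\<lambda>x. (psnd ^^ n x) (a x))" if "recursive n" "recursive a" for n a
    using rec_iterate[of "\<lambda>_ y. psnd y", OF rec_psnd[OF rec_psnd[OF rec_id]] that] .
  show ?thesis unfolding coefficient_def by (intro rec_intros it assms)
qed

text \<open>
  Substituting a combination for each basis vector: the \<^emph>\<open>l\<close>-th coefficient of the result is a sum over \<^emph>\<open>j\<close> of
  products of coefficients. The sum \<^emph>\<open>K\<close> of the largest indices of the combinations substituted bounds each of
  them, so that no coefficient is lost.
\<close>

lemma combination_of_combinations:
  fixes smul :: "'f::real_or_complex \<Rightarrow> 'h::banach \<Rightarrow> 'h" and e :: "nat \<Rightarrow> 'h"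
  assumes "vector_space smul" and g: "recursive g"
  shows "\<exists>h. recursive h \<and> (\<forall>c p. rational_combination smul e (h (pair c p)) =
    (\<Sum>j\<le>pfst c. smul (scalar_numbering (coefficient c j)) (rational_combination smul e (g (pair j p)))))"
proof -
  interpret vector_space smul by fact
  obtain add mul where add: "recursive (\<lambda>z. add (pfst z) (psnd z))" and mul: "recursive (\<lambda>z. mul (pfst z) (psnd z))"
    and sc_add: "\<And>a b. (scalar_numbering (add a b) :: 'f) = scalar_numbering a + scalar_numbering b"
    and sc_mul: "\<And>a b. (scalar_numbering (mul a b) :: 'f) = scalar_numbering a * scalar_numbering b"
    using scalar_arithmetic[where ?'f = 'f] by blast
  have sc_sum: "(scalar_numbering (sum_code add a n) :: 'f) = (\<Sum>j<n. scalar_numbering (a j))" for a n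
    by (induction n) (simp_all add: sum_code_def scalar_numbering_0 sc_add)
  define K where "K z = sum_code (+) (\<lambda>j. pfst (g (pair j (psnd z)))) (Suc (pfst (pfst z)))" for z
  define s where "s z l = sum_code add (\<lambda>j. mul (coefficient (pfst z) j) (coefficient (g (pair j (psnd z))) l)) (Suc (pfst (pfst z)))" for z l
  define h where "h z = pair (K z) (tuple_code (s z) (K z))" for z
  have mul': "recursive (\<lambda>x. mul (f x) (g x))" if "recursive f" "recursive g" for f g
    using rec_comp2[OF mul that] .
  have "recursive K"
    unfolding K_def by (intro rec_sum_code rec_intros rec_comp[OF g])
  moreover have "recursive (\<lambda>z. s (pfst z) (psnd z))"
    unfolding s_def by (intro rec_sum_code add mul' rec_coefficient rec_intros rec_comp[OF g])
  ultimately have "recursive h"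
    unfolding h_def by (intro rec_pair rec_tuple_code)
  moreover have "rational_combination smul e (h (pair c p)) =
    (\<Sum>j\<le>pfst c. smul (scalar_numbering (coefficient c j)) (rational_combination smul e (g (pair j p))))" for c p
  proof -
    let ?z = "pair c p"
    have K_ge: "pfst (g (pair j p)) \<le> K ?z" if "j \<le> pfst c" for j
    proof -
      have "K ?z = (\<Sum>j<Suc (pfst c). pfst (g (pair j p)))"
      proof -
        have "sum_code (+) a n = (\<Sum>j<n. a j)" for a n by (induction n) (simp_all add: sum_code_def)
        then show ?thesis by (simp add: K_def)
      qed
      also have "pfst (g (pair j p)) \<le> \<dots>"
        using member_le_sum[of j "{..<Suc (pfst c)}" "\<lambda>j. pfst (g (pair j p))"] that by simp
      finally show ?thesis .
    qed
    have coeff: "coefficient (h ?z) l = s ?z l" if "l \<le> K ?z" for l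
    proof -
      have "untuple (K ?z) (tuple_code (s ?z) (K ?z)) ! l = s ?z l"
        unfolding untuple_tuple_code using that by (simp del: upt_Suc)
      then show ?thesis
        using that untuple_nth[OF that, of "tuple_code (s ?z) (K ?z)"]
        by (auto simp: coefficient_def h_def split: if_splits)
    qed
    have "rational_combination smul e (h ?z) = (\<Sum>l\<le>K ?z. smul (scalar_numbering (s ?z l)) (e l))"
      using rational_combination_coefficient[OF assms(1), of "h ?z" "K ?z" e]
      by (simp add: coeff) (simp add: h_def)
    also have "\<dots> = (\<Sum>l\<le>K ?z. \<Sum>j\<le>pfst c. smul (scalar_numbering (coefficient c j))
        (smul (scalar_numbering (coefficient (g (pair j p)) l)) (e l)))"
      by (simp add: s_def sc_sum sc_mul scale_sum_left lessThan_Suc_atMost del: sum.lessThan_Suc)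
    also have "\<dots> = (\<Sum>j\<le>pfst c. smul (scalar_numbering (coefficient c j))
        (\<Sum>l\<le>K ?z. smul (scalar_numbering (coefficient (g (pair j p)) l)) (e l)))"
      by (subst sum.swap) (simp add: scale_sum_right)
    also have "\<dots> = (\<Sum>j\<le>pfst c. smul (scalar_numbering (coefficient c j)) (rational_combination smul e (g (pair j p))))"
      by (rule sum.cong) (simp_all add: rational_combination_coefficient[OF assms(1) K_ge])
    finally show ?thesis .
  qed
  ultimately show ?thesis by blast
qed

section \<open>Computable sequences as recursive approximations\<close>

text \<open>
  The condition that Cauchy names impose on the sequence that they describe.
\<close>

definition fast_limit :: "(nat \<Rightarrow> 'x::metric_space) \<Rightarrow> 'x \<Rightarrow> bool" where
  "fast_limit X x \<longleftrightarrow> X \<longlonglongrightarrow> x \<and> (\<forall>i j. i < j \<longrightarrow> dist (X i) (X j) < 1 / 2 ^ i)"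

lemma is_cauchy_name_seq_name: "is_cauchy_name \<alpha> x (seq_name n) \<longleftrightarrow> fast_limit (\<lambda>i. \<alpha> (n i)) x"
  unfolding is_cauchy_name_def fast_limit_def using seq_name_inject by metis

lemma is_cauchy_nameE:
  assumes "is_cauchy_name \<alpha> x p"
  obtains n where "p = seq_name n" and "fast_limit (\<lambda>i. \<alpha> (n i)) x"
  using assms unfolding is_cauchy_name_def fast_limit_def by blast

lemma fast_limit_dist:
  assumes "fast_limit X x" shows "dist (X i) x \<le> 1 / 2 ^ i"
proof (rule LIMSEQ_le_const2)
  show "(\<lambda>j. dist (X i) (X j)) \<longlonglongrightarrow> dist (X i) x"
    using assms unfolding fast_limit_def by (intro tendsto_intros) auto
  show "\<exists>N. \<forall>j\<ge>N. dist (X i) (X j) \<le> 1 / 2 ^ i"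
    using assms unfolding fast_limit_def by (intro exI[of _ "Suc i"]) (auto intro: less_imp_le)
qed

text \<open>
  The extra factor 2 absorbs the triangle inequality and makes the inequality in the definition strict.
\<close>

lemma fast_limitI:
  assumes X: "\<And>i. dist (X i) x \<le> 1 / 2 ^ Suc i"
  shows "fast_limit X x"
  unfolding fast_limit_def
proof (intro conjI allI impI)
  have "(\<lambda>i. 1 / 2 ^ Suc i :: real) \<longlonglongrightarrow> 0"
    using LIMSEQ_Suc[OF LIMSEQ_realpow_zero[of "1/2"]] by (simp add: power_divide)
  then have "(\<lambda>i. dist (X i) x) \<longlonglongrightarrow> 0"
    by (rule tendsto_sandwich[OF _ _ tendsto_const, rotated 2]) (use X in auto)
  then show "X \<longlonglongrightarrow> x" by (rule iffD2[OF tendsto_dist_iff])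
next
  fix i j :: nat assume "i < j"
  then have "(1 / 2 ^ Suc j :: real) < 1 / 2 ^ Suc i" by (intro divide_strict_left_mono power_strict_increasing) auto
  moreover have "dist (X i) (X j) \<le> dist (X i) x + dist (X j) x" by (rule dist_triangle2)
  moreover have "(1 / 2 ^ Suc i + 1 / 2 ^ Suc i :: real) = 1 / 2 ^ i" by simp
  ultimately show "dist (X i) (X j) < 1 / 2 ^ i" using X[of i] X[of j] by linarith
qed

lemma computable_machine:
  assumes "computable \<delta> (cauchy_rep \<alpha> :: (nat \<Rightarrow> 's::{finite, zero_neq_one}) \<rightharpoonup> 'x::metric_space) (\<lambda>x. Some (f x))"
  shows "\<exists>M. wf_machine M \<and> (\<forall>p x. \<delta> p = Some x \<longrightarrow>
    (\<exists>n. transforms M p (seq_name n) \<and> fast_limit (\<lambda>i. \<alpha> (n i)) (f x)))"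
proof -
  obtain F where F: "computable_on_words F"
    and val: "\<And>p. p \<in> dom ((\<lambda>x. Some (f x)) \<circ>\<^sub>m \<delta>) \<Longrightarrow> (cauchy_rep \<alpha> \<circ>\<^sub>m F) p = ((\<lambda>x. Some (f x)) \<circ>\<^sub>m \<delta>) p"
    using assms unfolding computable_def by blast
  obtain M where M: "wf_machine M" "\<And>p. p \<in> dom F \<Longrightarrow> transforms M p (the (F p))"
    using F unfolding computable_on_words_def by blast
  have "\<exists>n. transforms M p (seq_name n) \<and> fast_limit (\<lambda>i. \<alpha> (n i)) (f x)" if "\<delta> p = Some x" for p x
  proof -
    have "((\<lambda>x. Some (f x)) \<circ>\<^sub>m \<delta>) p = Some (f x)" using that by simp
    then have "(cauchy_rep \<alpha> \<circ>\<^sub>m F) p = Some (f x)" using val[of p] by auto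
    then obtain q where q: "F p = Some q" "cauchy_rep \<alpha> q = Some (f x)" by (auto simp: map_comp_Some_iff)
    then have "is_cauchy_name \<alpha> (f x) q" by (simp add: cauchy_rep_eq_Some_iff)
    then obtain n where n: "q = seq_name n" "fast_limit (\<lambda>i. \<alpha> (n i)) (f x)" by (rule is_cauchy_nameE)
    have "transforms M p (seq_name n)" using M(2)[of p] q n by auto
    with n show ?thesis by blast
  qed
  with M show ?thesis by blast
qed

lemma computableI:
  assumes F: "computable_on_words F"
    and val: "\<And>p x. \<delta> p = Some x \<Longrightarrow> \<exists>n. F p = Some (seq_name n) \<and> fast_limit (\<lambda>i. \<alpha> (n i)) (f x)"
  shows "computable \<delta> (cauchy_rep \<alpha>) (\<lambda>x. Some (f x))"
  unfolding computable_def
proof (intro exI[of _ F] conjI ballI F)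
  fix p assume "p \<in> dom ((\<lambda>x. Some (f x)) \<circ>\<^sub>m \<delta>)"
  then obtain x where x: "\<delta> p = Some x" by (auto simp: map_comp_Some_iff)
  then obtain n where "F p = Some (seq_name n)" "fast_limit (\<lambda>i. \<alpha> (n i)) (f x)" using val by blast
  with x show "(cauchy_rep \<alpha> \<circ>\<^sub>m F) p = ((\<lambda>x. Some (f x)) \<circ>\<^sub>m \<delta>) p"
    by (simp add: cauchy_rep_eq_Some_iff is_cauchy_name_seq_name)
qed

definition names_recursively :: "(nat \<Rightarrow> 'x::metric_space) \<Rightarrow> (nat \<Rightarrow> nat) \<Rightarrow> (nat \<Rightarrow> 'x) \<Rightarrow> bool" where
  "names_recursively \<alpha> g x \<longleftrightarrow> recursive g \<and> (\<forall>j. fast_limit (\<lambda>i. \<alpha> (g (pair j i))) (x j))"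

lemma names_recursively_simulation:
  fixes M :: "'s::{finite, zero_neq_one} machine"
  assumes wf: "wf_machine M" and inp: "recursive inp"
    and M: "\<And>j. \<exists>n. transforms M (\<lambda>i. bit_symbol (inp (pair j i) \<noteq> 0)) (seq_name n) \<and> fast_limit (\<lambda>i. \<alpha> (n i)) (x j)"
  shows "\<exists>g. names_recursively \<alpha> g x"
proof -
  obtain n where n: "\<And>j. transforms M (\<lambda>i. bit_symbol (inp (pair j i) \<noteq> 0)) (seq_name (n j))"
    "\<And>j. fast_limit (\<lambda>i. \<alpha> (n j i)) (x j)"
    using M by metis
  obtain f where f: "recursive f" "\<And>j m. f (pair j m) = 0 \<longleftrightarrow> (seq_name (n j) m :: 's) = 0"
    using simulation[OF wf inp n(1)] by blast
  obtain g where "recursive g" "\<And>j i. g (pair j i) = n j i"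
    using block_recursive[OF f] by blast
  then show ?thesis using n(2) unfolding names_recursively_def by (intro exI[of _ g]) simp
qed

text \<open>
  A machine for the sequence can be simulated, and recursive approximations can be written down by a machine.
\<close>

lemma computable_sequence_iff:
  "computable_sequence (cauchy_rep \<alpha> :: (nat \<Rightarrow> 's::{finite, zero_neq_one}) \<rightharpoonup> 'x::metric_space) x \<longleftrightarrow>
    (\<exists>g. names_recursively \<alpha> g x)"
proof
  assume "computable_sequence (cauchy_rep \<alpha> :: (nat \<Rightarrow> 's) \<rightharpoonup> 'x) x"
  then obtain M :: "'s machine" where wf: "wf_machine M"
    and M: "\<And>p j. nat_rep p = Some j \<Longrightarrow> \<exists>n. transforms M p (seq_name n) \<and> fast_limit (\<lambda>i. \<alpha> (n i)) (x j)"
    using computable_machine unfolding computable_sequence_def by blast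
  let ?inp = "\<lambda>z. if psnd z < pfst z then 1 else 0 :: nat"
  have "recursive ?inp" by (intro rec_intros)
  moreover have "(\<lambda>i. bit_symbol (?inp (pair j i) \<noteq> 0)) = (nat_name j :: nat \<Rightarrow> 's)" for j
    by (simp add: bit_symbol_def nat_name_def fun_eq_iff)
  ultimately show "\<exists>g. names_recursively \<alpha> g x"
    using M by (intro names_recursively_simulation[OF wf]) (auto simp: nat_rep_eq_Some_iff)
next
  assume "\<exists>g. names_recursively \<alpha> g x"
  then obtain g where g: "recursive g" "\<And>j. fast_limit (\<lambda>i. \<alpha> (g (pair j i))) (x j)"
    unfolding names_recursively_def by blast
  obtain F :: "(nat \<Rightarrow> 's) \<rightharpoonup> (nat \<Rightarrow> 's)" where F: "computable_on_words F"
    "\<And>k. F (nat_name k) = Some (seq_name (\<lambda>i. g (pair k i)))"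
    using computable_block_sequence[OF g(1)] by blast
  show "computable_sequence (cauchy_rep \<alpha> :: (nat \<Rightarrow> 's) \<rightharpoonup> 'x) x"
    unfolding computable_sequence_def
    by (rule computableI[OF F(1)]) (use F(2) g(2) in \<open>auto simp: nat_rep_eq_Some_iff\<close>)
qed

text \<open>
  Position \<^emph>\<open>m\<close> carries a 0 if and only if the first starting point of a block that is not below \<^emph>\<open>m\<close> is \<^emph>\<open>m\<close> itself.
\<close>

lemma seq_name_bits_recursive:
  assumes g: "recursive g"
  shows "\<exists>b. recursive b \<and> (\<forall>j. (\<lambda>i. bit_symbol (b (pair j i) \<noteq> 0)) = (seq_name (\<lambda>i. g (pair j i)) :: nat \<Rightarrow> 's::zero_neq_one))"
proof -
  define bs where "bs j i = rec_nat 0 (\<lambda>i s. s + g (pair j i) + 2) i" for j i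
  have bs: "bs j i = block_start (\<lambda>i. g (pair j i)) i" for j i
    by (induction i) (simp_all add: bs_def block_start_def)
  define L where "L z = (LEAST i. psnd z \<le> bs (pfst z) i)" for z
  define b where "b z = (if bs (pfst z) (L z) = psnd z then 0 else 1 :: nat)" for z
  have rec_bs: "recursive (\<lambda>x. bs (a x) (i x))" if a: "recursive a" and i: "recursive i" for a i
    unfolding bs_def
    by (intro rec_primrec rec_intros rec_comp[OF g] rec_comp[OF a] i)
  have ex: "\<exists>i. m \<le> bs j i" for m j
    unfolding bs using strict_mono_imp_increasing[OF strict_mono_block_start] by blast
  have "recursive L"
    unfolding L_def by (intro rec_Least dec_le rec_bs rec_intros ex)
  then have "recursive b"
    unfolding b_def by (intro rec_intros rec_bs)
  moreover have "b (pair j m) = 0 \<longleftrightarrow> m \<in> range (block_start (\<lambda>i. g (pair j i)))" for j m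
  proof -
    let ?b = "block_start (\<lambda>i. g (pair j i))"
    have Least: "(LEAST i. ?b k \<le> ?b i) = k" for k
      by (rule Least_equality) (auto simp: strict_mono_less_eq[OF strict_mono_block_start])
    have "?b (LEAST i. m \<le> ?b i) = m \<longleftrightarrow> m \<in> range ?b"
    proof
      assume "m \<in> range ?b"
      then show "?b (LEAST i. m \<le> ?b i) = m" by (auto simp: Least)
    qed (simp add: range_eqI[OF sym])
    then show ?thesis by (simp add: b_def L_def bs)
  qed
  ultimately show ?thesis
    by (intro exI[of _ b] conjI allI ext) (auto simp: bit_symbol_def seq_name_def)
qed

text \<open>
  The names of the \<^emph>\<open>x k\<close> form a recursive sequence of inputs, so that the machine for \<^emph>\<open>U\<close> can be simulated on
  them.
\<close>

lemma computable_operator_sequence: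
  fixes \<alpha> :: "nat \<Rightarrow> 'x::metric_space" and \<beta> :: "nat \<Rightarrow> 'y::metric_space"
  assumes U: "computable (cauchy_rep \<alpha> :: (nat \<Rightarrow> 's::{finite, zero_neq_one}) \<rightharpoonup> 'x) (cauchy_rep \<beta>) (\<lambda>x. Some (U x))"
    and x: "computable_sequence (cauchy_rep \<alpha> :: (nat \<Rightarrow> 's) \<rightharpoonup> 'x) x"
  shows "computable_sequence (cauchy_rep \<beta> :: (nat \<Rightarrow> 's) \<rightharpoonup> 'y) (\<lambda>k. U (x k))"
proof -
  obtain g where g: "recursive g" "\<And>j. fast_limit (\<lambda>i. \<alpha> (g (pair j i))) (x j)"
    using x unfolding computable_sequence_iff names_recursively_def by blast
  obtain M :: "'s machine" where wf: "wf_machine M"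
    and M: "\<And>p x. cauchy_rep \<alpha> p = Some x \<Longrightarrow> \<exists>n. transforms M p (seq_name n) \<and> fast_limit (\<lambda>i. \<beta> (n i)) (U x)"
    using computable_machine[OF U] by blast
  obtain b where b: "recursive b"
    "\<And>j. (\<lambda>i. bit_symbol (b (pair j i) \<noteq> 0)) = (seq_name (\<lambda>i. g (pair j i)) :: nat \<Rightarrow> 's)"
    using seq_name_bits_recursive[OF g(1), where ?'s = 's] by blast
  show ?thesis unfolding computable_sequence_iff
    by (rule names_recursively_simulation[OF wf b(1)], unfold b(2))
      (rule M, simp add: cauchy_rep_eq_Some_iff is_cauchy_name_seq_name g(2))
qed

section \<open>Computable operators are bounded\<close>

text \<open>
  The input head moves by at most one cell per step.
\<close>

lemma finite_use:
  assumes "\<And>i. i < t \<Longrightarrow> p i = p' i"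
  shows "output_after M p t = output_after M p' t"
proof -
  have "(step M p ^^ u) (init_config M) = (step M p' ^^ u) (init_config M) \<and>
      input_pos ((step M p ^^ u) (init_config M)) \<le> u" if "u \<le> t" for u
    using that
  proof (induction u)
    case 0
    then show ?case by (simp add: init_config_def)
  next
    case (Suc u)
    let ?c = "(step M p ^^ u) (init_config M)"
    have IH: "(step M p' ^^ u) (init_config M) = ?c" "input_pos ?c \<le> u"
      using Suc.IH Suc.prems by (metis Suc_leD)+
    have "p (input_pos ?c) = p' (input_pos ?c)" using IH(2) Suc.prems assms by simp
    then have "step M p ?c = step M p' ?c" by (simp add: step_def)
    moreover have "input_pos (step M p ?c) \<le> Suc u"
      using IH(2) by (simp add: step_def split: prod.split)
    ultimately show ?case using IH(1) by simp
  qed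
  then show ?thesis unfolding output_after_def by simp
qed

lemma seq_name_agree:
  assumes "\<And>i. i < N \<Longrightarrow> n i = m i" and "k < block_start n N"
  shows "seq_name n k = (seq_name m k :: 's::zero_neq_one)"
proof -
  have eq: "block_start n i = block_start m i" if "i \<le> N" for i
    unfolding block_start_def using assms(1) that by (intro sum.cong) auto
  have "k = block_start n i \<longleftrightarrow> k = block_start m i" for i
  proof (cases "i \<le> N")
    case False
    then have "block_start n N < block_start n i" "block_start m N < block_start m i"
      by (simp_all add: strict_mono_less[OF strict_mono_block_start])
    then show ?thesis using assms(2) eq[of N] by auto
  qed (simp add: eq)
  then show ?thesis by (auto simp: seq_name_def image_iff)
qed

lemma seq_name_first_block:
  assumes "\<And>k. k < Suc (block_start n 1) \<Longrightarrow> (seq_name n k :: 's::zero_neq_one) = seq_name m k"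
  shows "m 0 = n 0"
proof -
  have b: "block_start n 1 = n 0 + 2" for n by (simp add: block_start_def)
  have one: "(seq_name n (Suc d) :: 's) = 1" if "d \<le> n 0" for n d
    using seq_name_inside[of d n 0, where ?'a = 's] that by (simp add: block_start_def)
  have zero: "(seq_name n (n 0 + 2) :: 's) = 0" for n
    using seq_name_block_start[of n 1, where ?'a = 's] unfolding b .
  consider "m 0 < n 0" | "n 0 < m 0" | "m 0 = n 0" by linarith
  then show ?thesis
  proof cases
    case 1
    then show ?thesis using assms[of "m 0 + 2"] one[of "m 0 + 1" n] zero[of m] by (simp add: b[simplified])
  next
    case 2
    then show ?thesis using assms[of "n 0 + 2"] one[of "n 0 + 1" m] zero[of n] by (simp add: b[simplified])
  qed
qed

text \<open>
  The machine writes the first block of a name of \<^emph>\<open>U 0\<close> within \<^emph>\<open>N\<close> steps, and in this time it sees at most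
  the first \<^emph>\<open>N\<close> blocks of the constant name of 0. If \<^emph>\<open>y\<close> is close enough to 0, these blocks can be continued to a
  name of \<^emph>\<open>y\<close>. So the name computed for \<^emph>\<open>U y\<close> has the same first block, and both values are at a
  distance of at most 1 from the point that it denotes.
\<close>

lemma computable_locally_bounded:
  fixes \<alpha> :: "nat \<Rightarrow> 'x::real_normed_vector" and \<beta> :: "nat \<Rightarrow> 'y::metric_space"
  assumes U: "computable (cauchy_rep \<alpha> :: (nat \<Rightarrow> 's::{finite, zero_neq_one}) \<rightharpoonup> 'x) (cauchy_rep \<beta>) (\<lambda>x. Some (U x))"
    and dense: "closure (range \<alpha>) = UNIV" and zero: "\<alpha> c0 = 0"
  shows "\<exists>r > 0. \<forall>y. norm y \<le> r \<longrightarrow> dist (U y) (U 0) \<le> 2"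
proof -
  obtain M :: "'s machine" where M: "\<And>p x. cauchy_rep \<alpha> p = Some x \<Longrightarrow>
      \<exists>n. transforms M p (seq_name n) \<and> fast_limit (\<lambda>i. \<beta> (n i)) (U x)"
    using computable_machine[OF U] by blast
  have "fast_limit (\<lambda>i. \<alpha> c0) 0" by (rule fast_limitI) (simp add: zero)
  then obtain m where m: "transforms M (seq_name (\<lambda>_. c0)) (seq_name m)" "fast_limit (\<lambda>i. \<beta> (m i)) (U 0)"
    using M[of "seq_name (\<lambda>_. c0)" 0] by (auto simp: cauchy_rep_eq_Some_iff is_cauchy_name_seq_name)
  obtain N where N: "length (output_after M (seq_name (\<lambda>_. c0)) N) \<ge> Suc (block_start m 1)"
    using m(1) unfolding transforms_def by blast
  have "dist (U y) (U 0) \<le> 2" if y: "norm y \<le> 1 / 2 ^ (N + 1)" for y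
  proof -
    have "\<exists>k. dist (\<alpha> k) y < 1 / 2 ^ (i + 2)" for i
    proof -
      have "\<exists>z\<in>range \<alpha>. dist z y < 1 / 2 ^ (i + 2)"
        using dense closure_approachable[of y "range \<alpha>"] by simp
      then show ?thesis by blast
    qed
    then obtain k where k: "\<And>i. dist (\<alpha> (k i)) y < 1 / 2 ^ (i + 2)" by metis
    define n where "n i = (if i < N then c0 else k i)" for i
    have "dist (\<alpha> (n i)) y \<le> 1 / 2 ^ Suc i" for i
    proof (cases "i < N")
      case True
      have "(1 :: real) / 2 ^ (N + 1) \<le> 1 / 2 ^ Suc i" using True by (intro divide_left_mono power_increasing) auto
      then show ?thesis using True y by (simp add: n_def zero)
    next
      case False
      have "(1 :: real) / 2 ^ (i + 2) \<le> 1 / 2 ^ Suc i" by (intro divide_left_mono power_increasing) auto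
      then show ?thesis using False k[of i] by (simp add: n_def)
    qed
    then have "fast_limit (\<lambda>i. \<alpha> (n i)) y" by (rule fast_limitI)
    then obtain m' where m': "transforms M (seq_name n) (seq_name m')" "fast_limit (\<lambda>i. \<beta> (m' i)) (U y)"
      using M[of "seq_name n" y] by (auto simp: cauchy_rep_eq_Some_iff is_cauchy_name_seq_name)
    have "N \<le> block_start (\<lambda>_. c0) N"
      by (rule strict_mono_imp_increasing[OF strict_mono_block_start])
    then have agree: "output_after M (seq_name (\<lambda>_. c0)) N = output_after M (seq_name n) N"
      by (intro finite_use seq_name_agree[of N]) (auto simp: n_def)
    have "seq_name m j = (seq_name m' j :: 's)" if j: "j < Suc (block_start m 1)" for j
    proof -
      have "output_after M (seq_name (\<lambda>_. c0)) N ! j = seq_name m j"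
        using m(1) N j unfolding transforms_def by (metis (no_types, lifting) add_0 diff_zero less_le_trans nth_map_upt)
      moreover have "output_after M (seq_name n) N ! j = seq_name m' j"
        using m'(1) N j unfolding agree transforms_def by (metis (no_types, lifting) add_0 diff_zero less_le_trans nth_map_upt)
      ultimately show ?thesis using agree by simp
    qed
    then have "m' 0 = m 0" by (rule seq_name_first_block)
    then have "dist (\<beta> (m 0)) (U y) \<le> 1" "dist (\<beta> (m 0)) (U 0) \<le> 1"
      using fast_limit_dist[OF m'(2), of 0] fast_limit_dist[OF m(2), of 0] by simp_all
    then show ?thesis using dist_triangle3[of "U y" "U 0" "\<beta> (m 0)"] by simp
  qed
  then show ?thesis by (intro exI[of _ "1 / 2 ^ (N + 1)"]) simp
qed

section \<open>Computable frames\<close>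

lemma (in hilbert_space_with_basis) bounded_if_locally_bounded:
  assumes lin: "Vector_Spaces.linear smul smul U" and r: "r > 0" "\<And>y. norm y \<le> r \<Longrightarrow> norm (U y) \<le> L"
  shows "norm (U x) \<le> (L / r) * norm x"
proof -
  interpret U: Vector_Spaces.linear smul smul U by (rule lin)
  have U_scaleR: "U (s *\<^sub>R x) = s *\<^sub>R U x" for s x
    using U.scale[of "of_real s" x] by (simp add: smul_of_real)
  show ?thesis
  proof (cases "x = 0")
    case True
    then show ?thesis by (simp add: U.zero)
  next
    case False
    have "norm (U ((r / norm x) *\<^sub>R x)) \<le> L" by (rule r) (use False r in simp)
    then show ?thesis using False r(1) by (simp add: U_scaleR field_simps)
  qed
qed

lemma (in hilbert_space_with_basis) rational_combination_image:
  assumes lin: "Vector_Spaces.linear smul smul U"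
  shows "U (rational_combination smul e c) =
    (\<Sum>j\<le>pfst c. smul (scalar_numbering (coefficient c j)) (U (e j)))"
proof -
  interpret U: Vector_Spaces.linear smul smul U by (rule lin)
  show ?thesis
    unfolding rational_combination_coefficient[OF vector_space_axioms order_refl]
    by (simp add: U.sum U.scale)
qed

text \<open>
  The error budget of the \<^emph>\<open>i\<close>-th approximation is \<^emph>\<open>1 / 2 ^ Suc i\<close>. One half of it is spent on replacing the
  argument by its approximation number \<^emph>\<open>l + 2 + i\<close>, where \<^emph>\<open>2 ^ l\<close> bounds the norm of \<^emph>\<open>U\<close>, and the other half on
  replacing the \<^emph>\<open>U (e j)\<close> by rational combinations.
\<close>

lemma (in hilbert_space_with_basis) computable_of_bounded:
  assumes lin: "Vector_Spaces.linear smul smul U" and bd: "\<And>x. norm (U x) \<le> K * norm x"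
    and g: "names_recursively (rational_combination smul e) g (\<lambda>k. U (e k))"
  shows "computable (hilbert_rep smul e :: (nat \<Rightarrow> 's::{finite, zero_neq_one}) \<rightharpoonup> 'h) (hilbert_rep smul e) (\<lambda>x. Some (U x))"
proof -
  interpret U: Vector_Spaces.linear smul smul U by (rule lin)
  let ?\<alpha> = "rational_combination smul e"
  have rec_g: "recursive g" and lim_g: "\<And>k. fast_limit (\<lambda>i. ?\<alpha> (g (pair k i))) (U (e k))"
    using g unfolding names_recursively_def by blast+
  obtain h where h: "recursive h" "\<And>c p. ?\<alpha> (h (pair c p)) =
      (\<Sum>j\<le>pfst c. smul (scalar_numbering (coefficient c j)) (?\<alpha> (g (pair j p))))"
    using combination_of_combinations[OF vector_space_axioms rec_g] by blast
  \<comment> \<open>\<^emph>\<open>w c\<close> bounds the sum of the absolute values of the coefficients,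
      as there are at most \<^emph>\<open>Suc c\<close> of them, each at most \<^emph>\<open>2 * c\<close>\<close>
  define w where "w c = 2 * (Suc c * c)" for c :: nat
  define H where "H z = h (pair (psnd z) (pfst z + 2 + w (psnd z)))" for z
  have "recursive H" unfolding H_def w_def by (intro rec_comp[OF h(1)] rec_intros)
  have H: "dist (?\<alpha> (H (pair i c))) (U (?\<alpha> c)) \<le> 1 / 2 ^ (i + 2)" for i c
  proof -
    let ?p = "i + 2 + w c"
    let ?s = "\<lambda>j. scalar_numbering (coefficient c j) :: 'f"
    have "?\<alpha> (H (pair i c)) - U (?\<alpha> c) = (\<Sum>j\<le>pfst c. smul (?s j) (?\<alpha> (g (pair j ?p)) - U (e j)))"
      by (simp add: H_def h(2) rational_combination_image[OF lin] scale_right_diff_distrib sum_subtractf)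
    also have "norm \<dots> \<le> (\<Sum>j\<le>pfst c. 2 * real c * (1 / 2 ^ ?p))"
    proof (rule sum_norm_le)
      fix j
      have "norm (?s j) \<le> 2 * real (coefficient c j)"
        using scalar_arithmetic[where ?'f = 'f] by blast
      also have "\<dots> \<le> 2 * real c" using coefficient_le[of c j] by simp
      finally have "norm (?s j) \<le> 2 * real c" .
      moreover have "norm (?\<alpha> (g (pair j ?p)) - U (e j)) \<le> 1 / 2 ^ ?p"
        using fast_limit_dist[OF lim_g, of j ?p] by (simp add: dist_norm)
      ultimately show "norm (smul (?s j) (?\<alpha> (g (pair j ?p)) - U (e j))) \<le> 2 * real c * (1 / 2 ^ ?p)"
        unfolding norm_smul by (intro mult_mono) auto
    qed
    also have "\<dots> = real (Suc (pfst c)) * (2 * real c * (1 / 2 ^ ?p))" by simp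
    also have "\<dots> \<le> real (Suc c) * (2 * real c * (1 / 2 ^ ?p))"
      using pfst_le[of c] by (intro mult_right_mono) auto
    also have "\<dots> = real (w c) * (1 / 2 ^ ?p)"
    proof -
      have "real (w c) = real (Suc c) * (2 * real c)" by (simp add: w_def algebra_simps)
      then show ?thesis by (simp only: mult.assoc)
    qed
    also have "\<dots> \<le> 2 ^ w c * (1 / 2 ^ ?p)"
    proof -
      have "w c < 2 ^ w c" by (rule less_exp)
      then have "real (w c) \<le> 2 ^ w c" by (metis less_imp_le of_nat_le_iff of_nat_numeral of_nat_power)
      then show ?thesis by (intro mult_right_mono) auto
    qed
    also have "\<dots> = 1 / 2 ^ (i + 2)" by (simp add: power_add)
    finally show ?thesis by (simp add: dist_norm)
  qed
  obtain l :: nat where l: "K < 2 ^ l" using real_arch_pow[of 2 K] by auto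
  obtain F :: "(nat \<Rightarrow> 's) \<rightharpoonup> (nat \<Rightarrow> 's)" where F: "computable_on_words F"
    "\<And>n. F (seq_name n) = Some (seq_name (\<lambda>i. H (pair i (n (l + 2 + i)))))"
    using computable_block_map[OF \<open>recursive H\<close>, of "l + 2"] by blast
  show ?thesis unfolding hilbert_rep_def
  proof (rule computableI[OF F(1)])
    fix p :: "nat \<Rightarrow> 's" and x assume "cauchy_rep ?\<alpha> p = Some x"
    then obtain n where p: "p = seq_name n" and n: "fast_limit (\<lambda>i. ?\<alpha> (n i)) x"
      by (auto simp: cauchy_rep_eq_Some_iff elim: is_cauchy_nameE)
    have "dist (?\<alpha> (H (pair i (n (l + 2 + i))))) (U x) \<le> 1 / 2 ^ Suc i" for i
    proof -
      let ?c = "n (l + 2 + i)"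
      have "dist (U (?\<alpha> ?c)) (U x) = norm (U (?\<alpha> ?c - x))" by (simp add: dist_norm U.diff)
      also have "\<dots> \<le> K * norm (?\<alpha> ?c - x)" by (rule bd)
      also have "\<dots> \<le> 2 ^ l * (1 / 2 ^ (l + 2 + i))"
        using l fast_limit_dist[OF n, of "l + 2 + i"] by (intro mult_mono) (auto simp: dist_norm)
      also have "\<dots> = 1 / 2 ^ (i + 2)" by (simp add: power_add)
      finally have "dist (U (?\<alpha> ?c)) (U x) \<le> 1 / 2 ^ (i + 2)" .
      moreover have "(1 / 2 ^ (i + 2) + 1 / 2 ^ (i + 2) :: real) = 1 / 2 ^ Suc i" by simp
      ultimately show ?thesis
        using H[of i ?c] dist_triangle[of "?\<alpha> (H (pair i ?c))" "U x" "U (?\<alpha> ?c)"] by linarith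
    qed
    then show "\<exists>m. F p = Some (seq_name m) \<and> fast_limit (\<lambda>i. ?\<alpha> (m i)) (U x)"
      using F(2) p by (intro exI[of _ "\<lambda>i. H (pair i (n (l + 2 + i)))"]) (auto intro: fast_limitI)
  qed
qed

theorem theorem3p6:
  fixes smul :: "'f::real_or_complex \<Rightarrow> 'h::banach \<Rightarrow> 'h"
    and ip :: "'h \<Rightarrow> 'h \<Rightarrow> 'f"
    and e :: "nat \<Rightarrow> 'h"
  assumes "computable_hilbert_space TYPE('s::{finite, zero_neq_one}) smul ip e"
    and "computable_hilbert_sequence TYPE('s) smul e e"
    and "orthonormal_basis smul ip e"
  shows "{f. computable_frame TYPE('s) smul ip e f} =
         {(\<lambda>k. U (e k)) | U. computable_operator TYPE('s) smul e U \<and> surj U}"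
proof -
  interpret hilbert_space smul ip using assms(1) by (simp add: computable_hilbert_space_def)
  interpret hilbert_space_with_basis smul ip e
    using assms(3) by unfold_locales (simp_all add: orthonormal_basis_def)
  let ?\<alpha> = "rational_combination smul e"
  have seq: "computable_hilbert_sequence TYPE('s) smul e f \<longleftrightarrow> (\<exists>g. names_recursively ?\<alpha> g f)" for f
    unfolding computable_hilbert_sequence_def hilbert_rep_def by (rule computable_sequence_iff)
  have "\<exists>U. f = (\<lambda>k. U (e k)) \<and> computable_operator TYPE('s) smul e U \<and> surj U"
    if "computable_frame TYPE('s) smul ip e f" for f
  proof -
    have f: "is_frame ip f" and cf: "computable_hilbert_sequence TYPE('s) smul e f"
      using that unfolding computable_frame_def by blast+
    obtain U K where U: "Vector_Spaces.linear smul smul U" "\<And>x. norm (U x) \<le> K * norm x" "surj U"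
      "\<And>k. U (e k) = f k"
      using synthesis_operator[OF f] by blast
    obtain g where "names_recursively ?\<alpha> g (\<lambda>k. U (e k))" using cf unfolding seq U(4) by blast
    then show ?thesis
      using computable_of_bounded[OF U(1,2)] U unfolding computable_operator_def
      by (intro exI[of _ U]) auto
  qed
  moreover have "computable_frame TYPE('s) smul ip e (\<lambda>k. U (e k))"
    if "computable_operator TYPE('s) smul e U" "surj U" for U
  proof -
    have lin: "Vector_Spaces.linear smul smul U"
      and comp: "computable (cauchy_rep ?\<alpha> :: (nat \<Rightarrow> 's) \<rightharpoonup> 'h) (cauchy_rep ?\<alpha>) (\<lambda>x. Some (U x))"
      using that(1) unfolding computable_operator_def hilbert_rep_def by blast+
    have dense: "closure (range ?\<alpha>) = UNIV"
      using assms(1) by (simp add: computable_hilbert_space_def computable_metric_space_def)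
    have "?\<alpha> 0 = 0"
      by (subst rational_combination_coefficient[OF vector_space_axioms order_refl])
        (simp add: coefficient_def pair_0 scalar_numbering_0)
    then obtain r where "r > 0" "\<And>y. norm y \<le> r \<Longrightarrow> dist (U y) (U 0) \<le> 2"
      using computable_locally_bounded[OF comp dense] by blast
    moreover have "U 0 = 0"
      using lin unfolding Vector_Spaces.linear_iff by (metis add_cancel_right_right)
    ultimately have "norm (U x) \<le> (2 / r) * norm x" for x
      by (intro bounded_if_locally_bounded[OF lin]) auto
    then have "is_frame ip (\<lambda>k. U (e k))" by (rule frame_of_surjective[OF lin _ that(2)])
    moreover have "computable_hilbert_sequence TYPE('s) smul e (\<lambda>k. U (e k))"
      using computable_operator_sequence[OF comp] assms(2)
      unfolding computable_hilbert_sequence_def hilbert_rep_def by blast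
    ultimately show ?thesis by (simp add: computable_frame_def)
  qed
  ultimately show ?thesis by blast
qed

end
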